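(* Let $\mathbb{F}$ be a field of characteristic $p=3$, let $r\ge 1$, let $\underline{n}=(n_1,\ldots,n_{2r})$ be a tuple of positive integers with $|\underline{n}|=n_1+\cdots+n_{2r}$, and let $\mathfrak{g}=H(2r;\underline{n})^{(2)}$ be the Hamiltonian Lie algebra over $\mathbb{F}$. Then for $r>1$ the outer derivation algebra $\mathrm{Out}(\mathfrak{g})$ is $2$-step solvable, and for $r=1$ and $1<n_1\le n_2$ it is $3$-step solvable. More precisely, as Lie algebras, $$ \mathrm{Out}(\mathfrak{g})\cong \begin{cases} (\mathfrak{h}_3(\mathbb{F})\rtimes \mathbb{F})\oplus \mathbb{F}^{|\underline{n}|-2}, & \text{if } r=1,\ 1<n_1\le n_2,\\ (\mathbb{F}^{2r+1}\rtimes \mathbb{F})\oplus \mathbb{F}^{|\underline{n}|-2r}, & \text{if } r>1,\ r\equiv 0 \bmod 3,\\ (\mathbb{F}^{2r+1}\rtimes \mathbb{F})\oplus \mathbb{F}^{|\underline{n}|-2r}, & \text{if } r>1,\ r\equiv 1 \bmod 3,\\ (\mathbb{F}^{2r}\rtimes \mathbb{F})\oplus \mathbb{F}^{|\underline{n}|-2r+1}, & \text{if } r>1,\ r\equiv 2 \bmod 3. \end{cases} $$ Here in the first case $\mathbb{F}$ acts on $\mathfrak{h}_3(\mathbb{F})$ by the derivation $D=\mathrm{diag}(1,1,-1)$ (with respect to the basis $e_1,e_2,e_3$), in the second case $\mathbb{F}$ acts on $\mathbb{F}^{2r+1}$ by the derivation $D=\mathrm{id}$, in the third case $\mathbb{F}$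 acts on $\mathbb{F}^{2r+1}$ by the derivation $D=\mathrm{diag}(1,\ldots,1,-1)$, and in the last case $\mathbb{F}$ acts on $\mathbb{F}^{2r}$ by the derivation $D=\mathrm{id}$.
   Context: For a finite-dimensional Lie algebra $\mathfrak{g}$ over a field $\mathbb{F}$, $\mathrm{Der}(\mathfrak{g})$ is the Lie algebra of $\mathbb{F}$-linear derivations of $\mathfrak{g}$, $\mathrm{ad}(\mathfrak{g})$ is its ideal of inner derivations, and $\mathrm{Out}(\mathfrak{g})=\mathrm{Der}(\mathfrak{g})/\mathrm{ad}(\mathfrak{g})$ is the outer derivation algebra. A Lie algebra is called $k$-step solvable if it is solvable of derived length $k$. $\mathfrak{h}_3(\mathbb{F})$ is the Heisenberg Lie algebra with basis $\{e_1,e_2,e_3\}$ and bracket $[e_1,e_2]=e_3$ (with $e_3$ central). $\mathbb{F}^k$ denotes the abelian Lie algebra of dimension $k$. For a Lie algebra $\mathfrak{a}$ and a derivation $D$ of $\mathfrak{a}$, the semidirect product $\mathfrak{a}\rtimes\mathbb{F}$ in which $\mathbb{F}$ acts by $D$ is $\mathfrak{a}\oplus\mathbb{F}t$ as a vector space, with $\mathfrak{a}$ an ideal carrying its given bracket and $[t,v]=D(v)$ for $v\in\mathfrak{a}$. An outer $\oplus$ denotes the direct sum of Lie algebras. Hamiltonian algebras. Let $\mathbb{F}$ have characteristic $p>2$, let $m=2r$ with $r\ge 1$, and let $\underline{n}=(n_1,\ldots,n_m)$ be a tuple of positive integers with $|\underline{n}|=n_1+\cdots+n_m$. The divided power algebra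 $\mathcal{O}(m;\underline{n})$ is the commutative associative unital $\mathbb{F}$-algebra with basis $\{x^{(a)} : a=(a_1,\ldots,a_m),\ a_i\in\mathbb{Z},\ 0\le a_i<p^{n_i}\}$ and product $x^{(a)}x^{(b)}=\binom{a+b}{b}x^{(a+b)}$, where $\binom{a}{b}=\prod_{i=1}^m\binom{a_i}{b_i}$ and $x^{(c)}=0$ if $c_i\ge p^{n_i}$ for some $i$. Let $\varepsilon_i=(\delta_{i,1},\ldots,\delta_{i,m})$, and let $\partial_i$ be the derivation of $\mathcal{O}(m;\underline{n})$ with $\partial_i(x^{(a)})=x^{(a-\varepsilon_i)}$ (which is $0$ if $a_i=0$). The generalized Jacobson-Witt algebra is $W(m;\underline{n})=\sum_{i=1}^m\mathcal{O}(m;\underline{n})\partial_i$, with the commutator bracket of derivations. Put $\sigma(i)=1$ and $i'=i+r$ for $1\le i\le r$, and $\sigma(i)=-1$ and $i'=i-r$ for $r+1\le i\le 2r$. Define the linear map $D_H\colon\mathcal{O}(2r;\underline{n})\to W(2r;\underline{n})$ by $D_H(x^{(a)})=\sum_{i=1}^{2r}\sigma(i)\,\partial_i(x^{(a)})\,\partial_{i'}$. Let $\tau(\underline{n})=(p^{n_1}-1,\ldots,p^{n_m}-1)$. The Hamiltonian algebra is $$H(2r;\underline{n})^{(2)}=\mathrm{span}\{D_H(x^{(a)}) : 0<a<\tau(\underline{n})\},$$ where $0<a<\tau(\underline{n})$ means $0\le a_i\le p^{n_i}-1$ for all $i$, with $a\ne 0$ and $a\neq\tau(\underline{n})$. It is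 a Lie subalgebra of $W(2r;\underline{n})$ of dimension $p^{|\underline{n}|}-2$, with bracket $[D_H(x^{(a)}),D_H(x^{(b)})]=D_H\big(D_H(x^{(a)})(x^{(b)})\big)$. The case needed here is $p=3$. *)

theory Defs
  imports "HOL-Computational_Algebra.Computational_Algebra" "HOL-Library.FuncSet"
begin

section \<open>Lie algebras over a field\<close>

record ('k, 'v) lie_struct =
  lcarrier :: "'v set"
  lzero :: 'v
  ladd :: "'v \<Rightarrow> 'v \<Rightarrow> 'v"
  lscale :: "'k \<Rightarrow> 'v \<Rightarrow> 'v"
  lbracket :: "'v \<Rightarrow> 'v \<Rightarrow> 'v"

locale lie_algebra =
  fixes L :: "('k::field, 'v) lie_struct"
  assumes zero_closed: "lzero L \<in> lcarrier L"
    and add_closed: "\<lbrakk>x \<in> lcarrier L; y \<in> lcarrier L\<rbrakk> \<Longrightarrow> ladd L x y \<in> lcarrier L"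
    and scale_closed: "x \<in> lcarrier L \<Longrightarrow> lscale L c x \<in> lcarrier L"
    and bracket_closed: "\<lbrakk>x \<in> lcarrier L; y \<in> lcarrier L\<rbrakk> \<Longrightarrow> lbracket L x y \<in> lcarrier L"
    and add_assoc: "\<lbrakk>x \<in> lcarrier L; y \<in> lcarrier L; z \<in> lcarrier L\<rbrakk>
      \<Longrightarrow> ladd L (ladd L x y) z = ladd L x (ladd L y z)"
    and add_commute: "\<lbrakk>x \<in> lcarrier L; y \<in> lcarrier L\<rbrakk> \<Longrightarrow> ladd L x y = ladd L y x"
    and add_zero: "x \<in> lcarrier L \<Longrightarrow> ladd L (lzero L) x = x"
    and add_minus: "x \<in> lcarrier L \<Longrightarrow> ladd L x (lscale L (-1) x) = lzero L"
    and scale_add_right: "\<lbrakk>x \<in> lcarrier L; y \<in> lcarrier L\<rbrakk>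
      \<Longrightarrow> lscale L c (ladd L x y) = ladd L (lscale L c x) (lscale L c y)"
    and scale_add_left: "x \<in> lcarrier L \<Longrightarrow> lscale L (c + d) x = ladd L (lscale L c x) (lscale L d x)"
    and scale_scale: "x \<in> lcarrier L \<Longrightarrow> lscale L c (lscale L d x) = lscale L (c * d) x"
    and scale_one: "x \<in> lcarrier L \<Longrightarrow> lscale L 1 x = x"
    and bracket_add_left: "\<lbrakk>x \<in> lcarrier L; y \<in> lcarrier L; z \<in> lcarrier L\<rbrakk>
      \<Longrightarrow> lbracket L (ladd L x y) z = ladd L (lbracket L x z) (lbracket L y z)"
    and bracket_add_right: "\<lbrakk>x \<in> lcarrier L; y \<in> lcarrier L; z \<in> lcarrier L\<rbrakk>
      \<Longrightarrow> lbracket L x (ladd L y z) = ladd L (lbracket L x y) (lbracket L x z)"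
    and bracket_scale_left: "\<lbrakk>x \<in> lcarrier L; y \<in> lcarrier L\<rbrakk>
      \<Longrightarrow> lbracket L (lscale L c x) y = lscale L c (lbracket L x y)"
    and bracket_scale_right: "\<lbrakk>x \<in> lcarrier L; y \<in> lcarrier L\<rbrakk>
      \<Longrightarrow> lbracket L x (lscale L c y) = lscale L c (lbracket L x y)"
    and bracket_self: "x \<in> lcarrier L \<Longrightarrow> lbracket L x x = lzero L"
    and jacobi: "\<lbrakk>x \<in> lcarrier L; y \<in> lcarrier L; z \<in> lcarrier L\<rbrakk>
      \<Longrightarrow> ladd L (lbracket L x (lbracket L y z))
            (ladd L (lbracket L y (lbracket L z x)) (lbracket L z (lbracket L x y))) = lzero L"

definition lie_isomorphism ::
    "('k::field, 'v) lie_struct \<Rightarrow> ('k, 'w) lie_struct \<Rightarrow> ('v \<Rightarrow> 'w) \<Rightarrow> bool" where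
  "lie_isomorphism L M \<phi> \<longleftrightarrow>
     bij_betw \<phi> (lcarrier L) (lcarrier M) \<and>
     (\<forall>x\<in>lcarrier L. \<forall>y\<in>lcarrier L. \<phi> (ladd L x y) = ladd M (\<phi> x) (\<phi> y)) \<and>
     (\<forall>c. \<forall>x\<in>lcarrier L. \<phi> (lscale L c x) = lscale M c (\<phi> x)) \<and>
     (\<forall>x\<in>lcarrier L. \<forall>y\<in>lcarrier L. \<phi> (lbracket L x y) = lbracket M (\<phi> x) (\<phi> y))"

definition lie_isomorphic ::
    "('k::field, 'v) lie_struct \<Rightarrow> ('k, 'w) lie_struct \<Rightarrow> bool"  (infix "\<cong>\<^sub>L" 50) where
  "L \<cong>\<^sub>L M \<longleftrightarrow> (\<exists>\<phi>. lie_isomorphism L M \<phi>)"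

definition lie_subspace :: "('k::field, 'v) lie_struct \<Rightarrow> 'v set \<Rightarrow> bool" where
  "lie_subspace L U \<longleftrightarrow> U \<subseteq> lcarrier L \<and> lzero L \<in> U \<and>
     (\<forall>x\<in>U. \<forall>y\<in>U. ladd L x y \<in> U) \<and> (\<forall>c. \<forall>x\<in>U. lscale L c x \<in> U)"

definition lie_span :: "('k::field, 'v) lie_struct \<Rightarrow> 'v set \<Rightarrow> 'v set" where
  "lie_span L S = lie_subspace L hull S"

primrec derived_series :: "('k::field, 'v) lie_struct \<Rightarrow> nat \<Rightarrow> 'v set" where
  "derived_series L 0 = lcarrier L"
| "derived_series L (Suc k) =
     lie_span L {lbracket L x y | x y. x \<in> derived_series L k \<and> y \<in> derived_series L k}"

definition lie_solvable :: "('k::field, 'v) lie_struct \<Rightarrow> bool" where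
  "lie_solvable L \<longleftrightarrow> (\<exists>k. derived_series L k = {lzero L})"

definition derived_length :: "('k::field, 'v) lie_struct \<Rightarrow> nat" where
  "derived_length L = (LEAST k. derived_series L k = {lzero L})"

definition step_solvable :: "nat \<Rightarrow> ('k::field, 'v) lie_struct \<Rightarrow> bool" where
  "step_solvable k L \<longleftrightarrow> lie_solvable L \<and> derived_length L = k"


section \<open>Derivations and outer derivations\<close>

definition lie_derivation :: "('k::field, 'v) lie_struct \<Rightarrow> ('v \<Rightarrow> 'v) \<Rightarrow> bool" where
  "lie_derivation L D \<longleftrightarrow>
     D \<in> lcarrier L \<rightarrow> lcarrier L \<and>
     (\<forall>x\<in>lcarrier L. \<forall>y\<in>lcarrier L. D (ladd L x y) = ladd L (D x) (D y)) \<and>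
     (\<forall>c. \<forall>x\<in>lcarrier L. D (lscale L c x) = lscale L c (D x)) \<and>
     (\<forall>x\<in>lcarrier L. \<forall>y\<in>lcarrier L.
        D (lbracket L x y) = ladd L (lbracket L (D x) y) (lbracket L x (D y)))"

text \<open>Derivations are taken to be extensional functions on the carrier, so that equality of
  elements of the derivation algebra is equality of maps on the carrier.\<close>

definition Der :: "('k::field, 'v) lie_struct \<Rightarrow> ('k, 'v \<Rightarrow> 'v) lie_struct" where
  "Der L =
     \<lparr> lcarrier = {D \<in> extensional (lcarrier L). lie_derivation L D},
       lzero = (\<lambda>x\<in>lcarrier L. lzero L),
       ladd = (\<lambda>D E. \<lambda>x\<in>lcarrier L. ladd L (D x) (E x)),
       lscale = (\<lambda>c D. \<lambda>x\<in>lcarrier L. lscale L c (D x)),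
       lbracket = (\<lambda>D E. \<lambda>x\<in>lcarrier L. ladd L (D (E x)) (lscale L (-1) (E (D x)))) \<rparr>"

definition ad :: "('k::field, 'v) lie_struct \<Rightarrow> 'v \<Rightarrow> 'v \<Rightarrow> 'v" where
  "ad L x = (\<lambda>y\<in>lcarrier L. lbracket L x y)"

definition lie_coset :: "('k::field, 'v) lie_struct \<Rightarrow> 'v set \<Rightarrow> 'v \<Rightarrow> 'v set" where
  "lie_coset L I x = {ladd L x i | i. i \<in> I}"

definition lie_quotient ::
    "('k::field, 'v) lie_struct \<Rightarrow> 'v set \<Rightarrow> ('k, 'v set) lie_struct" where
  "lie_quotient L I =
     \<lparr> lcarrier = lie_coset L I ` lcarrier L,
       lzero = lie_coset L I (lzero L),
       ladd = (\<lambda>A B. \<Union>a\<in>A. \<Union>b\<in>B. lie_coset L I (ladd L a b)),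
       lscale = (\<lambda>c A. \<Union>a\<in>A. lie_coset L I (lscale L c a)),
       lbracket = (\<lambda>A B. \<Union>a\<in>A. \<Union>b\<in>B. lie_coset L I (lbracket L a b)) \<rparr>"

definition Out :: "('k::field, 'v) lie_struct \<Rightarrow> ('k, ('v \<Rightarrow> 'v) set) lie_struct" where
  "Out L = lie_quotient (Der L) (ad L ` lcarrier L)"


section \<open>The algebras on the right-hand side\<close>

text \<open>\<^term>\<open>abelian_lie k\<close> is the coordinate space of dimension \<^term>\<open>k\<close> with zero bracket; its
  coordinates are indexed by \<open>1, \<dots>, k\<close> and all other values of the functions are 0.\<close>

definition abelian_lie :: "nat \<Rightarrow> ('k::field, nat \<Rightarrow> 'k) lie_struct" where
  "abelian_lie k =
     \<lparr> lcarrier = {v. \<forall>i. i \<notin> {1..k} \<longrightarrow> v i = 0},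
       lzero = (\<lambda>i. 0),
       ladd = (\<lambda>v w i. v i + w i),
       lscale = (\<lambda>c v i. c * v i),
       lbracket = (\<lambda>v w i. 0) \<rparr>"

text \<open>Coordinates with respect to \<open>e\<^sub>1, e\<^sub>2, e\<^sub>3\<close>, where \<open>[e\<^sub>1, e\<^sub>2] = e\<^sub>3\<close> is central.\<close>

definition heisenberg_lie :: "('k::field, nat \<Rightarrow> 'k) lie_struct" where
  "heisenberg_lie =
     (abelian_lie 3)\<lparr> lbracket := (\<lambda>v w i. if i = 3 then v 1 * w 2 - v 2 * w 1 else 0) \<rparr>"

definition diag_map :: "(nat \<Rightarrow> 'k::field) \<Rightarrow> (nat \<Rightarrow> 'k) \<Rightarrow> nat \<Rightarrow> 'k" where
  "diag_map d v = (\<lambda>i. d i * v i)"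

text \<open>The pair \<^term>\<open>(v, s)\<close> stands for \<open>v + s t\<close>, where \<open>[t, v] = D v\<close>.\<close>

definition semidirect ::
    "('k::field, 'v) lie_struct \<Rightarrow> ('v \<Rightarrow> 'v) \<Rightarrow> ('k, 'v \<times> 'k) lie_struct" where
  "semidirect L D =
     \<lparr> lcarrier = lcarrier L \<times> UNIV,
       lzero = (lzero L, 0),
       ladd = (\<lambda>(v, s) (w, u). (ladd L v w, s + u)),
       lscale = (\<lambda>c (v, s). (lscale L c v, c * s)),
       lbracket = (\<lambda>(v, s) (w, u).
         (ladd L (lbracket L v w) (ladd L (lscale L s (D w)) (lscale L (- u) (D v))), 0)) \<rparr>"

definition lie_direct_sum ::
    "('k::field, 'v) lie_struct \<Rightarrow> ('k, 'w) lie_struct \<Rightarrow> ('k, 'v \<times> 'w) lie_struct"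
    (infixr "\<oplus>\<^sub>L" 65) where
  "L \<oplus>\<^sub>L M =
     \<lparr> lcarrier = lcarrier L \<times> lcarrier M,
       lzero = (lzero L, lzero M),
       ladd = (\<lambda>(v, v') (w, w'). (ladd L v w, ladd M v' w')),
       lscale = (\<lambda>c (v, v'). (lscale L c v, lscale M c v')),
       lbracket = (\<lambda>(v, v') (w, w'). (lbracket L v w, lbracket M v' w')) \<rparr>"

lemma lie_algebra_abelian: "lie_algebra (abelian_lie k)"
  by unfold_locales (auto simp: abelian_lie_def fun_eq_iff algebra_simps)

lemma lie_algebra_heisenberg: "lie_algebra heisenberg_lie"
  by unfold_locales (auto simp: heisenberg_lie_def abelian_lie_def fun_eq_iff algebra_simps)

lemma lie_algebra_direct_sum:
  assumes "lie_algebra L" "lie_algebra M"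
  shows "lie_algebra (L \<oplus>\<^sub>L M)"
proof -
  interpret L: lie_algebra L by fact
  interpret M: lie_algebra M by fact
  show ?thesis
    by unfold_locales
      (auto simp: lie_direct_sum_def
         intro: L.zero_closed L.add_closed L.scale_closed L.bracket_closed L.add_assoc
           L.add_commute L.add_zero L.add_minus L.scale_add_right L.scale_add_left
           L.scale_scale L.scale_one L.bracket_add_left L.bracket_add_right
           L.bracket_scale_left L.bracket_scale_right L.bracket_self L.jacobi
           M.zero_closed M.add_closed M.scale_closed M.bracket_closed M.add_assoc
           M.add_commute M.add_zero M.add_minus M.scale_add_right M.scale_add_left
           M.scale_scale M.scale_one M.bracket_add_left M.bracket_add_right
           M.bracket_scale_left M.bracket_scale_right M.bracket_self M.jacobi)
qed

lemma lie_derivation_diag_abelian: "lie_derivation (abelian_lie k) (diag_map d)"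
  by (auto simp: lie_derivation_def abelian_lie_def diag_map_def fun_eq_iff algebra_simps)

lemma lie_derivation_diag_heisenberg:
  assumes "d 3 = d 1 + d 2"
  shows "lie_derivation heisenberg_lie (diag_map d)"
  using assms by (auto simp: lie_derivation_def heisenberg_lie_def abelian_lie_def diag_map_def
      fun_eq_iff algebra_simps)


section \<open>Divided powers and Hamiltonian algebras\<close>

text \<open>A multi-index is a function supported on \<open>{1..m}\<close>, and \<open>f :: 'k dp\<close> stands for the
  linear combination of the \<open>x\<^sup>(\<^sup>a\<^sup>)\<close> with coefficients \<open>f a\<close>. The characteristic \<open>p\<close> is always that
  of the coefficient field. Only the values \<open>n 1, \<dots>, n m\<close> of the tuple are used.\<close>

type_synonym 'k dp = "(nat \<Rightarrow> nat) \<Rightarrow> 'k"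

definition dp_indices :: "nat \<Rightarrow> nat \<Rightarrow> (nat \<Rightarrow> nat) \<Rightarrow> (nat \<Rightarrow> nat) set" where
  "dp_indices p m n = {a. (\<forall>i\<in>{1..m}. a i < p ^ n i) \<and> (\<forall>i. i \<notin> {1..m} \<longrightarrow> a i = 0)}"

definition dp_algebra :: "nat \<Rightarrow> (nat \<Rightarrow> nat) \<Rightarrow> 'k::field dp set" where
  "dp_algebra m n = {f. \<forall>a. a \<notin> dp_indices CHAR('k) m n \<longrightarrow> f a = 0}"

definition dp_monom :: "(nat \<Rightarrow> nat) \<Rightarrow> 'k::field dp" where
  "dp_monom a = (\<lambda>b. if b = a then 1 else 0)"

definition dp_mult :: "nat \<Rightarrow> (nat \<Rightarrow> nat) \<Rightarrow> 'k::field dp \<Rightarrow> 'k dp \<Rightarrow> 'k dp" where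
  "dp_mult m n f g = (\<lambda>c.
     let I = dp_indices CHAR('k) m n in
     if c \<in> I then
       (\<Sum>(a, b) \<in> {(a, b) \<in> I \<times> I. \<forall>i. a i + b i = c i}.
          of_nat (\<Prod>i = 1..m. c i choose b i) * f a * g b)
     else 0)"

text \<open>\<open>\<partial>\<^sub>i x\<^sup>(\<^sup>b\<^sup>) = x\<^sup>(\<^sup>b\<^sup>-\<^sup>\<epsilon>\<^sup>)\<close> means that the coefficient of \<open>\<partial>\<^sub>i f\<close> at \<open>a\<close> is that of \<open>f\<close> at
  \<open>a + \<epsilon>\<^sub>i\<close>.\<close>

definition dp_partial :: "nat \<Rightarrow> (nat \<Rightarrow> nat) \<Rightarrow> nat \<Rightarrow> 'k::field dp \<Rightarrow> 'k dp" where
  "dp_partial m n i f = (\<lambda>a.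
     if a(i := Suc (a i)) \<in> dp_indices CHAR('k) m n then f (a(i := Suc (a i))) else 0)"

text \<open>Elements of the Jacobson-Witt algebra are derivations of the divided power algebra. They
  are represented as maps on all of \<^typ>\<open>'k dp\<close>; as \<^const>\<open>dp_partial\<close> ignores the values of
  its argument outside the multi-indices, such a map is determined by its restriction to
  \<^term>\<open>dp_algebra m n\<close>, into which it maps.\<close>

definition jacobson_witt ::
    "nat \<Rightarrow> (nat \<Rightarrow> nat) \<Rightarrow> ('k::field, 'k dp \<Rightarrow> 'k dp) lie_struct" where
  "jacobson_witt m n =
     \<lparr> lcarrier = {(\<lambda>g a. \<Sum>i = 1..m. dp_mult m n (f i) (dp_partial m n i g) a) | f.
                   \<forall>i\<in>{1..m}. f i \<in> dp_algebra m n},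
       lzero = (\<lambda>g a. 0),
       ladd = (\<lambda>D E g a. D g a + E g a),
       lscale = (\<lambda>c D g a. c * D g a),
       lbracket = (\<lambda>D E g a. D (E g) a - E (D g) a) \<rparr>"

definition ham_sign :: "nat \<Rightarrow> nat \<Rightarrow> 'k::field" where
  "ham_sign r i = (if i \<le> r then 1 else - 1)"

definition ham_conj :: "nat \<Rightarrow> nat \<Rightarrow> nat" where
  "ham_conj r i = (if i \<le> r then i + r else i - r)"

definition D_H :: "nat \<Rightarrow> (nat \<Rightarrow> nat) \<Rightarrow> 'k::field dp \<Rightarrow> 'k dp \<Rightarrow> 'k dp" where
  "D_H r n f = (\<lambda>g a. \<Sum>i = 1..2 * r.
     ham_sign r i *
       dp_mult (2 * r) n (dp_partial (2 * r) n i f) (dp_partial (2 * r) n (ham_conj r i) g) a)"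

text \<open>By the next lemma, the \<^const>\<open>lie_span\<close> in the definition of the Hamiltonian algebra below is the
  usual linear span: the hull is taken over subspaces of the carrier.\<close>

lemma D_H_in_jacobson_witt:
  "D_H r n f \<in> lcarrier (jacobson_witt (2 * r) n)"
proof -
  define F where
    "F j = (\<lambda>a. ham_sign r (ham_conj r j) * dp_partial (2 * r) n (ham_conj r j) f a)" for j
  have scale: "dp_mult (2 * r) n (\<lambda>a. c * u a) v b = c * dp_mult (2 * r) n u v b"
    for c :: 'a and u v :: "'a dp" and b
    by (auto simp: dp_mult_def Let_def sum_distrib_left algebra_simps intro!: sum.cong)
  have "D_H r n f g a = (\<Sum>j = 1..2 * r. dp_mult (2 * r) n (F j) (dp_partial (2 * r) n j g) a)"
    for g a
    unfolding D_H_def F_def scale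
    by (rule sum.reindex_bij_witness[of _ "ham_conj r" "ham_conj r"])
      (auto simp: ham_conj_def)
  then have "D_H r n f = (\<lambda>g a. \<Sum>j = 1..2 * r. dp_mult (2 * r) n (F j) (dp_partial (2 * r) n j g) a)"
    by (intro ext)
  moreover have "F j \<in> dp_algebra (2 * r) n" if "j \<in> {1..2 * r}" for j
  proof -
    have idx: "a \<in> dp_indices p m n" if "a(i := Suc (a i)) \<in> dp_indices p m n" "i \<in> {1..m}"
      for a i p m
      unfolding dp_indices_def
    proof (intro CollectI conjI ballI allI impI)
      fix k
      have *: "(\<forall>k\<in>{1..m}. (a(i := Suc (a i))) k < p ^ n k) \<and>
          (\<forall>k. k \<notin> {1..m} \<longrightarrow> (a(i := Suc (a i))) k = 0)"
        using that(1) by (simp only: dp_indices_def mem_Collect_eq)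
      show "a k < p ^ n k" if "k \<in> {1..m}"
        using conjunct1[OF *, rule_format, OF that] by (cases "k = i") auto
      show "a k = 0" if "k \<notin> {1..m}"
        using conjunct2[OF *, rule_format, OF that] by (cases "k = i") auto
    qed
    have j: "ham_conj r j \<in> {1..2 * r}"
      using that by (auto simp: ham_conj_def)
    have "F j a = 0" if "a \<notin> dp_indices CHAR('a) (2 * r) n" for a
    proof -
      have "a(ham_conj r j := Suc (a (ham_conj r j))) \<notin> dp_indices CHAR('a) (2 * r) n"
        using idx[OF _ j] that by blast
      then show ?thesis
        unfolding F_def dp_partial_def by (simp only: if_False mult_zero_right)
    qed
    then show ?thesis
      unfolding dp_algebra_def by blast
  qed
  ultimately show ?thesis
    unfolding jacobson_witt_def lie_struct.simps mem_Collect_eq by blast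
qed

definition dp_top :: "nat \<Rightarrow> nat \<Rightarrow> (nat \<Rightarrow> nat) \<Rightarrow> nat \<Rightarrow> nat" where
  "dp_top p m n = (\<lambda>i. if i \<in> {1..m} then p ^ n i - 1 else 0)"

definition hamiltonian ::
    "nat \<Rightarrow> (nat \<Rightarrow> nat) \<Rightarrow> ('k::field, 'k dp \<Rightarrow> 'k dp) lie_struct" where
  "hamiltonian r n = (jacobson_witt (2 * r) n)
     \<lparr> lcarrier := lie_span (jacobson_witt (2 * r) n)
         {D_H r n (dp_monom a) | a. a \<in> dp_indices CHAR('k) (2 * r) n \<and>
            a \<noteq> (\<lambda>i. 0) \<and> a \<noteq> dp_top CHAR('k) (2 * r) n} \<rparr>"

end

theory Submission
  imports Defs
begin

text \<open>
  Modulo constants the Hamiltonian algebra is the space of truncated divided power polynomials without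
  top term under the Poisson bracket. Let \<open>T\<close> be a derivation. Bracketing with the variables gives
  the partial derivatives, so the images of the variables form a 1-form that is closed up to a
  constant 2-form. The latter is a multiple of the symplectic form and is removed by the degree
  derivation; the primitive of the remaining closed 1-form is a truncated polynomial plus multiples
  of the monomials \<open>x\<^sub>j\<^sup>(\<^sup>q\<^sup>)\<close>, \<open>q = 3\<^sup>n\<close>, so up to an inner derivation and brackets with the top
  monomial and with these monomials, \<open>T\<close> commutes with all partial derivatives.
  Such a \<open>T\<close> is determined by its linear part, which after a further inner correction is equivariant
  under the quadratic polynomials and vanishes on brackets of polynomials of degree at least 3. Weights
  modulo 3 and a few explicit brackets then show that \<open>T\<close> is a combination of the \<open>3\<^sup>j\<close>-th powers of
  the partial derivatives with \<open>j \<ge> 1\<close>. The brackets of the outer derivations so obtained are read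
  off from \<open>[D, ad u] = ad (D u)\<close>; the element \<open>ad x\<^sup>\<tau>\<close> has degree \<open>r + 1\<close> modulo 3 and is a
  commutator of the two top power derivations exactly if \<open>r = 1\<close>.
\<close>

section \<open>Divided power series\<close>

text \<open>All derivations are computed on functions and carried to the algebra of operators only
  at the end. Modulo inner derivations a derivation has four kinds of coordinates: the coefficients
  \<open>w\<close> of the x_j^(q_j), \<open>z\<close> of x^(tau), \<open>s\<close> of the degree
  derivation and \<open>v\<close> of the powers of the partial derivatives, in total 2r + 1 + 1 +
  (|n| - 2r). A single commutator formula in these coordinates serves every case of the theorem; the
  cases differ only by the scalar r + 1 and by one extra term for r = 1. If r is 2 modulo 3 the
  scalar is 0 and the \<open>z\<close>-line moves to the abelian summand.

  The obstacle is the characteristic: weights under the quadratic polynomials are visible only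
  modulo 3. Exponents with entries q - 1 survive all arguments with quadratics and have to be
  excluded by brackets with a suitable cubic, chosen differently for r = 1 and for r > 1.\<close>

definition fin_index :: "(nat \<Rightarrow> nat) \<Rightarrow> bool" where
  "fin_index a \<longleftrightarrow> finite {i. a i \<noteq> 0}"

definition inc :: "nat \<Rightarrow> (nat \<Rightarrow> nat) \<Rightarrow> nat \<Rightarrow> nat" where
  "inc i a = a(i := Suc (a i))"

definition dec :: "nat \<Rightarrow> (nat \<Rightarrow> nat) \<Rightarrow> nat \<Rightarrow> nat" where
  "dec i a = a(i := a i - 1)"

definition add_index :: "(nat \<Rightarrow> nat) \<Rightarrow> (nat \<Rightarrow> nat) \<Rightarrow> nat \<Rightarrow> nat" where
  "add_index a b = (\<lambda>i. a i + b i)"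

definition sub_index :: "(nat \<Rightarrow> nat) \<Rightarrow> (nat \<Rightarrow> nat) \<Rightarrow> nat \<Rightarrow> nat" where
  "sub_index a b = (\<lambda>i. a i - b i)"

definition zero_index :: "nat \<Rightarrow> nat" where
  "zero_index = (\<lambda>i. 0)"

lemma inc_apply: "inc i a j = (if j = i then Suc (a i) else a j)"
  by (simp add: inc_def)

lemma dec_apply: "dec i a j = (if j = i then a i - 1 else a j)"
  by (simp add: dec_def)

lemma add_index_apply [simp]: "add_index a b i = a i + b i"
  by (simp add: add_index_def)

lemma sub_index_apply [simp]: "sub_index a b i = a i - b i"
  by (simp add: sub_index_def)

lemma zero_index_apply [simp]: "zero_index i = 0"
  by (simp add: zero_index_def)

lemma inc_inc: "inc i (inc j a) = inc j (inc i a)"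
  by (auto simp: fun_eq_iff inc_apply)

lemma inc_dec: "a i > 0 \<Longrightarrow> inc i (dec i a) = a"
  by (auto simp: fun_eq_iff inc_apply dec_apply)

lemma dec_inc [simp]: "dec i (inc i a) = a"
  by (auto simp: fun_eq_iff inc_apply dec_apply)

lemma inc_inject [simp]: "inc i a = inc i b \<longleftrightarrow> a = b"
  by (metis dec_inc)

lemma inc_neq_zero [simp]: "inc i a \<noteq> zero_index" "zero_index \<noteq> inc i a"
  by (auto simp: fun_eq_iff inc_apply)

lemma fin_index_zero [simp]: "fin_index zero_index"
  by (simp add: fin_index_def)

lemma fin_index_inc [simp]: "fin_index (inc i a) = fin_index a"
proof -
  have "{j. inc i a j \<noteq> 0} = insert i {j. a j \<noteq> 0}"
    by (auto simp: inc_apply)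
  then show ?thesis by (simp add: fin_index_def)
qed

lemma fin_index_le: "fin_index a \<Longrightarrow> b \<le> a \<Longrightarrow> fin_index b"
  unfolding fin_index_def le_fun_def
  by (erule rev_finite_subset) (metis (mono_tags, lifting) Collect_mono le_zero_eq)

lemma fin_index_dec [simp]: "fin_index a \<Longrightarrow> fin_index (dec i a)"
  by (erule fin_index_le) (auto simp: le_fun_def dec_apply)

lemma fin_index_add [simp]: "fin_index a \<Longrightarrow> fin_index b \<Longrightarrow> fin_index (add_index a b)"
  unfolding fin_index_def
  by (rule finite_subset[of _ "{i. a i \<noteq> 0} \<union> {i. b i \<noteq> 0}"]) auto

lemma fin_index_sub [simp]: "fin_index a \<Longrightarrow> fin_index (sub_index a b)"
  by (erule fin_index_le) (auto simp: le_fun_def)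

text \<open>Induction on the total degree. Combined with the Leibniz rule it replaces manipulations
  of convolution sums: an identity at \<open>inc i c\<close> is the identity of the i-th derivatives
  at \<open>c\<close>.\<close>

lemma index_induct [consumes 1, case_names zero inc]:
  assumes "fin_index c" "P zero_index" "\<And>i c. fin_index c \<Longrightarrow> P c \<Longrightarrow> P (inc i c)"
  shows "P c"
  using assms(1)
proof (induction "\<Sum>i | c i \<noteq> 0. c i" arbitrary: c rule: less_induct)
  case less
  show ?case
  proof (cases "c = zero_index")
    case False
    then obtain i where i: "c i > 0"
      by (auto simp: fun_eq_iff)
    have fin: "finite {i. c i \<noteq> 0}"
      using less.prems by (simp add: fin_index_def)
    \<comment> \<open>Lowering \<open>i\<close> may remove it from the support, so the new degree is
      first rewritten as a sum over the old support.\<close>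
    have "(\<Sum>j | dec i c j \<noteq> 0. dec i c j) = (\<Sum>j | c j \<noteq> 0. dec i c j)"
      by (rule sum.mono_neutral_left) (use fin i in \<open>auto simp: dec_apply split: if_splits\<close>)
    also have "\<dots> < (\<Sum>j | c j \<noteq> 0. c j)"
      by (rule sum_strict_mono_ex1) (use fin i in \<open>auto simp: dec_apply\<close>)
    finally have "P (dec i c)"
      using less by simp
    then show ?thesis
      using assms(3)[of "dec i c" i] less.prems i by (simp add: inc_dec)
  qed (use assms(2) in simp)
qed

lemma dec_le_of_le_inc: "a \<le> inc i c \<Longrightarrow> dec i a \<le> c"
  unfolding le_fun_def
proof
  fix j assume "\<forall>j. a j \<le> inc i c j"
  from spec[OF this, of j] show "dec i a j \<le> c j"
    by (cases "j = i") (auto simp: dec_apply inc_apply)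
qed

lemma le_inc_imp: "a \<le> inc i c \<Longrightarrow> \<not> a \<le> c \<Longrightarrow> c i < a i"
  unfolding le_fun_def inc_apply by (metis not_le)

lemma le_add_sub_index: "a \<le> c \<Longrightarrow> add_index a (sub_index c a) = c"
  by (auto simp: fun_eq_iff le_fun_def)

lemma sub_add_index [simp]: "sub_index (add_index a b) a = b"
  by (simp add: fun_eq_iff)

lemma le_add_index [simp]: "a \<le> add_index a b" "b \<le> add_index a b"
  by (simp_all add: le_fun_def)

lemma finite_index_le: "fin_index c \<Longrightarrow> finite {a. a \<le> c}"
proof (induction rule: index_induct)
  case zero
  have "{a. a \<le> zero_index} = {zero_index}"
    by (auto simp: le_fun_def fun_eq_iff)
  then show ?case by (metis finite.simps)
next
  case (inc i c)
  have "{a. a \<le> inc i c} \<subseteq> {a. a \<le> c} \<union> inc i ` {a. a \<le> c}"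
  proof
    fix a assume a: "a \<in> {a. a \<le> inc i c}"
    show "a \<in> {a. a \<le> c} \<union> inc i ` {a. a \<le> c}"
    proof (cases "a i = Suc (c i)")
      case True
      then have "a = inc i (dec i a)" "dec i a \<le> c"
        using a by (auto simp: inc_dec le_fun_def dec_apply inc_apply split: if_splits)
      then show ?thesis by blast
    next
      case False
      then have "a \<le> c"
        using a unfolding le_fun_def inc_apply mem_Collect_eq by (metis le_SucE)
      then show ?thesis by simp
    qed
  qed
  then show ?case
    using inc by (meson finite_UnI finite_imageI finite_subset)
qed

text \<open>Multiplying over the support of \<open>c\<close> keeps the product finite; for
  \<open>a \<le> c\<close> the omitted factors are 0 choose 0. For other \<open>a\<close> the value
  may differ from the full product, hence the guards \<open>a \<le> c\<close> below.\<close>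

definition binom_index :: "(nat \<Rightarrow> nat) \<Rightarrow> (nat \<Rightarrow> nat) \<Rightarrow> nat" where
  "binom_index c a = (\<Prod>i | c i \<noteq> 0. c i choose a i)"

lemma binom_index_superset:
  assumes "finite S" "{i. c i \<noteq> 0} \<subseteq> S" "a \<le> c"
  shows "binom_index c a = (\<Prod>i\<in>S. c i choose a i)"
  unfolding binom_index_def
proof (rule prod.mono_neutral_left)
  have "a i \<le> c i" for i
    using assms(3) by (simp add: le_fun_def)
  then show "\<forall>i\<in>S - {i. c i \<noteq> 0}. (c i choose a i) = 1"
    by (metis (mono_tags, lifting) DiffD2 binomial_n_0 le_zero_eq mem_Collect_eq)
qed (use assms in auto)

lemma binom_index_zero [simp]: "binom_index c zero_index = 1"
  by (simp add: binom_index_def)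

text \<open>Pascal's rule in the i-th factor, all other factors being equal. Given
  \<open>a \<le> inc i c\<close>, the guard \<open>a \<le> c\<close> fails only if
  \<open>a i\<close> is \<open>c i + 1\<close>, where the omitted binomial coefficient is 0.\<close>

lemma binom_index_Pascal:
  assumes c: "fin_index c" and a: "a \<le> inc i c"
  shows "binom_index (inc i c) a =
    (if a \<le> c then binom_index c a else 0) + (if a i > 0 then binom_index c (dec i a) else 0)"
proof -
  let ?S = "insert i {j. c j \<noteq> 0}"
  let ?P = "\<lambda>c a. \<Prod>j\<in>?S - {i}. c j choose a j"
  have S: "finite ?S"
    using c by (simp add: fin_index_def)
  have ext: "binom_index d b = (d i choose b i) * ?P d b" if "b \<le> d" "{j. d j \<noteq> 0} \<subseteq> ?S" for d b
    using binom_index_superset[OF S that(2) that(1)] prod.remove[OF S, of i "\<lambda>j. d j choose b j"]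
    by simp
  have P1: "?P (inc i c) a = ?P c a" "?P c (dec i a) = ?P c a"
    by (auto intro!: prod.cong simp: inc_apply dec_apply)
  have inc: "binom_index (inc i c) a = (Suc (c i) choose a i) * ?P c a"
  proof -
    have "{j. inc i c j \<noteq> 0} \<subseteq> ?S"
      by (auto simp: inc_apply)
    from ext[OF a this] show ?thesis
      unfolding P1 by (simp add: inc_apply[of i c i])
  qed
  have 1: "(if a \<le> c then binom_index c a else 0) = (c i choose a i) * ?P c a"
  proof (cases "a \<le> c")
    case False
    then have "a i > c i"
      using le_inc_imp[OF a] by simp
    then show ?thesis using False by simp
  qed (use ext[of a c] in auto)
  have 2: "binom_index c (dec i a) = (c i choose (a i - 1)) * ?P c a" if "a i > 0"
  proof -
    have "dec i a \<le> c"
      using a by (rule dec_le_of_le_inc)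
    from ext[OF this] show ?thesis
      using P1 by (simp add: dec_apply insert_absorb subset_insertI)
  qed
  show ?thesis
    unfolding inc 1 using 2 by (cases "a i") (auto simp: algebra_simps)
qed

text \<open>Working with untruncated series keeps \<open>x\<^sub>j\<^sup>(\<^sup>q\<^sup>)\<close>, \<open>q = 3\<^sup>n\<close>, available: the outer derivation
  \<open>x\<^sub>j\<^sup>(\<^sup>q\<^sup>-\<^sup>1\<^sup>)\<partial>\<^sub>j\<^sub>'\<close> becomes a Poisson bracket. Only finitely supported multi-indices are allowed
  to carry coefficients; otherwise there would be no unit.\<close>

typedef (overloaded) 'k dps = "{f :: (nat \<Rightarrow> nat) \<Rightarrow> 'k::zero. \<forall>a. \<not> fin_index a \<longrightarrow> f a = 0}"
  morphisms coef Abs_dps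
  by (rule exI[of _ "\<lambda>_. 0"]) simp

setup_lifting type_definition_dps

lemma coef_not_fin: "\<not> fin_index a \<Longrightarrow> coef f a = 0"
  using coef[of f] by simp

lemma dps_eqI: "(\<And>a. fin_index a \<Longrightarrow> coef f a = coef g a) \<Longrightarrow> f = g"
  by (metis coef_inject coef_not_fin ext)

instantiation dps :: (comm_ring_1) "{zero, one, plus, minus, uminus, times}"
begin

lift_definition zero_dps :: "'a dps" is "\<lambda>_. 0" by simp
lift_definition one_dps :: "'a dps" is "\<lambda>a. if a = zero_index then 1 else 0" by auto
lift_definition plus_dps :: "'a dps \<Rightarrow> 'a dps \<Rightarrow> 'a dps" is "\<lambda>f g a. f a + g a" by auto
lift_definition minus_dps :: "'a dps \<Rightarrow> 'a dps \<Rightarrow> 'a dps" is "\<lambda>f g a. f a - g a" by auto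
lift_definition uminus_dps :: "'a dps \<Rightarrow> 'a dps" is "\<lambda>f a. - f a" by auto
lift_definition times_dps :: "'a dps \<Rightarrow> 'a dps \<Rightarrow> 'a dps" is
  "\<lambda>f g c. if fin_index c
     then \<Sum>a | a \<le> c. of_nat (binom_index c a) * f a * g (sub_index c a) else 0"
  by auto

instance ..
end

lemma coef_zero [simp]: "coef 0 a = 0"
  by transfer simp

lemma coef_one: "coef 1 a = (if a = zero_index then 1 else 0)"
  by transfer simp

lemma coef_add [simp]: "coef (f + g) a = coef f a + coef g a"
  by transfer simp

lemma coef_diff [simp]: "coef (f - g) a = coef f a - coef g a"
  by transfer simp

lemma coef_uminus [simp]: "coef (- f) a = - coef f a"
  by transfer simp

lemma coef_mult: "fin_index c \<Longrightarrow>
    coef (f * g) c = (\<Sum>a | a \<le> c. of_nat (binom_index c a) * coef f a * coef g (sub_index c a))"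
  by transfer simp

lemma coef_mult_zero_index: "coef (f * g) zero_index = coef f zero_index * coef g zero_index"
proof -
  have "{a. a \<le> zero_index} = {zero_index}" "sub_index zero_index zero_index = zero_index"
    by (auto simp: le_fun_def fun_eq_iff)
  then show ?thesis by (simp add: coef_mult)
qed

lift_definition partial :: "nat \<Rightarrow> 'k::comm_ring_1 dps \<Rightarrow> 'k dps" is "\<lambda>i f a. f (inc i a)"
  by simp

lemma coef_partial [simp]: "coef (partial i f) a = coef f (inc i a)"
  by transfer simp

lemma partial_zero [simp]: "partial i 0 = 0"
  by (rule dps_eqI) simp

lemma partial_add: "partial i (f + g) = partial i f + partial i g"
  by (rule dps_eqI) simp

lemma partial_uminus: "partial i (- f) = - partial i f"
  by (rule dps_eqI) simp

lemma partial_one [simp]: "partial i 1 = 0"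
  by (rule dps_eqI) (simp add: coef_one)

lemma partial_commute: "partial i (partial j f) = partial j (partial i f)"
  by (rule dps_eqI) (simp add: inc_inc)

text \<open>Pascal's rule splits the coefficient at \<open>inc i c\<close>: the part with
  \<open>binom_index c a\<close> differentiates \<open>g\<close>, the part with
  \<open>binom_index c (dec i a)\<close>, reindexed by \<open>inc i\<close>, differentiates
  \<open>f\<close>.\<close>

lemma partial_mult: "partial i (f * g) = partial i f * g + f * partial i g"
proof (rule dps_eqI)
  fix c :: "nat \<Rightarrow> nat" assume c: "fin_index c"
  let ?t = "\<lambda>b a. of_nat b * coef f a * coef g (sub_index (inc i c) a)"
  have fin: "finite {a. a \<le> inc i c}"
    using c by (simp add: finite_index_le)
  have sub1: "sub_index (inc i c) a = inc i (sub_index c a)" if "a \<le> c" for a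
    using that by (auto simp: fun_eq_iff inc_apply le_fun_def Suc_diff_le)
  have sub2: "sub_index (inc i c) (inc i a) = sub_index c a" for a
    by (auto simp: fun_eq_iff inc_apply)
  have "coef (partial i (f * g)) c = (\<Sum>a | a \<le> inc i c. ?t (binom_index (inc i c) a) a)"
    using c by (simp add: coef_mult)
  also have "\<dots> = (\<Sum>a | a \<le> inc i c. ?t (if a \<le> c then binom_index c a else 0) a +
      ?t (if a i > 0 then binom_index c (dec i a) else 0) a)"
    using c by (intro sum.cong refl) (simp only: binom_index_Pascal mem_Collect_eq of_nat_add distrib_right)
  also have "\<dots> = (\<Sum>a | a \<le> inc i c. ?t (if a \<le> c then binom_index c a else 0) a) +
      (\<Sum>a | a \<le> inc i c. ?t (if a i > 0 then binom_index c (dec i a) else 0) a)"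
    by (rule sum.distrib)
  also have "(\<Sum>a | a \<le> inc i c. ?t (if a \<le> c then binom_index c a else 0) a) =
      (\<Sum>a | a \<le> c. ?t (binom_index c a) a)"
    by (rule sum.mono_neutral_cong_right[OF fin])
      (auto simp: le_fun_def inc_apply intro: le_SucI)
  also have "\<dots> = coef (f * partial i g) c"
    using c by (auto simp: coef_mult sub1 intro!: sum.cong)
  also have "(\<Sum>a | a \<le> inc i c. ?t (if a i > 0 then binom_index c (dec i a) else 0) a) =
      (\<Sum>a \<in> inc i ` {a. a \<le> c}. ?t (binom_index c (dec i a)) a)"
  proof (rule sum.mono_neutral_cong_right[OF fin])
    show "inc i ` {a. a \<le> c} \<subseteq> {a. a \<le> inc i c}"
      by (auto simp: le_fun_def inc_apply)
    show "\<forall>a\<in>{a. a \<le> inc i c} - inc i ` {a. a \<le> c}.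
        ?t (if a i > 0 then binom_index c (dec i a) else 0) a = 0"
    proof
      fix a assume a: "a \<in> {a. a \<le> inc i c} - inc i ` {a. a \<le> c}"
      have "dec i a \<le> c"
        using a dec_le_of_le_inc by blast
      then have "\<not> a i > 0"
        using a by (metis DiffD2 image_eqI inc_dec mem_Collect_eq)
      then show "?t (if a i > 0 then binom_index c (dec i a) else 0) a = 0" by simp
    qed
  qed (auto simp: inc_apply)
  also have "\<dots> = (\<Sum>a | a \<le> c. ?t (binom_index c a) (inc i a))"
    by (subst sum.reindex) (auto simp: inj_on_def)
  also have "\<dots> = coef (partial i f * g) c"
    using c by (auto simp: coef_mult sub2 intro!: sum.cong)
  finally show "coef (partial i (f * g)) c = coef (partial i f * g + f * partial i g) c"
    by simp
qed

lemma dps_add_mult: "(f + g) * h = f * h + g * (h :: 'k::comm_ring_1 dps)"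
  by (rule dps_eqI) (simp add: coef_mult algebra_simps sum.distrib)

lemma dps_mult_add: "h * (f + g) = h * f + h * (g :: 'k::comm_ring_1 dps)"
  by (rule dps_eqI) (simp add: coef_mult algebra_simps sum.distrib)

text \<open>A series is determined by its constant coefficient and its partial derivatives. Hence the ring
  laws follow from the Leibniz rule by induction on the multi-index.\<close>

lemma dps_mult_commute: "f * g = g * (f :: 'k::comm_ring_1 dps)"
proof (rule dps_eqI)
  fix a assume "fin_index a"
  then show "coef (f * g) a = coef (g * f) a"
  proof (induction a arbitrary: f g rule: index_induct)
    case (inc i c)
    have "coef (partial i (f * g)) c = coef (partial i (g * f)) c"
      unfolding partial_mult coef_add inc.IH[of "partial i f"] inc.IH[of f] by simp
    then show ?case by simp
  qed (simp add: coef_mult_zero_index)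
qed

lemma dps_mult_assoc: "(f * g) * h = f * (g * h :: 'k::comm_ring_1 dps)"
proof (rule dps_eqI)
  fix a assume "fin_index a"
  then show "coef ((f * g) * h) a = coef (f * (g * h)) a"
  proof (induction a arbitrary: f g h rule: index_induct)
    case (inc i c)
    have "coef (partial i ((f * g) * h)) c = coef (partial i (f * (g * h))) c"
      by (simp add: partial_mult dps_add_mult dps_mult_add inc.IH add.assoc del: coef_partial)
    then show ?case by simp
  qed (simp add: coef_mult_zero_index)
qed

lemma dps_one_mult: "1 * f = (f :: 'k::comm_ring_1 dps)"
proof (rule dps_eqI)
  fix a assume "fin_index a"
  then show "coef (1 * f) a = coef f a"
  proof (induction a arbitrary: f rule: index_induct)
    case (inc i c)
    have "coef (0 * f) c = 0"
      using inc by (simp add: coef_mult)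
    then have "coef (partial i (1 * f)) c = coef (partial i f) c"
      by (simp add: partial_mult inc.IH del: coef_partial)
    then show ?case by simp
  qed (simp add: coef_mult_zero_index coef_one)
qed

instance dps :: (comm_ring_1) comm_ring_1
proof
  show "(0 :: 'a dps) \<noteq> 1"
    by (metis coef_one coef_zero zero_neq_one)
qed (auto simp: dps_mult_assoc dps_add_mult dps_one_mult intro: dps_eqI dps_mult_commute)

lemma coef_sum [simp]: "coef (\<Sum>x\<in>A. f x) a = (\<Sum>x\<in>A. coef (f x) a)"
  by (induction A rule: infinite_finite_induct) auto

lemma partial_sum: "partial i (\<Sum>x\<in>A. f x) = (\<Sum>x\<in>A. partial i (f x))"
  by (rule dps_eqI) simp

lift_definition C :: "'k::comm_ring_1 \<Rightarrow> 'k dps" is "\<lambda>c a. if a = zero_index then c else 0"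
  by auto

lemma coef_C: "coef (C c) a = (if a = zero_index then c else 0)"
  by transfer simp

lemma partial_C [simp]: "partial i (C c) = 0"
  by (rule dps_eqI) (simp add: coef_C)

lemma C_simps: "C (a + b) = C a + C b" "C (a - b) = C a - C b" "C (- a) = - C a"
  "C 0 = 0" "C 1 = 1"
  by (auto intro!: dps_eqI simp: coef_C coef_one)

lemma coef_C_mult [simp]: "coef (C c * f) a = c * coef f a"
proof (cases "fin_index a")
  case True
  then show ?thesis
  proof (induction a arbitrary: f rule: index_induct)
    case (inc i a)
    have "coef (partial i (C c * f)) a = c * coef (partial i f) a"
      by (simp add: partial_mult inc.IH)
    then show ?case by simp
  qed (simp add: coef_mult_zero_index coef_C)
qed (simp add: coef_not_fin)

lemma partial_C_mult: "partial i (C c * f) = C c * partial i f"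
  by (simp add: partial_mult)

lemma C_mult: "C (a * b) = C a * C b"
  by (rule dps_eqI) (simp add: coef_C)

lemma C_of_nat: "C (of_nat m) = of_nat m"
  by (induction m) (auto simp: C_simps)

lemma C_numeral: "C (numeral m) = numeral m"
  using C_of_nat[of "numeral m"] by simp

lemma C_eq_0_iff [simp]: "C c = 0 \<longleftrightarrow> c = 0"
  by (metis C_simps(4) coef_C)

lift_definition X :: "(nat \<Rightarrow> nat) \<Rightarrow> 'k::comm_ring_1 dps" is
  "\<lambda>a b. if fin_index a \<and> b = a then 1 else 0"
  by auto

lemma coef_X: "coef (X a) b = (if fin_index a \<and> b = a then 1 else 0)"
  by transfer simp

lemma X_zero_index [simp]: "X zero_index = 1"
  by (rule dps_eqI) (simp add: coef_X coef_one)

lemma coef_X_mult: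
  assumes a: "fin_index a" and c: "fin_index c"
  shows "coef (X a * f) c =
    (if a \<le> c then of_nat (binom_index c a) * coef f (sub_index c a) else 0)"
proof -
  have "coef (X a * f) c =
      (\<Sum>b | b \<le> c. if b = a then of_nat (binom_index c a) * coef f (sub_index c a) else 0)"
    unfolding coef_mult[OF c] by (rule sum.cong) (auto simp: coef_X a)
  also have "\<dots> = (if a \<le> c then of_nat (binom_index c a) * coef f (sub_index c a) else 0)"
    using finite_index_le[OF c] by simp
  finally show ?thesis .
qed

lemma X_mult_X:
  assumes "fin_index a" "fin_index b"
  shows "X a * X b = of_nat (binom_index (add_index a b) a) * (X (add_index a b) :: 'k::comm_ring_1 dps)"
proof (rule dps_eqI)
  fix c :: "nat \<Rightarrow> nat" assume c: "fin_index c"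
  have "coef (X a * X b) c = of_nat (binom_index (add_index a b) a) * coef (X (add_index a b) :: 'k dps) c"
  proof (cases "c = add_index a b")
    case True
    then show ?thesis
      by (simp only: True coef_X_mult[OF assms(1) fin_index_add[OF assms]] coef_X[of b] coef_X[of "add_index a b"]
          sub_add_index le_add_index assms fin_index_add[OF assms] simp_thms if_True)
  next
    case False
    then have "\<not> (a \<le> c \<and> sub_index c a = b)"
      by (metis le_add_sub_index)
    then show ?thesis
      using False by (auto simp only: coef_X_mult[OF assms(1) c] coef_X[of b] coef_X[of "add_index a b"] mult_zero_right if_False split: if_splits)
  qed
  also have "\<dots> = coef (C (of_nat (binom_index (add_index a b) a)) * (X (add_index a b) :: 'k dps)) c"
    by (rule coef_C_mult [symmetric])
  finally show "coef (X a * X b) c = coef (of_nat (binom_index (add_index a b) a) * (X (add_index a b) :: 'k dps)) c"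
    by (simp only: C_of_nat)
qed

lemma inc_eq_iff: "inc i b = a \<longleftrightarrow> a i > 0 \<and> b = dec i a"
proof
  assume "inc i b = a"
  then have "a = inc i b" by simp
  then show "a i > 0 \<and> b = dec i a"
    by (simp add: inc_apply)
qed (simp add: inc_dec)

lemma partial_X: "fin_index a \<Longrightarrow> partial i (X a) = (if a i > 0 then X (dec i a) else 0)"
  by (rule dps_eqI) (simp add: coef_X inc_eq_iff)

lemma dps_eq_partial:
  assumes "coef f zero_index = coef g zero_index" "\<And>i. partial i f = partial i g"
  shows "f = g"
proof (rule dps_eqI)
  fix a assume "fin_index a"
  then show "coef f a = coef g a"
  proof (induction rule: index_induct)
    case (inc i c)
    then show ?case by (metis assms(2) coef_partial)
  qed (fact assms(1))
qed

section \<open>Binomial coefficients modulo 3 and the Poisson bracket\<close>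

lemma char3_of_nat_eq_iff:
  assumes "CHAR('k::field) = 3"
  shows "(of_nat a :: 'k) = of_nat b \<longleftrightarrow> a mod 3 = b mod 3"
proof (induction a b rule: linorder_wlog)
  case (le a b)
  have "(of_nat a :: 'k) = of_nat b \<longleftrightarrow> (of_nat (b - a) :: 'k) = 0"
    using le by (auto simp: of_nat_diff)
  also have "\<dots> \<longleftrightarrow> 3 dvd (b - a)"
    using assms by (simp add: of_nat_eq_0_iff_char_dvd)
  also have "\<dots> \<longleftrightarrow> a mod 3 = b mod 3"
    using le by (metis mod_eq_dvd_iff_nat)
  finally show ?case .
qed auto

text \<open>Lucas' theorem for the last ternary digit, i.e. (1 + x)^3 = 1 + x^3 modulo 3. The
  induction multiplies by (1 + x)^3, which amounts to three applications of Pascal's rule; the two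
  middle terms carry a factor 3.\<close>

lemma choose_3_mult_mod:
  "(3 * e choose k) mod 3 = (if 3 dvd k then e choose (k div 3) else 0) mod 3"
proof (induction e arbitrary: k)
  case 0
  then show ?case by (cases "k = 0") (auto simp: binomial_eq_0 elim!: dvdE)
next
  case (Suc e)
  consider "k = 0" | "k = 1" | "k = 2" | j where "k = j + 3"
  proof (cases "k < 3")
    case False
    then have "k = (k - 3) + 3" by simp
    then show thesis using that by blast
  qed (use that in linarith)
  then show ?case
  proof cases
    case 3
    have "(3 * Suc e choose 2) = 3 * ((3 * e choose 1) + (3 * e choose 0)) + (3 * e choose 2)"
      by (simp add: numeral_eq_Suc)
    also have "\<dots> mod 3 = (3 * e choose 2) mod 3"
      by presburger
    finally show ?thesis using Suc.IH[of 2] 3 by simp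
  next
    case 4
    have "(3 * Suc e choose k) = (3 * e choose j) + 3 * ((3 * e choose (j + 1)) + (3 * e choose (j + 2))) + (3 * e choose (j + 3))"
      unfolding 4 by (simp add: numeral_eq_Suc)
    also have "\<dots> mod 3 = ((3 * e choose j) + (3 * e choose (j + 3))) mod 3"
      by presburger
    also have "\<dots> = ((3 * e choose j) mod 3 + (3 * e choose (j + 3)) mod 3) mod 3"
      by presburger
    also have "\<dots> = (if 3 dvd k then Suc e choose (k div 3) else 0) mod 3"
    proof (cases "3 dvd j")
      case True
      then obtain i where "j = 3 * i" by (auto simp: dvd_def)
      then show ?thesis
        unfolding Suc.IH 4 by (simp add: mod_simps)
    next
      case False
      then show ?thesis
        unfolding Suc.IH 4 by (simp add: dvd_add_left_iff)
    qed
    finally show ?thesis .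
  qed (auto)
qed

lemma choose_3_power_mod:
  "0 < b \<Longrightarrow> b < 3 ^ m \<Longrightarrow> (3 ^ m choose b) mod 3 = 0"
proof (induction m arbitrary: b)
  case (Suc m)
  show ?case
  proof (cases "3 dvd b")
    case True
    then obtain i where i: "b = 3 * i" by (auto simp: dvd_def)
    then have "(3 ^ m choose i) mod 3 = 0"
      using Suc by simp
    then show ?thesis
      using choose_3_mult_mod[of "3 ^ m" b] i by simp
  next
    case False
    then show ?thesis
      using choose_3_mult_mod[of "3 ^ m" b] by simp
  qed
qed simp

text \<open>A carry in ternary addition: \<open>a\<close> and \<open>c - a\<close> have at most
  \<open>m\<close> digits but \<open>c\<close> has more. Pascal's rule descends to the row
  \<open>3 ^ m\<close>. This is what makes the truncated product closed.\<close>

lemma choose_carry_mod: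
  assumes "3 ^ m \<le> c" "a < 3 ^ m" "c - a < 3 ^ m"
  shows "(c choose a) mod 3 = 0"
  using assms
proof (induction c arbitrary: a)
  case (Suc c)
  obtain b where b: "a = Suc b"
    using Suc.prems by (cases a) auto
  show ?case
  proof (cases "Suc c = 3 ^ m")
    case True
    then show ?thesis
      using choose_3_power_mod[of a m] Suc.prems b by simp
  next
    case False
    then have "(c choose b) mod 3 = 0" "(c choose Suc b) mod 3 = 0"
      using Suc.IH[of b] Suc.IH[of "Suc b"] Suc.prems b by auto
    then show ?thesis
      using b by (simp add: mod_add_eq[symmetric])
  qed
qed simp

section \<open>The Poisson bracket on divided power series\<close>

definition poisson :: "nat \<Rightarrow> 'k::field dps \<Rightarrow> 'k dps \<Rightarrow> 'k dps" where
  "poisson r f g = (\<Sum>i = 1..2 * r. C (ham_sign r i) * (partial i f * partial (ham_conj r i) g))"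

lemma ham_conj_in: "i \<in> {1..2 * r} \<Longrightarrow> ham_conj r i \<in> {1..2 * r}"
  by (auto simp: ham_conj_def)

lemma ham_conj_conj: "i \<in> {1..2 * r} \<Longrightarrow> ham_conj r (ham_conj r i) = i"
  by (auto simp: ham_conj_def)

lemma ham_conj_neq: "i \<in> {1..2 * r} \<Longrightarrow> ham_conj r i \<noteq> i"
  by (auto simp: ham_conj_def)

lemma ham_sign_conj: "i \<in> {1..2 * r} \<Longrightarrow> ham_sign r (ham_conj r i) = - ham_sign r i"
  by (auto simp: ham_conj_def ham_sign_def)

lemma ham_sign_square: "ham_sign r i * ham_sign r i = 1"
  by (auto simp: ham_sign_def)

lemma ham_sign_neq_0 [simp]: "ham_sign r i \<noteq> 0"
  by (auto simp: ham_sign_def)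

lemma sum_ham_conj: "(\<Sum>i = 1..2 * r. F (ham_conj r i)) = (\<Sum>i = 1..2 * r. F i)"
  by (rule sum.reindex_bij_witness[of _ "ham_conj r" "ham_conj r"]) (auto simp: ham_conj_def)

lemma poisson_add_left: "poisson r (f + g) h = poisson r f h + poisson r g h"
  by (simp add: poisson_def partial_add algebra_simps sum.distrib)

lemma poisson_add_right: "poisson r f (g + h) = poisson r f g + poisson r f h"
  by (simp add: poisson_def partial_add algebra_simps sum.distrib)

lemma poisson_C_mult_left: "poisson r (C c * f) g = C c * poisson r f g"
  by (simp add: poisson_def partial_C_mult sum_distrib_left mult.left_commute mult.assoc)

lemma poisson_C_mult_right: "poisson r f (C c * g) = C c * poisson r f g"
  by (simp add: poisson_def partial_C_mult sum_distrib_left mult.left_commute mult.assoc)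

lemma poisson_C [simp]: "poisson r (C c) f = 0" "poisson r f (C c) = 0"
  by (simp_all add: poisson_def)

lemma poisson_0 [simp]: "poisson r 0 f = 0" "poisson r f 0 = 0"
  by (simp_all add: poisson_def)

lemma poisson_uminus: "poisson r (- f) g = - poisson r f g" "poisson r f (- g) = - poisson r f g"
  by (simp_all add: poisson_def partial_uminus sum_negf)

lemma poisson_diff: "poisson r (f - g) h = poisson r f h - poisson r g h" "poisson r h (f - g) = poisson r h f - poisson r h g"
  using poisson_add_left[of r f "- g" h] poisson_add_right[of r h f "- g"] by (simp_all add: poisson_uminus)

lemma poisson_sum_left: "poisson r (\<Sum>x\<in>A. F x) g = (\<Sum>x\<in>A. poisson r (F x) g)"
  by (induction A rule: infinite_finite_induct) (auto simp: poisson_add_left)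

lemma poisson_sum_right: "poisson r g (\<Sum>x\<in>A. F x) = (\<Sum>x\<in>A. poisson r g (F x))"
  by (induction A rule: infinite_finite_induct) (auto simp: poisson_add_right)

lemma poisson_commute: "poisson r g f = - poisson r f g"
proof -
  have "poisson r g f = (\<Sum>i = 1..2 * r. C (ham_sign r (ham_conj r i)) * (partial (ham_conj r i) g * partial (ham_conj r (ham_conj r i)) f))"
    unfolding poisson_def by (rule sum_ham_conj [symmetric])
  also have "\<dots> = (\<Sum>i = 1..2 * r. - (C (ham_sign r i) * (partial i f * partial (ham_conj r i) g)))"
    by (rule sum.cong) (auto simp: ham_conj_conj ham_sign_conj C_simps)
  finally show ?thesis
    by (simp add: poisson_def sum_negf)
qed

lemma poisson_mult_left: "poisson r (g * h) f = poisson r g f * h + g * poisson r h f"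
  by (simp add: poisson_def partial_mult algebra_simps sum.distrib sum_distrib_left sum_distrib_right)

lemma partial_poisson: "partial k (poisson r f g) = poisson r (partial k f) g + poisson r f (partial k g)"
  by (simp add: poisson_def partial_sum partial_C_mult partial_mult sum.distrib algebra_simps partial_commute[of k])

text \<open>The terms with two derivatives on \<open>h\<close> are symmetric in \<open>f\<close> and
  \<open>g\<close> (\<open>sym\<close>) and cancel; the remaining ones match after reindexing by
  \<open>ham_conj\<close>, which reverses the sign.\<close>

lemma poisson_Jacobi: "poisson r f (poisson r g h) = poisson r (poisson r f g) h + poisson r g (poisson r f h)"
proof -
  let ?S = "{1..2 * r}"
  let ?s = "\<lambda>i. C (ham_sign r i)"
  let ?c = "ham_conj r"
  have exp: "poisson r f (poisson r g h) = (\<Sum>i\<in>?S. ?s i * (partial i f * poisson r (partial (?c i) g) h)) +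
      (\<Sum>i\<in>?S. ?s i * (partial i f * poisson r g (partial (?c i) h)))" for f g
    unfolding poisson_def[of r f] partial_poisson by (simp add: algebra_simps sum.distrib)
  have sym: "(\<Sum>i\<in>?S. ?s i * (partial i f * poisson r g (partial (?c i) h))) =
      (\<Sum>i\<in>?S. ?s i * (partial i g * poisson r f (partial (?c i) h)))"
    unfolding poisson_def sum_distrib_left
    by (subst sum.swap) (simp add: algebra_simps partial_commute[of "?c _" "?c _"])
  have "poisson r (poisson r f g) h = (\<Sum>i\<in>?S. ?s i * (poisson r (partial i f) h * partial (?c i) g)) +
      (\<Sum>i\<in>?S. ?s i * (partial i f * poisson r (partial (?c i) g) h))"
    unfolding poisson_def[of r f] by (simp add: poisson_sum_left poisson_C_mult_left poisson_mult_left algebra_simps sum.distrib)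
  also have "(\<Sum>i\<in>?S. ?s i * (poisson r (partial i f) h * partial (?c i) g)) =
      (\<Sum>i\<in>?S. ?s (?c i) * (poisson r (partial (?c i) f) h * partial (?c (?c i)) g))"
    by (rule sum_ham_conj [symmetric])
  also have "\<dots> = - (\<Sum>i\<in>?S. ?s i * (partial i g * poisson r (partial (?c i) f) h))"
    unfolding sum_negf[symmetric]
    by (rule sum.cong) (auto simp: ham_conj_conj ham_sign_conj C_simps algebra_simps)
  finally show ?thesis
    unfolding exp sym by simp
qed

definition unit_index :: "nat \<Rightarrow> nat \<Rightarrow> nat" where
  "unit_index j = inc j zero_index"

lemma unit_index_apply: "unit_index j i = (if i = j then 1 else 0)"
  by (simp add: unit_index_def inc_apply)

lemma fin_index_unit [simp]: "fin_index (unit_index j)"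
  by (simp add: unit_index_def)

lemma partial_X_unit: "partial i (X (unit_index j)) = (if i = j then 1 else 0)"
proof (cases "i = j")
  case True
  then show ?thesis
    by (simp add: partial_X unit_index_apply) (simp add: unit_index_def)
qed (simp add: partial_X unit_index_apply)

lemma poisson_X_unit:
  assumes "j \<in> {1..2 * r}"
  shows "poisson r (X (unit_index j)) f = C (ham_sign r j) * partial (ham_conj r j) f"
proof -
  have "poisson r (X (unit_index j)) f =
      (\<Sum>i = 1..2 * r. if i = j then C (ham_sign r j) * partial (ham_conj r j) f else 0)"
    unfolding poisson_def by (rule sum.cong) (auto simp: partial_X_unit)
  then show ?thesis using assms by simp
qed

section \<open>The Hamiltonian algebra as functions modulo constants\<close>

locale ham =
  fixes r :: nat and n :: "nat \<Rightarrow> nat" and kk :: "'k::field itself"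
  assumes char3: "CHAR('k) = 3"
    and r_pos: "r \<ge> 1"
    and n_pos: "\<And>i. i \<in> {1..2 * r} \<Longrightarrow> n i \<ge> 1"
begin

text \<open>\<open>OA\<close> is the divided power algebra \<open>O(2r; n)\<close>. As \<open>D_H\<close> kills exactly the constants, every
  element of the Hamiltonian algebra is \<open>D_H f\<close> for a unique \<open>f \<in> GG\<close>, i.e. with neither constant nor
  top term; \<open>br\<close> below is accordingly the Poisson bracket with its constant term removed.\<close>

definition II :: "(nat \<Rightarrow> nat) set" where "II = dp_indices 3 (2 * r) n"
definition tau :: "nat \<Rightarrow> nat" where "tau = dp_top 3 (2 * r) n"
definition IS :: "(nat \<Rightarrow> nat) set" where "IS = II - {zero_index, tau}"
definition OA :: "'k dps set" where "OA = {f. \<forall>a. coef f a \<noteq> 0 \<longrightarrow> a \<in> II}"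
definition GG :: "'k dps set" where "GG = {f. \<forall>a. coef f a \<noteq> 0 \<longrightarrow> a \<in> IS}"

lemma of_nat_mod: "(of_nat a :: 'k) = of_nat b \<longleftrightarrow> a mod 3 = b mod 3"
  by (rule char3_of_nat_eq_iff[OF char3])

lemma of_nat_0: "(of_nat a :: 'k) = 0 \<longleftrightarrow> a mod 3 = 0"
  using of_nat_mod[of a 0] by simp

lemma three_eq_0: "(3 :: 'k) = 0"
  using of_nat_0[of 3] by simp

lemma two_eq: "(2 :: 'k) = -1"
  using three_eq_0 by (simp add: eq_neg_iff_add_eq_0)

lemma II_iff: "a \<in> II \<longleftrightarrow> (\<forall>i\<in>{1..2 * r}. a i < 3 ^ n i) \<and> (\<forall>i. i \<notin> {1..2 * r} \<longrightarrow> a i = 0)"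
  by (simp add: II_def dp_indices_def)

lemma II_less: "a \<in> II \<Longrightarrow> i \<in> {1..2 * r} \<Longrightarrow> a i < 3 ^ n i"
  by (simp add: II_iff)

lemma II_outside: "a \<in> II \<Longrightarrow> i \<notin> {1..2 * r} \<Longrightarrow> a i = 0"
  by (simp add: II_iff)

lemma II_pos_in: "a \<in> II \<Longrightarrow> a i > 0 \<Longrightarrow> i \<in> {1..2 * r}"
  using II_outside by fastforce

lemma II_fin: "a \<in> II \<Longrightarrow> fin_index a"
  unfolding fin_index_def by (rule finite_subset[of _ "{1..2 * r}"]) (use II_pos_in in auto)

lemma II_le: "a \<in> II \<Longrightarrow> b \<le> a \<Longrightarrow> b \<in> II"
  unfolding II_iff le_fun_def by (metis le_zero_eq order_le_less_trans)

lemma le_inc: "a \<le> inc i a"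
  by (simp add: le_fun_def inc_apply)

lemma dec_le: "dec i a \<le> a"
  by (simp add: le_fun_def dec_apply)

lemma II_inc: "inc i a \<in> II \<Longrightarrow> a \<in> II"
  using II_le le_inc by blast

lemma II_dec: "a \<in> II \<Longrightarrow> dec i a \<in> II"
  using II_le dec_le by blast

lemma inc_II_iff: "a \<in> II \<Longrightarrow> i \<in> {1..2 * r} \<Longrightarrow> inc i a \<in> II \<longleftrightarrow> Suc (a i) < 3 ^ n i"
  by (auto simp: II_iff inc_apply)

lemma zero_II [simp]: "zero_index \<in> II"
  by (simp add: II_iff)

lemma tau_apply: "tau i = (if i \<in> {1..2 * r} then 3 ^ n i - 1 else 0)"
  by (simp add: tau_def dp_top_def)

lemma tau_II [simp]: "tau \<in> II"
  by (simp add: II_iff tau_apply)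

lemma inc_tau: "inc i tau \<notin> II"
  by (auto simp: II_iff inc_apply tau_apply)

lemma le_tau: "a \<in> II \<Longrightarrow> a \<le> tau"
proof (unfold le_fun_def, rule allI)
  fix i assume a: "a \<in> II"
  show "a i \<le> tau i"
    using II_less[OF a, of i] II_outside[OF a, of i] by (cases "i \<in> {1..2 * r}") (auto simp: tau_apply)
qed

lemma II_eq: "II = {a. a \<le> tau}"
  using le_tau II_le[OF tau_II] by blast

lemma finite_II: "finite II"
  unfolding II_eq by (rule finite_index_le) (simp add: II_fin)

lemma power_ge_3: "i \<in> {1..2 * r} \<Longrightarrow> (3::nat) ^ n i \<ge> 3"
  using n_pos[of i] power_increasing[of 1 "n i" "3::nat"] by simp

lemma OA_I: "(\<And>a. a \<notin> II \<Longrightarrow> coef f a = 0) \<Longrightarrow> f \<in> OA"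
  by (auto simp: OA_def)

lemma OA_D: "f \<in> OA \<Longrightarrow> a \<notin> II \<Longrightarrow> coef f a = 0"
  by (auto simp: OA_def)

lemma GG_I: "(\<And>a. a \<notin> II \<Longrightarrow> coef f a = 0) \<Longrightarrow> coef f zero_index = 0 \<Longrightarrow> coef f tau = 0 \<Longrightarrow> f \<in> GG"
  by (auto simp: GG_def IS_def)

lemma GG_OA: "f \<in> GG \<Longrightarrow> f \<in> OA"
  by (auto simp: GG_def IS_def OA_def)

lemma GG_zero: "f \<in> GG \<Longrightarrow> coef f zero_index = 0"
  by (auto simp: GG_def IS_def)

lemma GG_tau: "f \<in> GG \<Longrightarrow> coef f tau = 0"
  by (auto simp: GG_def IS_def)

lemma GG_iff: "f \<in> GG \<longleftrightarrow> f \<in> OA \<and> coef f zero_index = 0 \<and> coef f tau = 0"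
  by (meson GG_I GG_OA GG_tau GG_zero OA_D)

lemma OA_zero [simp]: "0 \<in> OA"
  and OA_add: "f \<in> OA \<Longrightarrow> g \<in> OA \<Longrightarrow> f + g \<in> OA"
  and OA_diff: "f \<in> OA \<Longrightarrow> g \<in> OA \<Longrightarrow> f - g \<in> OA"
  and OA_C_mult: "f \<in> OA \<Longrightarrow> C c * f \<in> OA"
  by (auto intro!: OA_I simp: OA_D)

lemma OA_C [simp]: "C c \<in> OA"
  by (rule OA_I) (auto simp: coef_C)

lemma OA_X: "a \<in> II \<Longrightarrow> X a \<in> OA"
  by (rule OA_I) (auto simp: coef_X)

lemma OA_sum: "(\<And>x. x \<in> A \<Longrightarrow> F x \<in> OA) \<Longrightarrow> (\<Sum>x\<in>A. F x) \<in> OA"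
  by (rule OA_I) (auto simp: OA_D)

lemma OA_partial: "f \<in> OA \<Longrightarrow> partial i f \<in> OA"
  by (rule OA_I) (use II_inc OA_D in \<open>auto\<close>)

lemma dvd_binom_index: "fin_index c \<Longrightarrow> c i \<noteq> 0 \<Longrightarrow> m dvd (c i choose a i) \<Longrightarrow> m dvd binom_index c a"
  unfolding binom_index_def fin_index_def
  by (rule dvd_trans[OF _ dvd_prodI[of _ i]]) auto

text \<open>If \<open>a\<close> and \<open>c - a\<close> are truncated exponents but
  \<open>c\<close> is not, then some coordinate carries, and its binomial factor is divisible by
  3.\<close>

lemma OA_mult:
  assumes f: "f \<in> OA" and g: "g \<in> OA"
  shows "f * g \<in> OA"
proof (rule OA_I)
  fix c assume c: "c \<notin> II"
  show "coef (f * g) c = 0"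
  proof (cases "fin_index c")
    case True
    have "of_nat (binom_index c a) * coef f a * coef g (sub_index c a) = 0" if a: "a \<le> c" for a
    proof (cases "coef f a = 0 \<or> coef g (sub_index c a) = 0")
      case False
      then have 1: "a \<in> II" and 2: "sub_index c a \<in> II"
        using f g OA_D by blast+
      obtain i where i: "if i \<in> {1..2 * r} then c i \<ge> 3 ^ n i else c i \<noteq> 0"
        using c unfolding II_iff by (meson not_less)
      have "a i \<le> c i" using a by (simp add: le_fun_def)
      then have iS: "i \<in> {1..2 * r}"
        using II_outside[OF 1, of i] II_outside[OF 2, of i] i by (auto split: if_splits)
      have "3 dvd (c i choose a i)"
        using choose_carry_mod[of "n i" "c i" "a i"] i iS II_less[OF 1 iS] II_less[OF 2 iS] by auto
      moreover have "c i \<noteq> 0"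
        using i iS by (metis le_zero_eq power_not_zero zero_neq_numeral)
      ultimately have "3 dvd binom_index c a"
        using dvd_binom_index[OF True] by blast
      then have "(of_nat (binom_index c a) :: 'k) = 0"
        by (simp add: of_nat_0)
      then show ?thesis by simp
    qed auto
    then show ?thesis
      using True by (simp only: coef_mult) (rule sum.neutral, blast)
  qed (simp add: coef_not_fin)
qed

lemma OA_poisson: "f \<in> OA \<Longrightarrow> g \<in> OA \<Longrightarrow> poisson r f g \<in> OA"
  unfolding poisson_def by (intro OA_sum OA_C_mult OA_mult OA_partial)

lemma GG_0 [simp]: "0 \<in> GG"
  and GG_add: "f \<in> GG \<Longrightarrow> g \<in> GG \<Longrightarrow> f + g \<in> GG"
  and GG_diff: "f \<in> GG \<Longrightarrow> g \<in> GG \<Longrightarrow> f - g \<in> GG"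
  and GG_C_mult: "f \<in> GG \<Longrightarrow> C c * f \<in> GG"
  by (auto simp: GG_iff OA_add OA_diff OA_C_mult)

lemma GG_X: "a \<in> IS \<Longrightarrow> X a \<in> GG"
  by (auto simp: GG_def coef_X)

lemma GG_sum: "(\<And>x. x \<in> A \<Longrightarrow> F x \<in> GG) \<Longrightarrow> (\<Sum>x\<in>A. F x) \<in> GG"
  by (simp add: GG_iff OA_sum)

lemma coef_partial_tau: "f \<in> OA \<Longrightarrow> coef (partial i f) tau = 0"
  by (simp add: OA_D inc_tau)

text \<open>Integration by parts. The bracket is a sum of total derivatives, which have no top
  coefficient, minus \<open>A\<close>, the second-order terms
  \<open>f * partial i (partial (ham_conj r i) g)\<close> with signs. Exchanging conjugate indices
  shows that \<open>A\<close> equals its negative, and 2 is invertible.\<close>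

lemma poisson_tau:
  assumes "f \<in> OA" "g \<in> OA"
  shows "coef (poisson r f g) tau = 0"
proof -
  let ?c = "ham_conj r"
  define A where "A = (\<Sum>i = 1..2 * r. ham_sign r i * coef (f * partial i (partial (?c i) g)) tau)"
  have "A = (\<Sum>i = 1..2 * r. ham_sign r (?c i) * coef (f * partial (?c i) (partial (?c (?c i)) g)) tau)"
    unfolding A_def by (rule sum_ham_conj [symmetric])
  also have "\<dots> = - A"
    unfolding A_def sum_negf[symmetric]
    by (rule sum.cong) (auto simp: ham_conj_conj ham_sign_conj partial_commute)
  finally have "A + A = 0" by simp
  then have "2 * A = 0" by simp
  then have A: "A = 0"
    using two_eq by simp
  have "coef (poisson r f g) tau = (\<Sum>i = 1..2 * r. ham_sign r i * coef (partial i (f * partial (?c i) g)) tau) - A"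
    by (simp only: poisson_def A_def coef_sum coef_C_mult partial_mult coef_add distrib_left sum.distrib add_diff_cancel_right')
  also have "(\<Sum>i = 1..2 * r. ham_sign r i * coef (partial i (f * partial (?c i) g)) tau) = 0"
    by (rule sum.neutral) (use assms in \<open>simp only: coef_partial_tau OA_mult OA_partial mult_zero_right, simp\<close>)
  finally show ?thesis using A by simp
qed

definition br :: "'k dps \<Rightarrow> 'k dps \<Rightarrow> 'k dps" where
  "br f g = poisson r f g - C (coef (poisson r f g) zero_index)"

lemma br_GG: "f \<in> OA \<Longrightarrow> g \<in> OA \<Longrightarrow> br f g \<in> GG"
  unfolding GG_iff br_def
  using poisson_tau OA_poisson r_pos
proof (intro conjI)
  assume "f \<in> OA" "g \<in> OA"
  have "tau \<noteq> zero_index"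
    using r_pos power_ge_3[of 1] by (auto simp: fun_eq_iff tau_apply intro!: exI[of _ 1])
  then show "coef (poisson r f g - C (coef (poisson r f g) zero_index)) tau = 0"
    using poisson_tau[OF \<open>f \<in> OA\<close> \<open>g \<in> OA\<close>] by (simp add: coef_C)
qed (auto simp: coef_C OA_diff OA_poisson)

definition K :: "('k, 'k dps) lie_struct" where
  "K = \<lparr> lcarrier = GG, lzero = 0, ladd = (+), lscale = (\<lambda>c f. C c * f), lbracket = br \<rparr>"

lemma poisson_self: "poisson r f f = (0 :: 'k dps)"
proof -
  have "poisson r f f + poisson r f f = 0"
    by (metis add.right_inverse poisson_commute)
  then have "C 2 * poisson r f f = 0"
    by (simp add: C_numeral)
  then have "C (-1) * poisson r f f = 0" by (simp add: two_eq)
  then show ?thesis by (simp add: C_simps)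
qed

lemma br_self: "br f f = 0"
  by (simp add: br_def poisson_self C_simps)

lemma br_bilinear:
  "br (f + g) h = br f h + br g h" "br h (f + g) = br h f + br h g"
  "br (C c * f) g = C c * br f g" "br f (C c * g) = C c * br f g"
  by (simp_all add: br_def poisson_add_left poisson_add_right poisson_C_mult_left poisson_C_mult_right C_simps C_mult
      right_diff_distrib)

lemma lie_algebra_K: "lie_algebra K"
proof
  fix x y z :: "'k dps" assume "x \<in> lcarrier K" "y \<in> lcarrier K" "z \<in> lcarrier K"
  show "ladd K (lbracket K x (lbracket K y z))
            (ladd K (lbracket K y (lbracket K z x)) (lbracket K z (lbracket K x y))) = lzero K"
  proof -
    have "poisson r x (poisson r y z) + (poisson r y (poisson r z x) + poisson r z (poisson r x y)) = 0"
      using poisson_Jacobi[of r x y z] poisson_commute[of r "poisson r x y" z] poisson_commute[of r x z]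
      by (simp add: poisson_uminus)
    \<comment> \<open>Constants dropped from the inner brackets are killed by the outer ones; those
      dropped from the outer brackets add up to the constant term of the Jacobi sum.\<close>
    from arg_cong[OF this, of "\<lambda>f. coef f zero_index"]
    have h: "coef (poisson r x (poisson r y z)) zero_index + (coef (poisson r y (poisson r z x)) zero_index + coef (poisson r z (poisson r x y)) zero_index) = 0"
      by simp
    show ?thesis
      using \<open>poisson r x (poisson r y z) + _ = 0\<close> arg_cong[OF h, of C]
      by (simp add: K_def br_def poisson_diff C_simps algebra_simps neg_eq_iff_add_eq_0)
  qed
qed (auto simp: K_def GG_add GG_C_mult GG_OA br_GG C_simps C_mult poisson_self br_bilinear distrib_left distrib_right add_ac br_self)

section \<open>From functions to the operators of the Hamiltonian algebra\<close>

definition of_dp :: "'k dp \<Rightarrow> 'k dps" where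
  "of_dp u = Abs_dps (\<lambda>a. if a \<in> II then u a else 0)"

lemma coef_of_dp: "coef (of_dp u) a = (if a \<in> II then u a else 0)"
  unfolding of_dp_def by (subst Abs_dps_inverse) (auto dest: II_fin)

lemma of_dp_OA [simp]: "of_dp u \<in> OA"
  by (rule OA_I) (simp add: coef_of_dp)

lemma of_dp_coef: "f \<in> OA \<Longrightarrow> of_dp (coef f) = f"
  by (rule dps_eqI) (auto simp: coef_of_dp OA_D)

lemma of_dp_partial: "of_dp (dp_partial (2 * r) n i u) = partial i (of_dp u)"
  by (rule dps_eqI) (auto simp: coef_of_dp dp_partial_def II_def[symmetric] char3 inc_def[symmetric] dest: II_inc)

lemma dp_mult_eq: "dp_mult (2 * r) n u v = coef (of_dp u * of_dp v)"
proof
  fix c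
  show "dp_mult (2 * r) n u v c = coef (of_dp u * of_dp v) c"
  proof (cases "c \<in> II")
    case True
    have le: "a \<in> II" "sub_index c a \<in> II" if "a \<le> c" for a
      using II_le[OF True] that by (auto simp: le_fun_def)
    \<comment> \<open>\<open>dp_mult\<close> takes the binomial coefficient of the second factor,
      \<open>binom_index\<close> that of the first; they agree by symmetry.\<close>
    have binom: "(\<Prod>i = 1..2 * r. c i choose (c i - a i)) = binom_index c a" if "a \<le> c" for a
    proof -
      have "binom_index c a = (\<Prod>i = 1..2 * r. c i choose a i)"
        by (rule binom_index_superset[OF _ _ that]) (use II_pos_in[OF True] in auto)
      also have "\<dots> = (\<Prod>i = 1..2 * r. c i choose (c i - a i))"
        by (intro prod.cong refl binomial_symmetric) (use that in \<open>simp add: le_fun_def\<close>)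
      finally show ?thesis by simp
    qed
    have "coef (of_dp u * of_dp v) c = (\<Sum>a | a \<le> c.
        of_nat (\<Prod>i = 1..2 * r. c i choose (sub_index c a i)) * u a * v (sub_index c a))"
      unfolding coef_mult[OF II_fin[OF True]]
      by (rule sum.cong) (simp_all only: mem_Collect_eq coef_of_dp le binom sub_index_apply if_True)
    also have "\<dots> = (\<Sum>(a, b) \<in> {(a, b) \<in> II \<times> II. \<forall>i. a i + b i = c i}.
          of_nat (\<Prod>i = 1..2 * r. c i choose b i) * u a * v b)"
    proof (rule sum.reindex_bij_witness[of _ fst "\<lambda>a. (a, sub_index c a)"])
      fix ab assume "ab \<in> {(a, b) \<in> II \<times> II. \<forall>i. a i + b i = c i}"
      then obtain a b where ab: "ab = (a, b)" "\<And>i. c i = a i + b i" by auto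
      then have "c = add_index a b" by (simp add: fun_eq_iff)
      then show "fst ab \<in> {a. a \<le> c}" "(fst ab, sub_index c (fst ab)) = ab"
        using ab by simp_all
    qed (use le in \<open>auto simp: le_fun_def\<close>)
    finally show ?thesis
      using True by (simp add: dp_mult_def char3 II_def[symmetric] Let_def)
  next
    case False
    then show ?thesis
      using OA_D[OF OA_mult[OF of_dp_OA of_dp_OA] False] by (simp add: dp_mult_def char3 II_def[symmetric])
  qed
qed

definition ham_op :: "'k dps \<Rightarrow> 'k dp \<Rightarrow> 'k dp" where
  "ham_op f u = coef (poisson r f (of_dp u))"

lemma D_H_eq: "D_H r n u = ham_op (of_dp u)"
proof (intro ext)
  fix v a
  show "D_H r n u v a = ham_op (of_dp u) v a"
    unfolding D_H_def ham_op_def poisson_def dp_mult_eq of_dp_partial by simp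
qed

lemma ham_op_D_H: "f \<in> OA \<Longrightarrow> ham_op f = D_H r n (coef f)"
  by (simp add: D_H_eq of_dp_coef)

lemma ham_op_add: "ham_op (f + g) = (\<lambda>u a. ham_op f u a + ham_op g u a)"
  by (simp add: fun_eq_iff ham_op_def poisson_add_left)

lemma ham_op_C_mult: "ham_op (C c * f) = (\<lambda>u a. c * ham_op f u a)"
  by (simp add: fun_eq_iff ham_op_def poisson_C_mult_left)

lemma of_dp_ham_op: "f \<in> OA \<Longrightarrow> of_dp (ham_op f u) = poisson r f (of_dp u)"
  unfolding ham_op_def by (rule of_dp_coef) (simp add: OA_poisson)

lemma ham_op_br:
  assumes "f \<in> OA" "g \<in> OA"
  shows "ham_op (br f g) = (\<lambda>u a. ham_op f (ham_op g u) a - ham_op g (ham_op f u) a)"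
proof (intro ext)
  fix u a
  have "ham_op f (ham_op g u) a - ham_op g (ham_op f u) a = coef (poisson r f (poisson r g (of_dp u)) - poisson r g (poisson r f (of_dp u))) a"
    unfolding ham_op_def[of _ "ham_op _ _"] of_dp_ham_op[OF assms(1)] of_dp_ham_op[OF assms(2)] by simp
  also have "\<dots> = coef (poisson r (poisson r f g) (of_dp u)) a"
    by (simp add: poisson_Jacobi[of r f])
  finally show "ham_op (br f g) u a = ham_op f (ham_op g u) a - ham_op g (ham_op f u) a"
    by (simp add: ham_op_def br_def poisson_diff)
qed

lemma unit_II: "i \<in> {1..2 * r} \<Longrightarrow> unit_index i \<in> II"
  unfolding unit_index_def using power_ge_3[of i] by (subst inc_II_iff) auto

lemma poisson_X_unit_right:
  assumes "j \<in> {1..2 * r}"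
  shows "poisson r f (X (unit_index j)) = - (C (ham_sign r j) * partial (ham_conj r j) f)"
  by (subst poisson_commute) (simp only: poisson_X_unit[OF assms])

lemma OA_eq_const:
  assumes f: "f \<in> OA" and "\<And>i. i \<in> {1..2 * r} \<Longrightarrow> partial i f = 0"
  shows "f = C (coef f zero_index)"
proof (rule dps_eq_partial)
  fix i
  show "partial i f = partial i (C (coef f zero_index))"
  proof (cases "i \<in> {1..2 * r}")
    case False
    have "partial i f = 0"
    proof (rule dps_eqI)
      fix a
      have "inc i a \<notin> II"
        using II_outside[of "inc i a" i] False by (auto simp: inc_apply)
      then show "coef (partial i f) a = coef 0 a"
        using OA_D[OF f] by simp
    qed
    then show ?thesis by simp
  qed (use assms in simp)
qed (simp add: coef_C)

text \<open>Applied to the variables, \<open>ham_op f\<close> returns the partial derivatives of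
  \<open>f\<close> up to sign, so \<open>f\<close> is a constant, and \<open>GG\<close> contains
  only the constant 0.\<close>

lemma ham_op_eq_0:
  assumes f: "f \<in> GG" and 0: "ham_op f = (\<lambda>u a. 0)"
  shows "f = 0"
proof -
  have "partial i f = 0" if i: "i \<in> {1..2 * r}" for i
  proof -
    let ?j = "ham_conj r i"
    have j: "?j \<in> {1..2 * r}" using ham_conj_in i by blast
    have "coef (poisson r f (X (unit_index ?j))) a = 0" for a
      using fun_cong[OF fun_cong[OF 0], of "coef (X (unit_index ?j))" a]
      by (simp only: ham_op_def of_dp_coef[OF OA_X[OF unit_II[OF j]]])
    then show ?thesis
      unfolding poisson_X_unit_right[OF j] ham_conj_conj[OF i] by (intro dps_eqI) simp
  qed
  then have "f = C (coef f zero_index)"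
    using OA_eq_const GG_OA f by blast
  then show ?thesis
    using GG_zero[OF f] by (simp add: C_simps)
qed

lemma ham_op_inj: "inj_on ham_op GG"
proof (rule inj_onI)
  fix f g assume fg: "f \<in> GG" "g \<in> GG" "ham_op f = ham_op g"
  have "ham_op (f - g) = (\<lambda>u a. 0)"
    using fg(3) by (simp add: fun_eq_iff ham_op_def poisson_diff)
  then have "f - g = 0"
    using ham_op_eq_0 GG_diff fg by blast
  then show "f = g" by simp
qed

lemma dps_expand: "f \<in> GG \<Longrightarrow> f = (\<Sum>a\<in>IS. C (coef f a) * X a)"
proof (rule dps_eqI)
  fix b :: "nat \<Rightarrow> nat" assume f: "f \<in> GG" and b: "fin_index b"
  have fin: "finite IS" using finite_II by (simp add: IS_def)
  have "coef (\<Sum>a\<in>IS. C (coef f a) * X a) b = (\<Sum>a\<in>IS. if a = b then coef f b else 0)"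
    unfolding coef_sum by (rule sum.cong) (auto simp: coef_X b)
  also have "\<dots> = coef f b"
    using fin f by (auto simp: GG_def)
  finally show "coef f b = coef (\<Sum>a\<in>IS. C (coef f a) * X a) b" by simp
qed

text \<open>The hull is bounded from both sides: the image of \<open>GG\<close> is a subspace
  containing the generators, and by \<open>dps_expand\<close> each of its elements is a finite
  combination of them.\<close>

lemma carrier_hamiltonian: "lcarrier (hamiltonian r n) = ham_op ` GG"
proof -
  let ?J = "jacobson_witt (2 * r) n :: ('k, 'k dp \<Rightarrow> 'k dp) lie_struct"
  let ?S = "{D_H r n (dp_monom a :: 'k dp) | a. a \<in> dp_indices CHAR('k) (2 * r) n \<and>
            a \<noteq> (\<lambda>i. 0) \<and> a \<noteq> dp_top CHAR('k) (2 * r) n}"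
  have J: "lzero ?J = (\<lambda>u a. 0)" "ladd ?J = (\<lambda>D E u a. D u a + E u a)" "lscale ?J = (\<lambda>c D u a. c * D u a)"
    by (simp_all add: jacobson_witt_def)
  have mono: "D_H r n (dp_monom a) = ham_op (X a)" if "a \<in> II" for a
  proof -
    have "dp_monom a = coef (X a)"
      using II_fin[OF that] by (auto simp: dp_monom_def coef_X fun_eq_iff)
    then show ?thesis using ham_op_D_H OA_X that by metis
  qed
  have S: "?S = (\<lambda>a. ham_op (X a)) ` IS"
    unfolding char3 IS_def II_def[symmetric] tau_def[symmetric] zero_index_def[symmetric]
    using mono by (auto simp: image_iff) metis
  have "lie_subspace ?J (ham_op ` GG)"
    unfolding lie_subspace_def J
  proof (intro conjI ballI allI subsetI)
    fix D assume "D \<in> ham_op ` GG"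
    then show "D \<in> lcarrier ?J"
      using D_H_in_jacobson_witt ham_op_D_H GG_OA by auto
  next
    have "ham_op 0 = (\<lambda>u a. 0)" by (simp add: ham_op_def fun_eq_iff)
    then show "(\<lambda>u a. 0) \<in> ham_op ` GG" by (metis GG_0 image_eqI)
  next
    fix D E assume "D \<in> ham_op ` GG" "E \<in> ham_op ` GG"
    then show "(\<lambda>u a. D u a + E u a) \<in> ham_op ` GG"
      by (auto simp: ham_op_add[symmetric] intro!: imageI GG_add)
  next
    fix c D assume "D \<in> ham_op ` GG"
    then show "(\<lambda>u a. c * D u a) \<in> ham_op ` GG"
      by (auto simp: ham_op_C_mult[symmetric] intro!: imageI GG_C_mult)
  qed
  moreover have "?S \<subseteq> ham_op ` GG"
    unfolding S by (auto simp: GG_X)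
  ultimately have "lie_span ?J ?S \<subseteq> ham_op ` GG"
    unfolding lie_span_def by (simp add: hull_minimal)
  moreover have "ham_op ` GG \<subseteq> U" if "?S \<subseteq> U" "lie_subspace ?J U" for U
  proof (rule image_subsetI)
    fix f assume f: "f \<in> GG"
    have U: "(\<lambda>u a. 0) \<in> U" "\<And>D E. D \<in> U \<Longrightarrow> E \<in> U \<Longrightarrow> (\<lambda>u a. D u a + E u a) \<in> U"
      "\<And>c D. D \<in> U \<Longrightarrow> (\<lambda>u a. c * D u a) \<in> U"
      using that(2) unfolding lie_subspace_def J by auto
    have "finite A \<Longrightarrow> A \<subseteq> IS \<Longrightarrow> ham_op (\<Sum>a\<in>A. C (coef f a) * X a) \<in> U" for A
    proof (induction A rule: finite_induct)
      case empty
      have "ham_op 0 = (\<lambda>u a. 0)" by (simp add: ham_op_def fun_eq_iff)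
      then show ?case using U(1) by simp
    next
      case (insert a A)
      have "ham_op (X a) \<in> U"
        using insert that(1) unfolding S by blast
      then show ?case
        using insert U by (simp add: ham_op_add ham_op_C_mult)
    qed
    from this[of IS] show "ham_op f \<in> U"
      using dps_expand[OF f] finite_II by (simp add: IS_def)
  qed
  then have "ham_op ` GG \<subseteq> lie_span ?J ?S"
    unfolding lie_span_def hull_def by blast
  ultimately show ?thesis
    by (simp add: hamiltonian_def)
qed

lemma lie_isomorphism_ham_op: "lie_isomorphism K (hamiltonian r n) ham_op"
  unfolding lie_isomorphism_def carrier_hamiltonian
proof (intro conjI ballI allI)
  show "bij_betw ham_op (lcarrier K) (ham_op ` GG)"
    by (simp add: K_def ham_op_inj inj_on_imp_bij_betw)
qed (simp_all add: K_def hamiltonian_def jacobson_witt_def ham_op_add ham_op_C_mult ham_op_br GG_OA)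

end

section \<open>Derivations\<close>

text \<open>The representative without constant term of a class modulo constants.\<close>

definition drop_const :: "'k::comm_ring_1 dps \<Rightarrow> 'k dps" where
  "drop_const f = f - C (coef f zero_index)"

lemma coef_drop_const: "coef (drop_const f) a = (if a = zero_index then 0 else coef f a)"
  by (simp add: drop_const_def coef_C)

lemma drop_const_linear: "drop_const (f + g) = drop_const f + drop_const g" "drop_const (f - g) = drop_const f - drop_const g"
  "drop_const (C c * f) = C c * drop_const f" "drop_const (C c) = 0" "drop_const 0 = 0" "drop_const (- f) = - drop_const f"
  by (auto intro!: dps_eqI simp: coef_drop_const coef_C)

lemma drop_const_sum: "drop_const (\<Sum>x\<in>A. F x) = (\<Sum>x\<in>A. drop_const (F x))"
  by (auto intro!: dps_eqI simp: coef_drop_const)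

lemma drop_const_drop_const [simp]: "drop_const (drop_const f) = drop_const f"
  by (auto intro!: dps_eqI simp: coef_drop_const)

lemma poisson_drop_const [simp]: "poisson r (drop_const f) g = poisson r f g" "poisson r f (drop_const g) = poisson r f g"
  by (simp_all add: drop_const_def poisson_diff)

lemma poisson_one [simp]: "poisson r f 1 = 0"
  using poisson_C(2)[of r f 1] by (simp add: C_simps)

lemma binom_index_unit: "fin_index a \<Longrightarrow> a i > 0 \<Longrightarrow> binom_index a (unit_index i) = a i"
  using prod.remove[of "{j. a j \<noteq> 0}" i "\<lambda>j. a j choose unit_index i j"]
  by (simp add: binom_index_def fin_index_def unit_index_apply)

lemma unit_le_iff: "unit_index i \<le> a \<longleftrightarrow> a i > 0"
  by (auto simp: le_fun_def unit_index_apply Suc_le_eq)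

lemma sub_unit: "sub_index a (unit_index i) = dec i a"
  by (auto simp: fun_eq_iff unit_index_apply dec_apply)

lemma coef_X_unit_mult:
  "fin_index a \<Longrightarrow> coef (X (unit_index i) * f) a = (if a i > 0 then of_nat (a i) * coef f (dec i a) else 0)"
  by (simp add: coef_X_mult unit_le_iff sub_unit binom_index_unit)

lemma coef_partial_power: "coef ((partial k ^^ m) f) a = coef f (a(k := a k + m))"
  by (induction m arbitrary: a) (simp_all add: inc_def)

lemma partial_power_add: "(partial k ^^ m) (f + g) = (partial k ^^ m) f + (partial k ^^ m) g"
  by (rule dps_eqI) (simp add: coef_partial_power)

lemma partial_power_C_mult: "(partial k ^^ m) (C c * f) = C c * (partial k ^^ m) f"
  by (rule dps_eqI) (simp add: coef_partial_power)

lemma partial_power_sum: "(partial k ^^ m) (\<Sum>x\<in>A. F x) = (\<Sum>x\<in>A. (partial k ^^ m) (F x))"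
  by (rule dps_eqI) (simp add: coef_partial_power)

lemma partial_power_partial: "(partial k ^^ m) (partial i f) = partial i ((partial k ^^ m) f)"
  by (induction m) (simp_all add: partial_commute[of i])

lemma power_three_power: "(f ^^ (3 * m)) x = (f ^^ m) ((f ^^ m) ((f ^^ m) x))"
  by (simp add: mult_numeral_left_semiring_numeral numeral_3_eq_3 funpow_add flip: funpow_mult)

context ham
begin

definition S :: "nat set" where "S = {1..2 * r}"
definition cj :: "nat \<Rightarrow> nat" where "cj = ham_conj r"
definition sg :: "nat \<Rightarrow> 'k" where "sg = ham_sign r"
definition q :: "nat \<Rightarrow> nat" where "q i = 3 ^ n i"
abbreviation P :: "'k dps \<Rightarrow> 'k dps \<Rightarrow> 'k dps" where "P \<equiv> poisson r"
abbreviation e :: "nat \<Rightarrow> nat \<Rightarrow> nat" where "e \<equiv> unit_index"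
abbreviation zi :: "nat \<Rightarrow> nat" where "zi \<equiv> zero_index"

lemma finite_S [simp]: "finite S"
  by (simp add: S_def)

lemma one_S: "1 \<in> S" "2 \<in> S"
  using r_pos by (simp_all add: S_def)

lemma cj_S [simp]: "i \<in> S \<Longrightarrow> cj i \<in> S"
  unfolding S_def cj_def by (rule ham_conj_in)

lemma cj_cj [simp]: "i \<in> S \<Longrightarrow> cj (cj i) = i"
  unfolding S_def cj_def by (rule ham_conj_conj)

lemma cj_neq: "i \<in> S \<Longrightarrow> cj i \<noteq> i" "i \<in> S \<Longrightarrow> i \<noteq> cj i"
  unfolding S_def cj_def using ham_conj_neq by metis+

lemma cj_eq_iff: "i \<in> S \<Longrightarrow> j \<in> S \<Longrightarrow> cj i = j \<longleftrightarrow> i = cj j"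
  by (metis cj_cj)

lemma cj_inj: "i \<in> S \<Longrightarrow> j \<in> S \<Longrightarrow> cj i = cj j \<longleftrightarrow> i = j"
  by (metis cj_cj)

lemma sg_cj [simp]: "i \<in> S \<Longrightarrow> sg (cj i) = - sg i"
  unfolding S_def cj_def sg_def by (rule ham_sign_conj)

lemma sg_square [simp]: "sg i * sg i = 1" "sg i * (sg i * x) = x"
  unfolding sg_def by (simp_all add: ham_sign_square flip: mult.assoc)

lemma sg_neq_0 [simp]: "sg i \<noteq> 0"
  by (simp add: sg_def)

lemma P_def: "P f g = (\<Sum>i\<in>S. C (sg i) * (partial i f * partial (cj i) g))"
  by (simp add: poisson_def S_def sg_def cj_def)

lemma P_X_unit: "j \<in> S \<Longrightarrow> P (X (e j)) f = C (sg j) * partial (cj j) f"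
  unfolding S_def sg_def cj_def by (rule poisson_X_unit)

lemma II_S: "a \<in> II \<longleftrightarrow> (\<forall>i\<in>S. a i < q i) \<and> (\<forall>i. i \<notin> S \<longrightarrow> a i = 0)"
  by (simp add: II_iff S_def q_def)

lemma IIq: "a \<in> II \<Longrightarrow> i \<in> S \<Longrightarrow> a i < q i"
  by (simp add: II_S)

lemma II_posS: "a \<in> II \<Longrightarrow> a i > 0 \<Longrightarrow> i \<in> S"
  using II_pos_in by (simp add: S_def)

lemma q_ge_3: "i \<in> S \<Longrightarrow> q i \<ge> 3"
  unfolding S_def q_def by (rule power_ge_3)

lemma q_mod_3: "i \<in> S \<Longrightarrow> q i mod 3 = 0"
  using n_pos[of i] by (cases "n i") (auto simp: q_def S_def)

lemma tau_S: "tau i = (if i \<in> S then q i - 1 else 0)"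
  by (simp add: tau_apply S_def q_def)

lemma tau_neq_zero [simp]: "tau \<noteq> zi" "zi \<noteq> tau"
proof -
  have "tau 1 > 0"
    using q_ge_3[OF one_S(1)] one_S by (simp add: tau_S)
  then show "tau \<noteq> zi" by auto
  then show "zi \<noteq> tau" by auto
qed

lemma e_II [simp]: "i \<in> S \<Longrightarrow> e i \<in> II"
  using unit_II by (simp add: S_def)

lemma e_neq_zero [simp]: "e i \<noteq> zi" "zi \<noteq> e i"
  by (simp_all add: unit_index_def)

lemma e_eq_iff [simp]: "e i = e j \<longleftrightarrow> i = j"
  by (metis unit_index_apply zero_neq_one)

lemma IS_iff: "a \<in> IS \<longleftrightarrow> a \<in> II \<and> a \<noteq> zi \<and> a \<noteq> tau"
  by (auto simp: IS_def)

lemma IS_II: "a \<in> IS \<Longrightarrow> a \<in> II"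
  by (simp add: IS_iff)

lemma IS_fin: "a \<in> IS \<Longrightarrow> fin_index a"
  using IS_II II_fin by blast

lemma neq_tau: "i \<in> S \<Longrightarrow> Suc (a i) < q i \<Longrightarrow> a \<noteq> tau"
  by (auto simp: tau_S)

lemma e_IS [simp]: "i \<in> S \<Longrightarrow> e i \<in> IS"
  unfolding IS_iff using neq_tau[of "cj i" "e i"] q_ge_3[of "cj i"] cj_neq[of i]
  by (auto simp: unit_index_apply)

lemma br_drop_const: "br f g = drop_const (P f g)"
  by (simp add: br_def drop_const_def)

lemma br_cut2 [simp]: "br (drop_const f) g = br f g" "br f (drop_const g) = br f g"
  by (simp_all add: br_drop_const)

lemma br_diff: "br (f - g) h = br f h - br g h" "br h (f - g) = br h f - br h g"
  by (simp_all add: br_drop_const poisson_diff drop_const_linear)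

lemma drop_const_GG: "f \<in> GG \<Longrightarrow> drop_const f = f"
  by (simp add: drop_const_def GG_zero C_simps)

lemma GG_drop_const: "f \<in> OA \<Longrightarrow> coef f tau = 0 \<Longrightarrow> drop_const f \<in> GG"
  by (auto intro!: GG_I simp: coef_drop_const OA_D)

section \<open>Derivations of the function model and the basic examples\<close>

definition poisson_der :: "('k dps \<Rightarrow> 'k dps) \<Rightarrow> bool" where
  "poisson_der T \<longleftrightarrow> (\<forall>f\<in>GG. T f \<in> GG) \<and> (\<forall>f\<in>GG. \<forall>g\<in>GG. T (f + g) = T f + T g) \<and>
     (\<forall>c. \<forall>f\<in>GG. T (C c * f) = C c * T f) \<and>
     (\<forall>f\<in>GG. \<forall>g\<in>GG. T (br f g) = br (T f) g + br f (T g))"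

lemma poisson_der_iff: "lie_derivation K T \<longleftrightarrow> poisson_der T"
  by (auto simp: lie_derivation_def poisson_der_def K_def)

lemma poisson_derD:
  assumes "poisson_der T"
  shows "f \<in> GG \<Longrightarrow> T f \<in> GG"
    and "f \<in> GG \<Longrightarrow> g \<in> GG \<Longrightarrow> T (f + g) = T f + T g"
    and "f \<in> GG \<Longrightarrow> T (C c * f) = C c * T f"
    and "f \<in> GG \<Longrightarrow> g \<in> GG \<Longrightarrow> T (br f g) = br (T f) g + br f (T g)"
  using assms by (auto simp: poisson_der_def)

lemma poisson_der_0:
  assumes "poisson_der T" shows "T 0 = 0"
  using poisson_derD(3)[OF assms, of 0 0] by (simp add: C_simps)

lemma poisson_der_sum:
  assumes "poisson_der T" "\<And>x. x \<in> A \<Longrightarrow> F x \<in> GG"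
  shows "T (\<Sum>x\<in>A. F x) = (\<Sum>x\<in>A. T (F x))"
  using assms(2)
  by (induction A rule: infinite_finite_induct) (auto simp: poisson_der_0[OF assms(1)] poisson_derD(2)[OF assms(1)] GG_sum)

lemma poisson_der_add: "poisson_der T \<Longrightarrow> poisson_der U \<Longrightarrow> poisson_der (\<lambda>f. T f + U f)"
  unfolding poisson_der_def by (auto simp: GG_add algebra_simps br_bilinear)

lemma poisson_der_diff: "poisson_der T \<Longrightarrow> poisson_der U \<Longrightarrow> poisson_der (\<lambda>f. T f - U f)"
  unfolding poisson_der_def by (auto simp: GG_diff algebra_simps br_diff)

lemma poisson_der_C_mult: "poisson_der T \<Longrightarrow> poisson_der (\<lambda>f. C c * T f)"
  unfolding poisson_der_def by (auto simp: GG_C_mult algebra_simps br_bilinear mult.left_commute[of "C c"])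

lemma poisson_der_zero: "poisson_der (\<lambda>f. 0)"
  unfolding poisson_der_def by (auto simp: br_drop_const drop_const_linear)

lemma poisson_der_sum_fun: "(\<And>x. x \<in> A \<Longrightarrow> poisson_der (F x)) \<Longrightarrow> poisson_der (\<lambda>f. \<Sum>x\<in>A. F x f)"
  by (induction A rule: infinite_finite_induct) (auto intro: poisson_der_zero poisson_der_add)

text \<open>A derivation of the Poisson algebra descends to functions modulo constants once it sends
  constants to constants and maps \<open>GG\<close> into \<open>OA\<close> without top term. The
  outer derivations below all arise in this way.\<close>

lemma poisson_der_drop_const:
  assumes add: "\<And>f g. E (f + g) = E f + E g" and C: "\<And>c f. E (C c * f) = C c * E f"
    and poisson: "\<And>f g. E (P f g) = P (E f) g + P f (E g)"
    and one: "drop_const (E 1) = 0"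
    and OA: "\<And>f. f \<in> GG \<Longrightarrow> E f \<in> OA" and tau: "\<And>f. f \<in> GG \<Longrightarrow> coef (E f) tau = 0"
  shows "poisson_der (\<lambda>f. drop_const (E f))"
proof -
  have diff: "E (f - g) = E f - E g" for f g
    using add[of "f - g" g] by simp
  have const: "drop_const (E (C c)) = 0" for c
    using one C[of c 1] by (simp add: drop_const_linear)
  have "drop_const (E (br f g)) = br (drop_const (E f)) g + br f (drop_const (E g))" for f g
    unfolding br_cut2 unfolding br_def diff poisson drop_const_linear const by (simp add: drop_const_def br_def)
  then show ?thesis
    unfolding poisson_der_def by (auto simp: add C drop_const_linear GG_drop_const OA tau)
qed

lemma poisson_der_br_GG: "F \<in> GG \<Longrightarrow> poisson_der (br F)"
  unfolding poisson_der_def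
  by (auto simp: br_GG GG_OA br_bilinear) (simp add: br_def poisson_diff poisson_Jacobi[of r F] C_simps)

text \<open>The exponent of \<open>x\<^sub>j\<^sup>(\<^sup>q\<^sup>)\<close>, just outside the truncated algebra.\<close>

definition top_power :: "nat \<Rightarrow> nat \<Rightarrow> nat" where
  "top_power j = (\<lambda>i. if i = j then q j else 0)"

lemma fin_top_power [simp]: "fin_index (top_power j)"
  by (auto simp: fin_index_def top_power_def)

lemma dec_top_power: "j \<in> S \<Longrightarrow> dec j (top_power j) \<in> II"
  using q_ge_3 by (fastforce simp: II_S dec_def top_power_def)

lemma partial_top_power: "j \<in> S \<Longrightarrow> partial i (X (top_power j)) = (if i = j then X (dec j (top_power j)) else 0)"
  using q_ge_3[of j] by (simp add: partial_X) (simp add: top_power_def)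

lemma P_top_power: "j \<in> S \<Longrightarrow> P (X (top_power j)) f = C (sg j) * (X (dec j (top_power j)) * partial (cj j) f)"
  by (simp add: P_def partial_top_power if_distrib[of "\<lambda>x. x * _"] if_distrib[of "\<lambda>x. _ * x"] cong: if_cong)

text \<open>Since x_j^(q) lies outside \<open>OA\<close>, closure is seen from the explicit
  operator, a multiple of x_j^(q-1) \<partial>_{j'}. A top term of the result would need the full
  exponent q of x_{j'} in \<open>f\<close>, which truncation excludes.\<close>

lemma poisson_der_br_top_power:
  assumes j: "j \<in> S"
  shows "poisson_der (br (X (top_power j)))"
proof -
  have "poisson_der (\<lambda>f. drop_const (P (X (top_power j)) f))"
  proof (rule poisson_der_drop_const)
    fix f assume f: "f \<in> GG"
    show "P (X (top_power j)) f \<in> OA"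
      unfolding P_top_power[OF j]
      by (intro OA_C_mult OA_mult OA_X dec_top_power j OA_partial GG_OA f)
    let ?b = "sub_index tau (dec j (top_power j))"
    have "?b (cj j) = q (cj j) - 1"
      using cj_neq[OF j] cj_S[OF j] by (simp add: dec_apply top_power_def tau_S)
    then have "inc (cj j) ?b \<notin> II"
      using IIq[of "inc (cj j) ?b" "cj j"] q_ge_3[of "cj j"] j by (auto simp: inc_apply)
    then have "coef (partial (cj j) f) ?b = 0"
      using OA_D[OF GG_OA[OF f]] by simp
    then show "coef (P (X (top_power j)) f) tau = 0"
      unfolding P_top_power[OF j] coef_C_mult
      by (simp only: coef_X_mult fin_index_dec fin_top_power II_fin[OF tau_II]) simp
  qed (rule poisson_add_right poisson_C_mult_right poisson_Jacobi | simp add: drop_const_linear)+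
  then show ?thesis
    by (simp add: br_drop_const[abs_def])
qed

lemma poisson_der_br_tau: "poisson_der (br (X tau))"
proof -
  have "poisson_der (\<lambda>f. drop_const (P (X tau) f))"
    by (rule poisson_der_drop_const)
      (rule poisson_add_right poisson_C_mult_right poisson_Jacobi | simp add: drop_const_linear OA_poisson poisson_tau OA_X GG_OA)+
  then show ?thesis
    by (simp add: br_drop_const[abs_def])
qed

definition deg :: "'k dps \<Rightarrow> 'k dps" where
  "deg f = (\<Sum>i\<in>S. X (e i) * partial i f)"

text \<open>The Poisson bracket lowers the degree by 2, so the degree minus 2 is additive and gives
  a derivation.\<close>

definition delta :: "'k dps \<Rightarrow> 'k dps" where
  "delta f = deg f - 2 * f"

definition sz :: "(nat \<Rightarrow> nat) \<Rightarrow> nat" where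
  "sz a = (\<Sum>i\<in>S. a i)"

lemma coef_deg: "fin_index a \<Longrightarrow> coef (deg f) a = of_nat (sz a) * coef f a"
proof -
  assume a: "fin_index a"
  have "coef (deg f) a = (\<Sum>i\<in>S. of_nat (a i) * coef f a)"
    unfolding deg_def coef_sum coef_X_unit_mult[OF a] by (rule sum.cong) (auto simp: inc_dec)
  then show ?thesis by (simp add: sz_def sum_distrib_right)
qed

lemma coef_delta: "fin_index a \<Longrightarrow> coef (delta f) a = (of_nat (sz a) - 2) * coef f a"
  using coef_C_mult[of 2 f a] by (simp add: delta_def coef_deg left_diff_distrib C_numeral)

lemma delta_add: "delta (f + g) = delta f + delta g"
  by (rule dps_eqI) (simp add: coef_delta algebra_simps)

lemma delta_C_mult: "delta (C c * f) = C c * delta f"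
  by (rule dps_eqI) (simp add: coef_delta)

lemma deg_mult: "deg (f * g) = deg f * g + f * deg g"
  by (simp add: deg_def partial_mult algebra_simps sum.distrib sum_distrib_left sum_distrib_right)

lemma deg_C [simp]: "deg (C c) = 0"
  by (simp add: deg_def)

lemma sz_inc: "i \<in> S \<Longrightarrow> sz (inc i a) = Suc (sz a)"
proof -
  assume i: "i \<in> S"
  have "sz (inc i a) = (\<Sum>j\<in>S. a j + (if j = i then 1 else 0))"
    unfolding sz_def by (rule sum.cong) (auto simp: inc_apply)
  then show ?thesis
    using i by (simp add: sum.distrib sz_def)
qed

lemma partial_deg: "i \<in> S \<Longrightarrow> partial i (deg f) = deg (partial i f) + partial i f"
  by (rule dps_eqI) (simp add: coef_deg sz_inc algebra_simps)

lemma deg_sum: "deg (\<Sum>x\<in>A. F x) = (\<Sum>x\<in>A. deg (F x))"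
  by (rule dps_eqI) (simp add: coef_deg sum_distrib_left)

lemma delta_P: "delta (P f g) = P (delta f) g + P f (delta g)"
proof -
  have deg: "deg (P f g) + 2 * P f g = P (deg f) g + P f (deg g)"
  proof -
    have "P (deg f) g + P f (deg g) = (\<Sum>i\<in>S. C (sg i) * (deg (partial i f) * partial (cj i) g) + C (sg i) * (partial i f * deg (partial (cj i) g))
        + 2 * (C (sg i) * (partial i f * partial (cj i) g)))"
      unfolding P_def sum.distrib[symmetric] by (rule sum.cong) (simp_all add: partial_deg algebra_simps)
    then show ?thesis
      by (simp add: P_def deg_sum deg_mult distrib_left sum.distrib flip: sum_distrib_left)
  qed
  have "P (2 * f) g = 2 * P f g" "P f (2 * g) = 2 * P f g"
    using poisson_C_mult_left[of r 2 f g] poisson_C_mult_right[of r f 2 g] by (simp_all add: C_numeral)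
  then show ?thesis
    using deg by (simp add: delta_def poisson_diff algebra_simps)
qed

lemma poisson_der_delta: "poisson_der (\<lambda>f. drop_const (delta f))"
proof (rule poisson_der_drop_const)
  show "drop_const (delta 1) = 0"
    by (rule dps_eqI) (simp add: coef_drop_const coef_delta coef_one)
next
  fix f assume f: "f \<in> GG"
  show "delta f \<in> OA"
  proof (rule OA_I)
    fix a assume "a \<notin> II"
    then show "coef (delta f) a = 0"
      using OA_D[OF GG_OA[OF f], of a] coef_delta[of a f] coef_not_fin[of a "delta f"]
      by (cases "fin_index a") auto
  qed
  show "coef (delta f) tau = 0"
    using GG_tau[OF f] by (simp add: coef_delta II_fin)
qed (simp_all add: delta_add delta_C_mult delta_P)

text \<open>The cube of a derivation is a derivation in characteristic 3, because the mixed Leibniz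
  terms have coefficient 3; the exponent \<open>3 ^ j\<close> comes from iterated cubing.\<close>

lemma partial_power_mult: "(partial k ^^ 3 ^ j) (f * g) = (partial k ^^ 3 ^ j) f * g + f * (partial k ^^ 3 ^ j) (g :: 'k dps)"
proof (induction j arbitrary: f g)
  case 0
  then show ?case by (simp add: partial_mult)
next
  case (Suc j)
  let ?D = "partial k ^^ 3 ^ j"
  have "(3 :: 'k dps) = 0"
    using three_eq_0 C_numeral[of "num.One", where 'a='k] C_numeral[of "num.Bit1 num.One", where 'a='k] by (simp add: C_simps)
  then have 3: "3 * x = 0" for x :: "'k dps" by simp
  have "?D (?D (?D (f * g))) = ?D (?D (?D f)) * g + f * ?D (?D (?D g)) +
      3 * (?D (?D f) * ?D g + ?D f * ?D (?D g))"
    unfolding Suc partial_power_add by (simp add: algebra_simps)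
  then show ?case
    unfolding power_Suc power_three_power 3 by simp
qed

lemma partial_power_P: "(partial k ^^ 3 ^ j) (P f g) = P ((partial k ^^ 3 ^ j) f) g + P f ((partial k ^^ 3 ^ j) g)"
  by (simp add: P_def partial_power_sum partial_power_C_mult partial_power_mult partial_power_partial distrib_left sum.distrib)

lemma poisson_der_partial_power: "poisson_der (\<lambda>f. drop_const ((partial k ^^ 3 ^ j) f))"
proof (rule poisson_der_drop_const)
  show "drop_const ((partial k ^^ 3 ^ j) (1 :: 'k dps)) = 0"
  proof (rule dps_eqI)
    fix a :: "nat \<Rightarrow> nat"
    have "a(k := a k + 3 ^ j) \<noteq> zi"
      by (metis add_is_0 fun_upd_same power_not_zero zero_index_apply zero_neq_numeral)
    then show "coef (drop_const ((partial k ^^ 3 ^ j) 1)) a = coef (0 :: 'k dps) a"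
      by (simp add: coef_drop_const coef_partial_power coef_one)
  qed
next
  fix f assume f: "f \<in> GG"
  have up: "a \<in> II" if "a(k := a k + 3 ^ j) \<in> II" for a
    using II_le[OF that, of a] by (simp add: le_fun_def)
  then show "(partial k ^^ 3 ^ j) f \<in> OA"
    by (intro OA_I) (metis OA_D[OF GG_OA[OF f]] coef_partial_power)
  have "tau(k := tau k + 3 ^ j) \<notin> II"
  proof
    assume "tau(k := tau k + 3 ^ j) \<in> II"
    then have "(tau(k := tau k + 3 ^ j)) k \<le> tau k"
      using le_tau unfolding le_fun_def by blast
    then show False by simp
  qed
  then show "coef ((partial k ^^ 3 ^ j) f) tau = 0"
    using OA_D[OF GG_OA[OF f]] by (simp add: coef_partial_power)
qed (simp_all add: partial_power_add partial_power_C_mult partial_power_P)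

text \<open>Normalised so that bracketing with \<open>y j\<close> is the \<open>j\<close>-th partial derivative.\<close>

definition y :: "nat \<Rightarrow> 'k dps" where
  "y j = C (sg (cj j)) * X (e (cj j))"

lemma y_GG: "j \<in> S \<Longrightarrow> y j \<in> GG"
  by (simp add: y_def GG_C_mult GG_X)

lemma P_y: "j \<in> S \<Longrightarrow> P (y j) f = partial j f"
  by (simp add: y_def poisson_C_mult_left P_X_unit mult.assoc[symmetric] C_simps poisson_uminus flip: C_mult)

lemma P_y_right: "j \<in> S \<Longrightarrow> P f (y j) = - partial j f"
  by (simp add: poisson_commute[of r f] P_y)

lemma br_y: "j \<in> S \<Longrightarrow> br (y j) f = drop_const (partial j f)" "j \<in> S \<Longrightarrow> br f (y j) = - drop_const (partial j f)"
  by (simp_all add: br_drop_const P_y P_y_right drop_const_linear)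

lemma X_e_eq: "k \<in> S \<Longrightarrow> X (e k) = C (sg k) * y (cj k)"
  by (simp add: y_def mult.assoc[symmetric] C_simps flip: C_mult)

lemma poisson_der_drop_const_partial:
  assumes "poisson_der T" "j \<in> S" "f \<in> GG"
  shows "T (drop_const (partial j f)) = br (T (y j)) f + drop_const (partial j (T f))"
  using poisson_derD(4)[OF assms(1) y_GG[OF assms(2)] assms(3)] by (simp add: br_y assms(2))

lemma partial_y: "i \<in> S \<Longrightarrow> j \<in> S \<Longrightarrow> drop_const (partial j (y i)) = 0"
  by (simp add: y_def partial_C_mult partial_X_unit drop_const_linear)
    (metis C_simps(5) drop_const_linear(4) mult.right_neutral drop_const_linear(3,5) mult_zero_right)

text \<open>\<open>T\<close> is applied to the vanishing bracket of \<open>y j\<close> and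
  \<open>y i\<close>. The bracket is taken modulo constants, hence so is the closedness of the
  1-form with components \<open>T (y j)\<close>.\<close>

lemma poisson_der_y_closed:
  assumes T: "poisson_der T" and "i \<in> S" "j \<in> S"
  shows "drop_const (partial i (T (y j))) = drop_const (partial j (T (y i)))"
  using poisson_der_drop_const_partial[OF T, of j "y i"] assms by (simp add: y_GG partial_y poisson_der_0 br_y)

text \<open>The coefficient of \<open>T s\<close> at x_j x_l occurs in both instances of the
  derivation rule and drops out of their difference. For quadratic \<open>s\<close> what remains is
  a relation between the linear coefficients of the \<open>T (y j)\<close>.\<close>

lemma poisson_der_y_quadratic:
  assumes T: "poisson_der T" and jl: "j \<in> S" "l \<in> S" and s: "s \<in> GG"
  shows "coef (T (drop_const (partial j s))) (e l) - coef (T (drop_const (partial l s))) (e j) =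
    coef (P (T (y j)) s) (e l) - coef (P (T (y l)) s) (e j)"
proof -
  have "inc l (e j) = inc j (e l)"
    by (simp add: unit_index_def inc_inc)
  then show ?thesis
    using poisson_der_drop_const_partial[OF T jl(1) s] poisson_der_drop_const_partial[OF T jl(2) s] by (simp add: br_drop_const coef_drop_const)
qed

definition e2 :: "nat \<Rightarrow> nat \<Rightarrow> nat \<Rightarrow> nat" where
  "e2 i j = inc i (e j)"

lemma e2_apply: "e2 i j k = (if k = i then 1 else 0) + (if k = j then 1 else 0)"
  by (simp add: e2_def unit_index_apply inc_apply)

lemma e2_commute: "e2 i j = e2 j i"
  by (simp add: e2_def unit_index_def inc_inc)

lemma e2_IS: "i \<in> S \<Longrightarrow> j \<in> S \<Longrightarrow> sz tau \<ge> 3 \<Longrightarrow> e2 i j \<in> IS"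
proof -
  assume ij: "i \<in> S" "j \<in> S" and t: "sz tau \<ge> 3"
  have "e2 i j \<in> II"
    using ij q_ge_3 by (fastforce simp: II_S e2_apply)
  moreover have "sz (e2 i j) = 2"
    using ij by (simp add: e2_def unit_index_def sz_inc) (simp add: sz_def)
  ultimately show ?thesis
    using t by (auto simp: IS_iff e2_def)
qed

end

text \<open>For \<open>r = 1\<close> the cubic \<open>x\<^sub>i\<^sup>(\<^sup>3\<^sup>)\<close> is needed, which exists only if \<open>n i > 1\<close>.\<close>

locale ham_big = ham r n kk for r n and kk :: "'k::field itself" +
  assumes big: "r = 1 \<Longrightarrow> i \<in> {1..2 * r} \<Longrightarrow> n i \<ge> 2"
begin

lemma q_ge_9: "r = 1 \<Longrightarrow> i \<in> S \<Longrightarrow> q i \<ge> 9"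
proof -
  assume "r = 1" "i \<in> S"
  then have "n i \<ge> 2" using big[of i] unfolding S_def by blast
  then show ?thesis
    using power_increasing[of 2 "n i" "3::nat"] by (simp add: q_def)
qed

lemma other_pair:
  assumes "r \<noteq> 1" "i \<in> S"
  obtains k where "k \<in> S" "k \<noteq> i" "k \<noteq> cj i" "cj k \<noteq> i" "cj k \<noteq> cj i"
proof -
  have "r \<ge> 2" using assms r_pos by simp
  define k where "k = (if i = 1 \<or> cj i = 1 then 2 else (1::nat))"
  have "k \<in> S" using one_S by (simp add: k_def)
  moreover have "k \<noteq> i" "k \<noteq> cj i"
    using \<open>r \<ge> 2\<close> assms(2) by (auto simp: k_def cj_def ham_conj_def S_def split: if_splits)
  ultimately show ?thesis
    using that assms(2) cj_eq_iff[of k i] cj_inj[of k i] by auto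
qed

text \<open>For \<open>r = 1\<close> a single exponent already contributes 8; for larger
  \<open>r\<close> there are at least four variables contributing 2 each. The bound keeps quadratic
  and cubic monomials away from the top.\<close>

lemma sz_tau: "sz tau \<ge> 8"
proof (cases "r = 1")
  case True
  have "tau 1 \<le> sz tau"
    unfolding sz_def by (rule member_le_sum) (use one_S in auto)
  then show ?thesis
    using q_ge_9[OF True one_S(1)] one_S by (simp add: tau_S)
next
  case False
  have "card S * 2 \<le> sz tau"
    using sum_bounded_below[of S 2 tau] q_ge_3 by (fastforce simp: tau_S sz_def)
  then show ?thesis
    using False r_pos by (simp add: S_def)
qed

lemma small_IS:
  assumes "a \<in> II" "sz a > 0" "sz a < 8"
  shows "a \<in> IS"
  using assms sz_tau by (auto simp: IS_iff sz_def)

lemma e2_in [simp]: "i \<in> S \<Longrightarrow> j \<in> S \<Longrightarrow> e2 i j \<in> IS"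
  using e2_IS sz_tau by simp

lemma X_GG_e2: "i \<in> S \<Longrightarrow> j \<in> S \<Longrightarrow> X (e2 i j) \<in> GG"
  by (simp add: GG_X)

lemma fin_e2 [simp]: "fin_index (e2 i j)"
  by (simp add: e2_def)

lemma partial_X_e2: "partial k (X (e2 i j)) = (if k = i then X (e j) else if k = j then X (e i) else 0)"
proof -
  have "dec i (e2 i j) = e j" "dec j (e2 i j) = e i" for i j
    by (metis dec_inc e2_def e2_commute)+
  then show ?thesis
    by (auto simp: partial_X e2_apply)
qed

lemma drop_const_X: "a \<noteq> zi \<Longrightarrow> drop_const (X a) = X a"
  by (simp add: drop_const_def coef_X C_simps)

lemma coef_X_e_mult: "coef (X (e k) * f) (e l) = (if k = l then coef f zi else 0)"
  by (simp add: coef_X_unit_mult unit_index_apply) (simp add: unit_index_def)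

lemma inc_zi: "inc j zi = e j"
  by (simp add: unit_index_def)

lemma poisson_der_T_e:
  assumes "poisson_der T" "k \<in> S"
  shows "coef (T (X (e k))) a = sg k * coef (T (y (cj k))) a"
  using assms by (simp add: X_e_eq poisson_derD(3) y_GG)

text \<open>With \<open>u\<^sub>j = T (y j)\<close>, the 1-form \<open>\<Sum> u\<^sub>j dx\<^sub>j\<close> is closed up to a constant 2-form. Applying
  \<open>T\<close> to the brackets of the quadratic monomials with \<open>y j\<close> shows that this 2-form is a multiple of
  the symplectic form, which the degree derivation accounts for.\<close>

lemma poisson_der_skew_off:
  assumes T: "poisson_der T" and kl: "k \<in> S" "l \<in> S" "l \<noteq> k"
  shows "coef (T (y (cj k))) (e l) = coef (T (y l)) (e (cj k))"
proof -
  have s: "X (e2 k k) \<in> GG" using kl by (simp add: X_GG_e2)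
  have P: "P u (X (e2 k k)) = - (C (sg k) * (X (e k) * partial (cj k) u))" for u
    using kl by (subst poisson_commute) (simp add: P_def partial_X_e2 if_distrib[of "\<lambda>x. x * _"] if_distrib[of "\<lambda>x. _ * x"] cong: if_cong)
  show ?thesis
    using poisson_der_y_quadratic[OF T kl(1,2) s] kl
    by (simp add: P partial_X_e2 drop_const_X coef_X_e_mult poisson_der_T_e[OF T] poisson_der_0[OF T] drop_const_linear inc_zi)
qed

text \<open>The product x_k x_m couples the conjugate pair of \<open>k\<close> with that of
  \<open>m\<close>, so a single scalar describes the skew part on all pairs.\<close>

lemma poisson_der_skew_diag:
  assumes T: "poisson_der T" and km: "k \<in> S" "m \<in> S"
  shows "sg m * (coef (T (y (cj m))) (e m) - coef (T (y m)) (e (cj m))) =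
    sg k * (coef (T (y (cj k))) (e k) - coef (T (y k)) (e (cj k)))"
proof (cases "m = k \<or> m = cj k")
  case True
  then show ?thesis using km by (auto simp: algebra_simps)
next
  case False
  have s: "X (e2 k m) \<in> GG" using km by (simp add: X_GG_e2)
  have P: "P u (X (e2 k m)) = - (C (sg k) * (X (e m) * partial (cj k) u)) - (C (sg m) * (X (e k) * partial (cj m) u))" for u
  proof -
    have "P (X (e2 k m)) u = (\<Sum>i\<in>S. (if i = k then C (sg k) * (X (e m) * partial (cj k) u) else 0) +
        (if i = m then C (sg m) * (X (e k) * partial (cj m) u) else 0))"
      unfolding P_def by (rule sum.cong) (use False in \<open>auto simp: partial_X_e2\<close>)
    then show ?thesis
      using km by (subst poisson_commute) (simp add: sum.distrib)
  qed
  show ?thesis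
    using poisson_der_y_quadratic[OF T km s] km False
    by (simp add: P partial_X_e2 drop_const_X coef_X_e_mult poisson_der_T_e[OF T] inc_zi algebra_simps)
qed

lemma coef_delta_y: "j \<in> S \<Longrightarrow> delta (y j) = - y j"
proof (rule dps_eqI)
  fix a assume j: "j \<in> S" and a: "fin_index a"
  have "sz (e (cj j)) = 1"
    using j by (simp add: unit_index_def sz_inc) (simp add: sz_def)
  then show "coef (delta (y j)) a = coef (- y j) a"
    using a by (auto simp: coef_delta y_def coef_X)
qed

text \<open>Poincare lemma. Integration of divided powers needs no division: the coefficient of
  \<open>F\<close> at \<open>a\<close> is that of \<open>u j\<close> at \<open>dec j a\<close> for
  any \<open>j\<close> in \<open>S\<close> with \<open>a j > 0\<close>, and closedness makes the
  choice of \<open>j\<close> irrelevant. Untruncated series leave no obstruction at the top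
  exponents. The last conclusion excludes exponents in which no variable from \<open>S\<close>
  occurs.\<close>

lemma closed_imp_exact:
  assumes closed: "\<And>i j. i \<in> S \<Longrightarrow> j \<in> S \<Longrightarrow> partial i (u j) = partial j (u i :: 'k dps)"
  shows "\<exists>F. coef F zi = 0 \<and> (\<forall>j\<in>S. partial j F = u j) \<and> (\<forall>a. coef F a \<noteq> 0 \<longrightarrow> (\<exists>j\<in>S. a j > 0))"
proof -
  define g where "g a = (if fin_index a \<and> (\<exists>j\<in>S. a j > 0)
    then let j = (SOME j. j \<in> S \<and> a j > 0) in coef (u j) (dec j a) else 0)" for a
  define F where "F = Abs_dps g"
  have F: "coef F = g"
    unfolding F_def by (rule Abs_dps_inverse) (simp add: g_def)
  have "partial j F = u j" if j: "j \<in> S" for j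
  proof (rule dps_eqI)
    fix a :: "nat \<Rightarrow> nat" assume a: "fin_index a"
    define i where "i = (SOME i. i \<in> S \<and> inc j a i > 0)"
    have ex: "j \<in> S \<and> inc j a j > 0" using j by (simp add: inc_apply)
    have i: "i \<in> S" "inc j a i > 0"
      using someI[of "\<lambda>i. i \<in> S \<and> inc j a i > 0", OF ex] by (auto simp: i_def)
    have "g (inc j a) = coef (u i) (dec i (inc j a))"
      using a ex unfolding g_def i_def by (auto simp: Let_def)
    also have "\<dots> = coef (u j) a"
    proof (cases "i = j")
      case False
      then have ai: "a i > 0" using i by (simp add: inc_apply)
      have "dec i (inc j a) = inc j (dec i a)"
        using False by (auto simp: fun_eq_iff inc_apply dec_apply)
      then have "coef (u i) (dec i (inc j a)) = coef (partial j (u i)) (dec i a)"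
        by simp
      also have "\<dots> = coef (u j) a"
        using closed[OF i(1) j] ai by (metis coef_partial inc_dec)
      finally show ?thesis .
    qed simp
    finally show "coef (partial j F) a = coef (u j) a"
      by (simp add: F)
  qed
  moreover have "coef F zi = 0" "\<forall>a. coef F a \<noteq> 0 \<longrightarrow> (\<exists>j\<in>S. a j > 0)"
    by (auto simp: F g_def)
  ultimately show ?thesis by blast
qed

lemma top_power_notin: "j \<in> S \<Longrightarrow> top_power j \<notin> II"
  using IIq[of "top_power j" j] by (auto simp: top_power_def)

lemma top_power_inj: "i \<in> S \<Longrightarrow> top_power i = top_power j \<Longrightarrow> i = j"
  using q_ge_3[of i] by (metis le_zero_eq top_power_def zero_neq_numeral)

text \<open>Lowering any variable of \<open>a\<close> must lead into \<open>II\<close>. So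
  \<open>a\<close> exceeds the bound in one variable and by exactly one, and no second variable can
  occur, since lowering that one would leave the excess in place.\<close>

lemma primitive_support:
  assumes F: "\<And>j. j \<in> S \<Longrightarrow> partial j F \<in> OA" "\<And>a. coef F a \<noteq> 0 \<Longrightarrow> \<exists>j\<in>S. a j > 0"
    and a: "coef F a \<noteq> 0" "a \<notin> II"
  shows "\<exists>j\<in>S. a = top_power j"
proof -
  have dec: "dec i a \<in> II" if "i \<in> S" "a i > 0" for i
    using OA_D[OF F(1)[OF that(1)], of "dec i a"] a that by (auto simp: inc_dec)
  obtain k where k: "k \<in> S" "a k > 0" using F(2) a by blast
  have out: "a i = 0" if "i \<notin> S" for i
    using II_posS[OF dec[OF k], of i] that k by (cases "i = k") (auto simp: dec_apply)
  then obtain j where j: "j \<in> S" "a j \<ge> q j"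
    using a(2) out unfolding II_S by (auto simp: not_less)
  have pos: "a j > 0" using j q_ge_3[of j] by simp
  have aj: "a j = q j"
    using IIq[OF dec[OF j(1) pos] j(1)] j by (simp add: dec_apply)
  have "a i = 0" if "i \<noteq> j" for i
  proof (rule ccontr)
    assume "a i \<noteq> 0"
    then have "i \<in> S" "a i > 0" using out[of i] by (metis, simp)
    from IIq[OF dec[OF this] j(1)] show False
      using that aj by (simp add: dec_apply)
  qed
  then have "a = top_power j"
    using aj by (auto simp: top_power_def)
  then show ?thesis using j by blast
qed

text \<open>Hamiltonian functions that preserve \<open>GG\<close> under the bracket; each of these
  monomials lies outside \<open>GG\<close>.\<close>

definition outer :: "(nat \<Rightarrow> 'k) \<Rightarrow> 'k \<Rightarrow> 'k dps" where
  "outer w z = (\<Sum>j\<in>S. C (w j) * X (top_power j)) + C z * X tau"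

lemma br_outer: "br (outer w z) f = (\<Sum>j\<in>S. C (w j) * br (X (top_power j)) f) + C z * br (X tau) f"
  by (simp add: br_drop_const outer_def poisson_add_left poisson_sum_left poisson_C_mult_left drop_const_linear drop_const_sum)

lemma poisson_der_outer: "poisson_der (br (outer w z))"
proof -
  have "poisson_der (\<lambda>f. (\<Sum>j\<in>S. C (w j) * br (X (top_power j)) f) + C z * br (X tau) f)"
    by (intro poisson_der_add poisson_der_sum_fun poisson_der_C_mult poisson_der_br_top_power poisson_der_br_tau)
  then show ?thesis
    by (simp add: br_outer[abs_def])
qed

lemma coef_outer: "fin_index a \<Longrightarrow>
  coef (outer w z) a = (\<Sum>j\<in>S. if a = top_power j then w j else 0) + (if a = tau then z else 0)"
  using II_fin[OF tau_II] by (auto simp: outer_def coef_X intro!: sum.cong)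

lemma coef_outer_top: "j \<in> S \<Longrightarrow> coef (outer w z) (top_power j) = w j"
proof -
  assume j: "j \<in> S"
  have "(\<Sum>i\<in>S. if top_power j = top_power i then w i else 0) = (\<Sum>i\<in>S. if i = j then w i else 0)"
    by (rule sum.cong) (use top_power_inj[OF j] in auto)
  then show ?thesis
    using j top_power_notin[OF j] tau_II by (auto simp: coef_outer)
qed

lemma coef_outer_II: "a \<in> II \<Longrightarrow> coef (outer w z) a = (if a = tau then z else 0)"
  using top_power_notin by (auto simp: coef_outer II_fin intro!: sum.neutral)

lemma poisson_der_reduce_y:
  assumes T: "poisson_der T"
  shows "\<exists>F w z s. F \<in> GG \<and> (\<forall>j\<in>S. T (y j) = br F (y j) + br (outer w z) (y j) + C s * drop_const (delta (y j)))"
proof -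
  \<comment> \<open>The skew part on the pair of 1; by \<open>poisson_der_skew_diag\<close> the same
    number occurs on every pair.\<close>
  define s where "s = sg 1 * (coef (T (y (cj 1))) (e 1) - coef (T (y 1)) (e (cj 1)))"
  define T1 where "T1 f = T f - C s * drop_const (delta f)" for f
  have T1: "poisson_der T1"
    unfolding T1_def[abs_def] by (intro poisson_der_diff T poisson_der_C_mult poisson_der_delta)
  have T1y: "T1 (y j) = T (y j) + C s * y j" if "j \<in> S" for j
    using that by (simp add: T1_def coef_delta_y drop_const_linear drop_const_GG y_GG)
  have sym: "coef (T1 (y j)) (e i) = coef (T1 (y i)) (e j)" if ij: "i \<in> S" "j \<in> S" for i j
  proof (cases "j = cj i")
    case False
    then show ?thesis
      using poisson_der_skew_off[OF T1, of "cj j" i] ij cj_eq_iff[of i j] by auto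
  next
    case True
    have "coef (T (y (cj i))) (e i) - coef (T (y i)) (e (cj i)) = sg i * s"
      using arg_cong[OF poisson_der_skew_diag[OF T one_S(1) ij(1)], of "\<lambda>x. sg i * x"] by (simp add: s_def)
    moreover have "coef (y j) a = (if a = e (cj j) then sg (cj j) else 0)" for j a
      by (simp add: y_def coef_X)
    \<comment> \<open>The two \<open>y\<close>-terms in \<open>T1y\<close> add 2 s to the skew part
      s of \<open>T\<close>, and 3 s = 0. This is why the degree derivation enters with coefficient
      exactly \<open>s\<close>.\<close>
    moreover have "x + s * sg i = u - s * sg i" if "x - u = sg i * s" for x u
    proof -
      have "(x + s * sg i) - (u - s * sg i) = 3 * (sg i * s)"
        using that by (simp add: algebra_simps)
      then show ?thesis by (simp only: three_eq_0 mult_zero_left right_minus_eq)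
    qed
    ultimately show ?thesis
      using True ij cj_neq[OF ij(1)]
      by (simp add: T1y)
  qed
  have "partial i (T1 (y j)) = partial j (T1 (y i))" if ij: "i \<in> S" "j \<in> S" for i j
  proof (rule dps_eqI)
    fix a
    show "coef (partial i (T1 (y j))) a = coef (partial j (T1 (y i))) a"
    proof (cases "a = zi")
      case True
      then show ?thesis using sym[OF ij] by (simp add: unit_index_def)
    next
      case False
      then show ?thesis
        using arg_cong[OF poisson_der_y_closed[OF T1 ij], of "\<lambda>f. coef f a"] by (simp add: coef_drop_const)
    qed
  qed
  from closed_imp_exact[OF this] obtain F where F0: "coef F zi = 0"
    and Fd: "\<And>j. j \<in> S \<Longrightarrow> partial j F = T1 (y j)" and Fs: "\<And>a. coef F a \<noteq> 0 \<Longrightarrow> \<exists>j\<in>S. a j > 0"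
    by blast
  define G where "G = F - outer (\<lambda>j. coef F (top_power j)) (coef F tau)"
  have OAF: "partial j F \<in> OA" if "j \<in> S" for j
    unfolding Fd[OF that] using poisson_derD(1)[OF T1 y_GG[OF that]] GG_OA by blast
  have "G \<in> GG"
  proof (rule GG_I)
    fix a assume a: "a \<notin> II"
    show "coef G a = 0"
    proof (cases "\<exists>j\<in>S. a = top_power j")
      case True
      then show ?thesis by (auto simp: G_def coef_outer_top)
    next
      case False
      then have "coef F a = 0"
        using primitive_support[OF OAF Fs, of a] a by blast
      moreover have "coef (outer (\<lambda>j. coef F (top_power j)) (coef F tau)) a = 0"
        using False a tau_II coef_not_fin[of a] coef_outer[of a] by (cases "fin_index a") auto
      ultimately show ?thesis by (simp add: G_def)
    qed
  qed (simp_all add: G_def coef_outer_II F0)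
  \<comment> \<open>With \<open>y j\<close> as second argument the bracket is minus the partial
    derivative, hence the negated coefficients.\<close>
  moreover have "T (y j) = br (- G) (y j) + br (outer (\<lambda>j. - coef F (top_power j)) (- coef F tau)) (y j) + C s * drop_const (delta (y j))"
    if j: "j \<in> S" for j
  proof -
    have "F = G + outer (\<lambda>j. coef F (top_power j)) (coef F tau)"
      by (simp add: G_def)
    moreover have "outer (\<lambda>j. - coef F (top_power j)) (- coef F tau) = - outer (\<lambda>j. coef F (top_power j)) (coef F tau)"
      by (simp add: outer_def C_simps sum_negf)
    ultimately have "br (- G) (y j) + br (outer (\<lambda>j. - coef F (top_power j)) (- coef F tau)) (y j) = br (- F) (y j)"
      by (metis add.inverse_distrib_swap add.commute br_bilinear(1))
    also have "\<dots> = drop_const (T1 (y j))"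
      using Fd[OF j] br_y(2)[OF j, of "- F"] by (simp add: partial_uminus drop_const_linear)
    also have "\<dots> = T1 (y j)"
      using drop_const_GG poisson_derD(1)[OF T1 y_GG[OF j]] by blast
    finally show ?thesis by (simp add: T1_def)
  qed
  moreover have "- G \<in> GG"
    using GG_diff[OF GG_0 \<open>G \<in> GG\<close>] by simp
  ultimately show ?thesis by blast
qed

end

text \<open>Powers of 3 are excluded because all their inner binomial coefficients vanish modulo 3.
  Otherwise \<open>choose_3_mult_mod\<close> strips factors 3 until \<open>D = 3 * E\<close> with
  \<open>E\<close> prime to 3; then m = 3 works, since (D choose 3) is congruent to
  \<open>E\<close>.\<close>

lemma choose_split_mod:
  assumes "3 dvd D" "D > 0" "\<And>j. j \<ge> 1 \<Longrightarrow> D \<noteq> 3 ^ j"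
  shows "\<exists>m. 3 dvd m \<and> 0 < m \<and> m < D \<and> (D choose m) mod 3 \<noteq> 0"
  using assms
proof (induction D rule: less_induct)
  case (less D)
  obtain E where E: "D = 3 * E" using less.prems(1) by (auto simp: dvd_def)
  have E1: "E > 1"
    using less.prems(2) less.prems(3)[of 1] E by (cases E) (auto simp: Suc_lessI)
  show ?case
  proof (cases "3 dvd E")
    case False
    then have "(D choose 3) mod 3 \<noteq> 0"
      unfolding E choose_3_mult_mod by (simp add: dvd_eq_mod_eq_0)
    then show ?thesis
      using E E1 by (intro exI[of _ 3]) auto
  next
    case True
    have "E \<noteq> 3 ^ j" if "j \<ge> 1" for j
      using less.prems(3)[of "Suc j"] E by auto
    then obtain m where m: "3 dvd m" "0 < m" "m < E" "(E choose m) mod 3 \<noteq> 0"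
      using less.IH[of E] E E1 True by auto
    then have "(D choose (3 * m)) mod 3 \<noteq> 0"
      unfolding E choose_3_mult_mod by simp
    then show ?thesis
      using E m by (intro exI[of _ "3 * m"]) auto
  qed
qed

context ham_big
begin

definition Xi :: "nat \<Rightarrow> nat \<Rightarrow> nat \<Rightarrow> nat" where
  "Xi k j = (\<lambda>i. if i = k then 3 ^ j else 0)"

lemma inc_II: "a \<in> II \<Longrightarrow> i \<in> S \<Longrightarrow> inc i a \<in> II \<longleftrightarrow> Suc (a i) < q i"
  using inc_II_iff by (simp add: S_def q_def)

lemma sz_dec: "i \<in> S \<Longrightarrow> a i > 0 \<Longrightarrow> sz a = Suc (sz (dec i a))"
  by (metis inc_dec sz_inc)

lemma IS_dec: "a \<in> IS \<Longrightarrow> dec j a \<noteq> zi \<Longrightarrow> a j > 0 \<Longrightarrow> dec j a \<in> IS"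
  by (metis IS_iff II_dec inc_dec inc_tau)

end

section \<open>Derivations commuting with the partial derivatives\<close>

locale ham_T = ham_big r n kk for r n and kk :: "'k::field itself" +
  fixes T :: "'k dps \<Rightarrow> 'k dps"
  assumes T: "poisson_der T" and T_y: "\<And>j. j \<in> S \<Longrightarrow> T (y j) = 0"
begin

text \<open>Since \<open>T\<close> commutes with all partial derivatives, it is determined by the linear parts
  \<open>E a (e i)\<close> of the images of the monomials (lemma \<open>E_eq_0\<close> below).\<close>

definition E :: "(nat \<Rightarrow> nat) \<Rightarrow> (nat \<Rightarrow> nat) \<Rightarrow> 'k" where
  "E a b = (if a \<in> IS then coef (T (X a)) b else 0)"

lemma T_partial: "j \<in> S \<Longrightarrow> f \<in> GG \<Longrightarrow> T (drop_const (partial j f)) = drop_const (partial j (T f))"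
  using poisson_der_drop_const_partial[OF T] by (simp add: T_y br_drop_const drop_const_linear)

lemma T_X_e: "j \<in> S \<Longrightarrow> T (X (e j)) = 0"
  by (simp add: X_e_eq poisson_derD(3)[OF T] y_GG T_y)

lemma E_e: "E (e j) b = 0"
proof (cases "j \<in> S")
  case False
  then have "e j \<notin> IS"
    using II_posS[OF IS_II, of "e j" j] by (auto simp: unit_index_apply)
  then show ?thesis by (simp add: E_def)
qed (simp add: E_def T_X_e)

text \<open>\<open>T\<close> commutes with the partial derivatives, but only modulo constants,
  whence \<open>b \<noteq> zi\<close>.\<close>

lemma E_inc:
  assumes a: "a \<in> IS" and j: "j \<in> S" and b: "b \<noteq> zi"
  shows "E a (inc j b) = (if a j = 0 then 0 else E (dec j a) b)"
proof -
  have "E a (inc j b) = coef (T (drop_const (partial j (X a)))) b"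
    using a b T_partial[OF j GG_X[OF a]] by (simp add: E_def coef_drop_const)
  also have "\<dots> = (if a j = 0 then 0 else E (dec j a) b)"
  proof (cases "a j = 0")
    case True
    then show ?thesis
      by (simp add: partial_X IS_fin a drop_const_linear poisson_der_0[OF T])
  next
    case False
    then have partial: "partial j (X a) = X (dec j a)" by (simp add: partial_X IS_fin a)
    show ?thesis
    proof (cases "dec j a = zi")
      case True
      then have "a = e j" using False by (metis inc_dec inc_zi neq0_conv)
      then show ?thesis
        using True by (simp add: partial_X unit_index_apply drop_const_linear poisson_der_0[OF T] E_def IS_iff)
          (metis C_simps(5) drop_const_linear(4) coef_zero poisson_der_0[OF T])
    next
      case F: False
      then show ?thesis
        using False IS_dec[OF a F] by (simp add: partial drop_const_X E_def)
    qed
  qed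
  finally show ?thesis .
qed

text \<open>The coefficient at x_i x_j can be lowered by either variable. Comparing the results
  relates the linear parts at neighbouring exponents.\<close>

lemma E_consistent:
  assumes "a \<in> IS" "i \<in> S" "j \<in> S"
  shows "(if a j = 0 then 0 else E (dec j a) (e i)) = (if a i = 0 then 0 else E (dec i a) (e j))"
  using E_inc[OF assms(1) assms(3), of "e i"] E_inc[OF assms(1) assms(2), of "e j"]
  by (simp add: unit_index_def inc_inc[of i j])

lemma E_eq_0:
  assumes "\<And>a i. a \<in> IS \<Longrightarrow> i \<in> S \<Longrightarrow> E a (e i) = 0" and "f \<in> GG"
  shows "T f = 0"
proof -
  have E: "E a b = 0" for a b
  proof (cases "fin_index b")
    case True
    then show ?thesis
    proof (induction b arbitrary: a rule: index_induct)
      case zero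
      show ?case
        using GG_zero[OF poisson_derD(1)[OF T GG_X[of a]]] unfolding E_def by metis
    next
      case (inc i b)
      show ?case
      proof (cases "a \<in> IS \<and> i \<in> S")
        case True
        then show ?thesis
          using assms(1) inc E_inc[of a i b] by (cases "b = zi") (auto simp: inc_zi)
      next
        case False
        show ?thesis
        proof (cases "a \<in> IS")
          case True
          then have "inc i b \<notin> II"
            using False II_posS[of "inc i b" i] by (auto simp: inc_apply)
          then show ?thesis
            using poisson_derD(1)[OF T GG_X[OF True]] GG_OA OA_D by (simp add: E_def)
        qed (simp add: E_def)
      qed
    qed
  qed (simp add: E_def coef_not_fin)
  have "T (X a) = 0" if "a \<in> IS" for a
    using E[of a] that by (intro dps_eqI) (auto simp: E_def)
  then have "(\<Sum>a\<in>IS. T (C (coef f a) * X a)) = 0"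
    by (intro sum.neutral) (simp add: poisson_derD(3)[OF T] GG_X)
  then show ?thesis
    using dps_expand[OF assms(2)] poisson_der_sum[OF T, of IS "\<lambda>a. C (coef f a) * X a"]
    by (simp add: GG_C_mult GG_X)
qed

text \<open>Consistency at \<open>inc l c\<close>: one side is \<open>E c (e k)\<close>, the other
  vanishes because x_k does not occur.\<close>

lemma E_miss:
  assumes "c k = 0" "k \<in> S" "l \<in> S" "l \<noteq> k" "inc l c \<in> IS"
  shows "E c (e k) = 0"
  using E_consistent[OF assms(5) assms(2,3)] assms by (simp add: inc_apply)

lemma sz_e2: "i \<in> S \<Longrightarrow> j \<in> S \<Longrightarrow> sz (e2 i j) = 2"
  by (simp add: e2_def unit_index_def sz_inc) (simp add: sz_def)

text \<open>\<open>E_miss\<close> needs room to raise a variable other than x_k. For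
  \<open>r = 1\<close> and \<open>i = j\<close> the only candidate is x_i itself, raised from
  x_i^(2) to x_i^(3); here the bound q_i \<ge> 9 enters.\<close>

lemma E_e2_off:
  assumes "i \<in> S" "j \<in> S" "k \<in> S" "k \<noteq> i" "k \<noteq> j"
  shows "E (e2 i j) (e k) = 0"
proof -
  have "\<exists>l\<in>S. l \<noteq> k \<and> Suc (e2 i j l) < q l"
  proof (cases "i = j")
    case False
    then show ?thesis
      using assms q_ge_3[of i] by (intro bexI[of _ i]) (auto simp: e2_apply)
  next
    case ij: True
    show ?thesis
    proof (cases "r = 1")
      case True
      then show ?thesis
        using assms q_ge_9[of i] by (intro bexI[of _ i]) (auto simp: e2_apply)
    next
      case False
      then obtain l where "l \<in> S" "l \<noteq> i" "l \<noteq> cj i" by (rule other_pair[OF _ assms(1)])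
      then show ?thesis
        using assms q_ge_3[of l] q_ge_3[of "cj i"] ij cj_neq[of i]
        by (intro bexI[of _ "if k = l then cj i else l"]) (auto simp: e2_apply)
    qed
  qed
  then obtain l where l: "l \<in> S" "l \<noteq> k" "Suc (e2 i j l) < q l" by blast
  have "inc l (e2 i j) \<in> IS"
    using l assms e2_in by (intro small_IS) (auto simp: inc_II IS_II sz_inc sz_e2)
  with l show ?thesis
    using E_miss[of "e2 i j" k l] assms by (simp add: e2_apply)
qed

lemma E_e2_on:
  assumes "i \<in> S" "j \<in> S"
  shows "E (e2 i j) (e i) = E (e2 j j) (e j)"
proof (cases "i = j")
  case False
  have I: "inc i (e2 j j) \<in> IS"
    using assms e2_in q_ge_3[of i] False by (intro small_IS) (auto simp: inc_II IS_II sz_inc sz_e2 e2_apply)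
  have "dec j (inc i (e2 j j)) = e2 i j" "dec i (inc i (e2 j j)) = e2 j j"
    by (simp add: e2_def inc_inc[of i j], simp)
  then show ?thesis
    using E_consistent[OF I assms] False by (simp add: inc_apply e2_apply)
qed simp

text \<open>\<open>W\<close> is linear, so \<open>br W\<close> is the vector field with constant
  coefficients \<open>al j\<close>; it kills the \<open>y j\<close> because constants are dropped.
  By \<open>E_e2_off\<close> and \<open>E_e2_on\<close>, \<open>T\<close> has the same linear parts
  on quadratic monomials.\<close>

lemma reduce_quadratic:
  "\<exists>W\<in>GG. \<forall>f\<in>{X (e2 i j) |i j. i \<in> S \<and> j \<in> S} \<union> y ` S. T f = br W f"
proof -
  define al where "al j = E (e2 j j) (e j)" for j
  define W where "W = (\<Sum>j\<in>S. C (al j) * y j)"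
  have W: "W \<in> GG" by (auto simp: W_def intro!: GG_sum GG_C_mult y_GG)
  have brW: "br W f = (\<Sum>j\<in>S. C (al j) * drop_const (partial j f))" for f
    by (simp add: W_def br_drop_const poisson_sum_left poisson_C_mult_left P_y drop_const_sum drop_const_linear)
  have "T (y j) = br W (y j)" if "j \<in> S" for j
    using that by (simp add: brW T_y partial_y)
  moreover have "T (X (e2 i j)) = br W (X (e2 i j))" if ij: "i \<in> S" "j \<in> S" for i j
  proof (rule dps_eqI)
    fix b assume b: "fin_index b"
    have T: "coef (T (X (e2 i j))) b = E (e2 i j) b"
      using ij by (simp add: E_def)
    have rhs: "coef (br W (X (e2 i j))) b = (\<Sum>k\<in>S. al k * (if k = i then coef (X (e j)) b else if k = j then coef (X (e i)) b else 0))"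
      unfolding brW coef_sum coef_C_mult partial_X_e2 by (rule sum.cong) (auto simp: drop_const_X drop_const_linear)
    also have "\<dots> = (if b = e i then al j else if b = e j then al i else 0)"
    proof (cases "i = j")
      case True
      then have "(\<Sum>k\<in>S. al k * (if k = i then coef (X (e j)) b else if k = j then coef (X (e i)) b else 0)) = (\<Sum>k\<in>S. if k = i then al i * coef (X (e i)) b else 0)"
        by (intro sum.cong) auto
      then show ?thesis using ij True by (simp add: coef_X)
    next
      case False
      then have "(\<Sum>k\<in>S. al k * (if k = i then coef (X (e j)) b else if k = j then coef (X (e i)) b else 0)) =
          (\<Sum>k\<in>S. (if k = i then al i * coef (X (e j)) b else 0) + (if k = j then al j * coef (X (e i)) b else 0))"
        by (intro sum.cong) auto
      then show ?thesis using ij False by (simp add: coef_X sum.distrib)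
    qed
    finally have rhs: "coef (br W (X (e2 i j))) b = (if b = e i then al j else if b = e j then al i else 0)" .
    show "coef (T (X (e2 i j))) b = coef (br W (X (e2 i j))) b"
    proof (cases "b \<in> II")
      case False
      then show ?thesis
        using OA_D[OF GG_OA[OF poisson_derD(1)[OF ham_T.T[OF ham_T_axioms] X_GG_e2[OF ij]]] False] ij
        by (auto simp: rhs)
    next
      case bI: True
      show ?thesis
      proof (cases "b = zi")
        case True
        then show ?thesis
          using GG_zero[OF poisson_derD(1)[OF ham_T.T[OF ham_T_axioms] X_GG_e2[OF ij]]] using True by (simp add: rhs[unfolded True])
      next
        case False
        then obtain k where k: "b k > 0" by (auto simp: fun_eq_iff)
        then have kS: "k \<in> S" using II_posS bI by blast
        have bk: "b = inc k (dec k b)" using k by (simp add: inc_dec)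
        show ?thesis
        proof (cases "dec k b = zi")
          case True
          then have "b = e k" using bk by (simp add: inc_zi)
          then show ?thesis
            unfolding T rhs
            using E_e2_off[OF ij kS] E_e2_on[OF ij] E_e2_on[OF ij(2,1)] by (auto simp: al_def e2_commute[of j i])
        next
          case nz: False
          \<comment> \<open>For \<open>b\<close> of degree at least 2, \<open>E_inc\<close> leads to
            the image of a linear monomial, which is 0.\<close>
          have "dec k (e2 i j) = e i \<or> dec k (e2 i j) = e j" if "e2 i j k > 0"
          proof -
            have "k = i \<or> k = j" using that by (auto simp: e2_apply split: if_splits)
            then show ?thesis by (metis dec_inc e2_commute e2_def)
          qed
          then have "E (e2 i j) b = 0"
            using E_inc[OF e2_in[OF ij] kS nz] bk by (metis E_e neq0_conv)
          moreover have "b \<noteq> e i" for i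
          proof
            assume b: "b = e i"
            then have "k = i" using k by (simp add: unit_index_apply split: if_splits)
            then show False using nz b by (metis dec_inc inc_zi)
          qed
          ultimately show ?thesis
            unfolding T rhs by simp
        qed
      qed
    qed
  qed
  ultimately show ?thesis
    using W by blast
qed

end

lemma binom_index_single:
  assumes "fin_index c" "a \<le> c" "\<And>i. i \<noteq> k \<Longrightarrow> a i = 0"
  shows "binom_index c a = (c k choose a k)"
proof -
  let ?S = "insert k {i. c i \<noteq> 0}"
  have S: "finite ?S" using assms(1) by (simp add: fin_index_def)
  have "binom_index c a = (\<Prod>i\<in>?S. c i choose a i)"
    by (rule binom_index_superset[OF S _ assms(2)]) auto
  also have "\<dots> = (c k choose a k) * (\<Prod>i\<in>?S - {k}. c i choose a i)"
    by (rule prod.remove[OF S]) simp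
  also have "(\<Prod>i\<in>?S - {k}. c i choose a i) = 1"
    by (rule prod.neutral) (use assms(3) in auto)
  finally show ?thesis by simp
qed

lemma binom_index_eq_1:
  assumes "\<And>i. a i = 0 \<or> a i = c i"
  shows "binom_index c a = 1"
  unfolding binom_index_def
proof (rule prod.neutral, rule ballI)
  fix i
  show "(c i choose a i) = 1" using assms[of i] by auto
qed

lemma inc_dec_swap: "k \<noteq> j \<Longrightarrow> inc k (dec j a) = dec j (inc k a)"
  by (rule ext) (simp add: inc_apply dec_apply)

lemma pred_mod_3: "m mod 3 = 0 \<Longrightarrow> m > 0 \<Longrightarrow> (m - 1) mod 3 = (2::nat)"
  by (cases m) (auto simp: mod_Suc split: if_splits)

lemma Suc_mod_3: "Suc m mod 3 = 0 \<Longrightarrow> m mod 3 = 2"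
  by (auto simp: mod_Suc split: if_splits)

lemma mod_3_1_less: "a < m \<Longrightarrow> m mod 3 = 0 \<Longrightarrow> a mod 3 = 1 \<Longrightarrow> Suc a < m"
  using Suc_mod_3[of a] by (cases "Suc a = m") auto

lemma add_inc: "add_index (inc i a) b = inc i (add_index a b)" "add_index a (inc i b) = inc i (add_index a b)"
  by (simp_all add: fun_eq_iff inc_apply)

lemma add_zi: "add_index zero_index b = b" "add_index b zero_index = b"
  by (simp_all add: fun_eq_iff)

lemma choose_two_mod: "x mod 3 = 2 \<Longrightarrow> (x choose 2) mod 3 = 1"
proof -
  assume x: "x mod 3 = 2"
  define m where "m = x div 3"
  have "x = 3 * m + 2"
    using x mult_div_mod_eq[of 3 x] by (simp add: m_def)
  moreover have "(3 * m + 2 choose 2) = (3 * m choose 2) + 3 * (2 * m) + 1"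
    by (simp add: numeral_eq_Suc)
  ultimately have "(x choose 2) mod 3 = ((3 * m choose 2) + 1) mod 3"
    by presburger
  also have "\<dots> = ((3 * m choose 2) mod 3 + 1) mod 3"
    by presburger
  finally show ?thesis
    by (simp add: choose_3_mult_mod)
qed

context ham_big begin

lemma P_X_e2:
  assumes "k \<in> S" "m \<in> S" "k \<noteq> m"
  shows "P (X (e2 k m)) u = C (sg k) * (X (e m) * partial (cj k) u) + C (sg m) * (X (e k) * partial (cj m) u)"
proof -
  have "P (X (e2 k m)) u = (\<Sum>i\<in>S. (if i = k then C (sg k) * (X (e m) * partial (cj k) u) else 0) +
      (if i = m then C (sg m) * (X (e k) * partial (cj m) u) else 0))"
    unfolding P_def by (rule sum.cong) (use assms in \<open>auto simp: partial_X_e2\<close>)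
  then show ?thesis
    using assms by (simp add: sum.distrib)
qed

lemma P_X_e2_same: "k \<in> S \<Longrightarrow> P (X (e2 k k)) u = C (sg k) * (X (e k) * partial (cj k) u)"
  by (simp add: P_def partial_X_e2 if_distrib[of "\<lambda>x. x * _"] if_distrib[of "\<lambda>x. _ * x"] cong: if_cong)

lemma partial_X_cubic:
  assumes "k \<noteq> m"
  shows "partial i (X (inc k (e2 k m))) = (if i = k then X (e2 k m) else if i = m then X (e2 k k) else 0)"
proof -
  have "inc k (e2 k m) = inc m (e2 k k)"
    by (simp add: e2_def unit_index_def inc_inc)
  then have "dec m (inc k (e2 k m)) = e2 k k"
    by simp
  then show ?thesis
    using assms by (auto simp: partial_X inc_apply e2_apply)
qed

lemma P_X_cubic:
  assumes "k \<in> S" "m \<in> S" "k \<noteq> m"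
  shows "P (X (inc k (e2 k m))) u = C (sg k) * (X (e2 k m) * partial (cj k) u) + C (sg m) * (X (e2 k k) * partial (cj m) u)"
proof -
  have "P (X (inc k (e2 k m))) u = (\<Sum>i\<in>S. (if i = k then C (sg k) * (X (e2 k m) * partial (cj k) u) else 0) +
      (if i = m then C (sg m) * (X (e2 k k) * partial (cj m) u) else 0))"
    unfolding P_def by (rule sum.cong) (use assms in \<open>auto simp: partial_X_cubic\<close>)
  then show ?thesis
    using assms by (simp add: sum.distrib)
qed

lemma P_X_cubic_same: "k \<in> S \<Longrightarrow> P (X (inc k (e2 k k))) u = C (sg k) * (X (e2 k k) * partial (cj k) u)"
proof -
  assume k: "k \<in> S"
  have "partial i (X (inc k (e2 k k)) :: 'k dps) = (if i = k then X (e2 k k) else 0)" for i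
    by (auto simp: partial_X inc_apply e2_apply)
  then show ?thesis
    using k by (simp add: P_def if_distrib[of "\<lambda>x. x * _"] if_distrib[of "\<lambda>x. _ * x"] cong: if_cong)
qed

end

section \<open>Linear parts and equivariance under the quadratic polynomials\<close>

locale ham_T2 = ham_T r n kk T for r n and kk :: "'k::field itself" and T +
  assumes T_e2: "\<And>i j. i \<in> S \<Longrightarrow> j \<in> S \<Longrightarrow> T (X (e2 i j)) = 0"
begin

text \<open>The x_i-coefficient of \<open>T f\<close> for \<open>f\<close> in \<open>GG\<close>,
  extended linearly by 0 on monomials outside \<open>IS\<close>. Products and brackets can thus be
  expanded without checking that each term stays in \<open>GG\<close>.\<close>

definition L :: "nat \<Rightarrow> 'k dps \<Rightarrow> 'k" where
  "L i f = (\<Sum>a\<in>IS. coef f a * E a (e i))"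

lemma E_IS: "E a b \<noteq> 0 \<Longrightarrow> a \<in> IS"
  unfolding E_def by presburger

lemma L_add: "L i (f + g) = L i f + L i g"
  by (simp add: L_def algebra_simps sum.distrib)

lemma L_C_mult: "L i (C c * f) = c * L i f"
  by (simp add: L_def sum_distrib_left mult.assoc)

lemma L_of_nat_mult: "L i (of_nat c * f) = of_nat c * L i f"
  using L_C_mult[of i "of_nat c"] by (simp add: C_of_nat)

lemma L_0 [simp]: "L i 0 = 0"
  by (simp add: L_def)

lemma L_sum: "L i (\<Sum>x\<in>A. F x) = (\<Sum>x\<in>A. L i (F x))"
  by (induction A rule: infinite_finite_induct) (auto simp: L_add)

lemma L_drop_const [simp]: "L i (drop_const f) = L i f"
  by (simp add: L_def coef_drop_const) (rule sum.cong, auto simp: IS_iff)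

lemma finite_IS: "finite IS"
  using finite_II by (simp add: IS_def)

lemma L_X: "L i (X g) = E g (e i)"
proof (cases "g \<in> IS")
  case True
  then have "L i (X g) = (\<Sum>a\<in>IS. if a = g then E g (e i) else 0)"
    unfolding L_def by (intro sum.cong) (auto simp: coef_X IS_fin)
  then show ?thesis
    using True finite_IS by simp
next
  case False
  then show ?thesis
    by (auto simp: L_def coef_X E_def intro!: sum.neutral)
qed

lemma L_GG: "f \<in> GG \<Longrightarrow> L i f = coef (T f) (e i)"
proof -
  assume f: "f \<in> GG"
  have "coef (T (\<Sum>a\<in>IS. C (coef f a) * X a)) (e i) = (\<Sum>a\<in>IS. coef f a * coef (T (X a)) (e i))"
    by (subst poisson_der_sum[OF T]) (auto simp: GG_C_mult GG_X poisson_derD(3)[OF T])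
  then show ?thesis
    using dps_expand[OF f] by (simp add: L_def E_def cong: sum.cong)
qed

lemma L_P:
  assumes "f \<in> GG" "g \<in> GG"
  shows "L i (P f g) = coef (P (T f) g) (e i) + coef (P f (T g)) (e i)"
proof -
  have "L i (P f g) = L i (br f g)" by (simp add: br_drop_const)
  also have "\<dots> = coef (br (T f) g + br f (T g)) (e i)"
    using assms by (simp add: L_GG br_GG GG_OA poisson_derD(4)[OF T])
  finally show ?thesis by (simp add: br_drop_const coef_drop_const)
qed

lemma X_mult_L: "fin_index a \<Longrightarrow> fin_index b \<Longrightarrow>
    L i (X a * X b) = of_nat (binom_index (add_index a b) a) * E (add_index a b) (e i)"
  by (simp add: X_mult_X L_of_nat_mult L_X)

lemma X_e_mult_L: "fin_index b \<Longrightarrow> L i (X (e k) * X b) = of_nat (Suc (b k)) * E (inc k b) (e i)"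
proof -
  assume b: "fin_index b"
  have "add_index (e k) b = inc k b"
    by (simp add: unit_index_def add_inc add_zi)
  moreover have "binom_index (inc k b) (e k) = Suc (b k)"
    using binom_index_unit[of "inc k b" k] b by (simp add: inc_apply)
  ultimately show ?thesis
    using b by (simp add: X_mult_L)
qed

text \<open>\<open>T\<close> commutes with the bracket by x_k^(2), which up to sign is x_k
  \<partial>_{k'}, a root vector of the symplectic algebra of quadratics.\<close>

lemma raise_lower:
  assumes k: "k \<in> S" and a: "a \<in> IS"
  shows "(if a (cj k) = 0 then 0 else of_nat (Suc (a k)) * E (inc k (dec (cj k) a)) (e i)) =
    (if i = k then E a (e (cj k)) else 0)"
proof -
  have "L i (P (X (e2 k k)) (X a)) = coef (P (X (e2 k k)) (T (X a))) (e i)"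
    using k a by (simp add: L_P GG_X T_e2)
  moreover have "L i (P (X (e2 k k)) (X a)) = sg k * (if a (cj k) = 0 then 0 else of_nat (Suc (a k)) * E (inc k (dec (cj k) a)) (e i))"
    using k a cj_neq[of k] by (simp add: P_X_e2_same L_C_mult partial_X IS_fin X_e_mult_L dec_apply)
  moreover have "coef (P (X (e2 k k)) (T (X a))) (e i) = sg k * (if i = k then E a (e (cj k)) else 0)"
    using k a by (simp add: P_X_e2_same coef_X_e_mult E_def inc_zi)
  ultimately show ?thesis by simp
qed

text \<open>If x_{k'} could be raised, x_k \<partial>_{k'} would produce \<open>c\<close> from
  \<open>inc (cj k) (dec k c)\<close> with the nonzero factor \<open>c k\<close>, whereas the
  right-hand side of \<open>raise_lower\<close> is 0 for \<open>i \<noteq> k\<close>.\<close>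

lemma E_raise:
  assumes "c \<in> IS" "k \<in> S" "i \<noteq> k" "c k mod 3 \<noteq> 0" "E c (e i) \<noteq> 0"
  shows "Suc (c (cj k)) = q (cj k)"
proof (rule ccontr)
  assume "Suc (c (cj k)) \<noteq> q (cj k)"
  then have lt: "Suc (c (cj k)) < q (cj k)"
    using IIq[OF IS_II[OF assms(1)], of "cj k"] assms(2) by simp
  have ck: "c k > 0" using assms(4) by (cases "c k") auto
  define a where "a = inc (cj k) (dec k c)"
  have kk: "cj k \<noteq> k" using cj_neq assms(2) by blast
  have "a \<in> II"
    unfolding a_def using inc_II[OF II_dec[OF IS_II[OF assms(1)]], of "cj k" k] lt assms(2) kk by (simp add: dec_apply)
  moreover have "a \<noteq> zi" by (simp add: a_def)
  moreover have "Suc (a k) < q k"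
    using IIq[OF IS_II[OF assms(1)] assms(2)] ck kk by (auto simp: a_def inc_apply dec_apply)
  ultimately have "a \<in> IS"
    using neq_tau[of k a] assms(2) by (simp add: IS_iff)
  moreover have "inc k (dec (cj k) a) = c" "Suc (a k) = c k" "a (cj k) \<noteq> 0"
    using ck kk by (auto simp: a_def inc_dec inc_apply dec_apply)
  ultimately have "of_nat (c k) * E c (e i) = 0"
    using raise_lower[OF assms(2), of a i] assms(3) by (simp del: of_nat_Suc)
  then show False
    using assms(4,5) by (simp add: of_nat_0)
qed

text \<open>\<open>T\<close> commutes with the torus element x_k x_{k'}, so linear parts connect
  only monomials of equal weight. Weights are elements of the field, hence known modulo 3.\<close>

lemma weight:
  assumes k: "k \<in> S" and a: "a \<in> IS" and i: "i \<in> S"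
  shows "(of_nat (a (cj k)) - of_nat (a k)) * E a (e i) =
    ((if i = cj k then 1 else 0) - (if i = k then 1 else 0)) * E a (e i)"
proof -
  have X: "L i (X (e j) * partial j (X a)) = of_nat (a j) * E a (e i)" for j
    using a by (cases "a j = 0") (simp_all add: partial_X IS_fin X_e_mult_L inc_dec dec_apply del: of_nat_Suc)
  have "L i (P (X (e2 k (cj k))) (X a)) = coef (P (X (e2 k (cj k))) (T (X a))) (e i)"
    using k a by (simp add: L_P GG_X T_e2)
  moreover have "L i (P (X (e2 k (cj k))) (X a)) = sg k * ((of_nat (a (cj k)) - of_nat (a k)) * E a (e i))"
    using k a cj_neq[of k] by (simp add: P_X_e2 L_add L_C_mult X) (simp add: algebra_simps)
  moreover have "coef (P (X (e2 k (cj k))) (T (X a))) (e i) = sg k * (((if i = cj k then 1 else 0) - (if i = k then 1 else 0)) * E a (e i))"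
    using k a cj_neq[of k] i by (simp add: P_X_e2 coef_X_e_mult E_def inc_zi)
  ultimately show ?thesis by simp
qed

lemma weight_other:
  assumes "k \<in> S" "a \<in> IS" "i \<in> S" "E a (e i) \<noteq> 0" "k \<noteq> i" "k \<noteq> cj i"
  shows "a k mod 3 = a (cj k) mod 3"
proof -
  have "i \<noteq> cj k" using assms cj_cj by metis
  then have "(of_nat (a (cj k)) :: 'k) = of_nat (a k)"
    using weight[OF assms(1-3)] assms by simp
  then show ?thesis by (simp add: of_nat_mod)
qed

lemma weight_same:
  assumes "a \<in> IS" "i \<in> S" "E a (e i) \<noteq> 0"
  shows "a i mod 3 = Suc (a (cj i)) mod 3"
proof -
  have "(of_nat (a (cj i)) - of_nat (a i) + 1) * E a (e i) = 0"
    using weight[OF assms(2,1,2)] assms cj_neq[of i] by (simp add: distrib_right)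
  then have "(of_nat (a (cj i)) - of_nat (a i) + 1 :: 'k) = 0"
    using assms(3) by simp
  then have "(of_nat (a i) :: 'k) = of_nat (Suc (a (cj i)))"
    by (simp add: algebra_simps)
  then show ?thesis by (simp only: of_nat_mod)
qed

text \<open>The weights make both exponents congruent modulo 3; if they are not divisible by 3,
  \<open>E_raise\<close> in both directions makes both of them maximal.\<close>

lemma pair_other:
  assumes "k \<in> S" "a \<in> IS" "i \<in> S" "E a (e i) \<noteq> 0" "k \<noteq> i" "k \<noteq> cj i"
  shows "(a k mod 3 = 0 \<and> a (cj k) mod 3 = 0) \<or> (Suc (a k) = q k \<and> Suc (a (cj k)) = q (cj k))"
proof -
  have k': "cj k \<noteq> i" "cj k \<in> S" "cj (cj k) = k"
    using assms cj_cj by auto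
  then show ?thesis
    using weight_other[OF assms] E_raise[OF assms(2) assms(1) _ _ assms(4)]
      E_raise[OF assms(2) k'(2) _ _ assms(4)] assms(5) by metis
qed

text \<open>Inside the pair of \<open>i\<close> the weight condition is shifted by one, and
  \<open>E_raise\<close> is available only for \<open>k = cj i\<close>. The alternative with a
  maximal exponent is ruled out in \<open>E_top_case\<close>.\<close>

lemma pair_same:
  assumes "a \<in> IS" "i \<in> S" "E a (e i) \<noteq> 0"
  shows "(a i mod 3 = 1 \<and> a (cj i) mod 3 = 0) \<or> (Suc (a i) = q i \<and> a (cj i) mod 3 = 1)"
proof (cases "a (cj i) mod 3 = 0")
  case True
  then show ?thesis using weight_same[OF assms] by (simp add: mod_Suc)
next
  case False
  then have "Suc (a i) = q i"
    using E_raise[OF assms(1) cj_S[OF assms(2)] _ _ assms(3)] cj_neq[of i] assms(2) by simp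
  moreover have "Suc (a i) mod 3 = 0"
    using calculation q_mod_3[OF assms(2)] by simp
  then have "a (cj i) mod 3 = 1"
    using weight_same[OF assms] by presburger
  ultimately show ?thesis by simp
qed

text \<open>The linear part of \<open>T\<close> kills every bracket of two monomials of degree at least 3. Together
  with the equivariance under quadratic monomials (\<open>raise_lower\<close>, \<open>weight\<close>) this leaves only the
  exponents \<open>3\<^sup>j \<epsilon>\<^sub>k + \<epsilon>\<^sub>i\<close>.\<close>

lemma L_cubic:
  assumes a: "a \<in> IS" "sz a \<ge> 3" and b: "b \<in> IS" "sz b \<ge> 3"
  shows "L i (P (X a) (X b)) = 0"
proof -
  have *: "coef (P f (X b)) (e i) = 0" if b: "b \<in> IS" "sz b \<ge> 3" for f b
  proof -
    have "coef (partial k f * partial l (X b)) (e i) = 0" if "l \<in> S" for k l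
    proof (cases "b l = 0")
      case False
      have d: "fin_index (dec l b)" using b IS_fin by simp
      \<comment> \<open>The derivative of \<open>X b\<close> has degree at least 2, so its multiples
        have no linear term.\<close>
      have "\<not> dec l b \<le> e i"
      proof
        assume "dec l b \<le> e i"
        then have "sz (dec l b) \<le> sz (e i)"
          unfolding sz_def le_fun_def by (intro sum_mono) blast
        moreover have "sz (e i) \<le> 1"
          by (simp add: sz_def unit_index_apply)
        ultimately show False
          using sz_dec[OF that, of b] False b by simp
      qed
      then show ?thesis
        using False b d by (subst mult.commute) (simp add: partial_X IS_fin coef_X_mult)
    qed (simp add: partial_X IS_fin b)
    then show ?thesis
      by (simp add: P_def)
  qed
  have "coef (P (X a) (T (X b))) (e i) = 0"
    using *[OF a] by (subst poisson_commute) simp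
  then show ?thesis
    using *[OF b] a b by (simp add: L_P GG_X)
qed

lemma X_e2_mult_L: "fin_index b \<Longrightarrow> L i (X (e2 k k) * X b) = of_nat (b k + 2 choose 2) * E (inc k (inc k b)) (e i)"
proof -
  assume b: "fin_index b"
  have 1: "add_index (e2 k k) b = inc k (inc k b)"
    by (simp add: e2_def unit_index_def add_inc add_zi)
  then have "binom_index (inc k (inc k b)) (e2 k k) = (inc k (inc k b) k choose e2 k k k)"
    by (intro binom_index_single) (use b in \<open>auto simp: e2_apply simp flip: 1\<close>)
  then show ?thesis
    using b by (simp add: X_mult_L 1) (simp add: inc_apply e2_apply numeral_2_eq_2)
qed

lemma sz_ge2: "i \<in> S \<Longrightarrow> j \<in> S \<Longrightarrow> i \<noteq> j \<Longrightarrow> sz a \<ge> a i + a j"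
  using sum_mono2[of S "{i, j}" a] by (simp add: sz_def)

lemma cubic_IS: "k \<in> S \<Longrightarrow> m \<in> S \<Longrightarrow> k \<noteq> m \<Longrightarrow> inc k (e2 k m) \<in> IS \<and> sz (inc k (e2 k m)) = 3"
  using q_ge_3[of k] by (auto intro!: small_IS simp: inc_II IS_II sz_inc sz_e2 e2_apply)

text \<open>This exponent satisfies every condition from quadratics. With \<open>b\<close> two below
  the top in x_k, a cubic whose bracket contains x_k^(2) \<partial>_{i'} leads from
  \<open>X b\<close> to it with factor (q - 1 choose 2), which is 1 modulo 3. The cubic is x_i^(3)
  with k = i for \<open>r = 1\<close>, and x_k^(2) x_i with k outside the pair of \<open>i\<close>
  otherwise; in the latter case the second part of the bracket overflows in x_i.\<close>

lemma E_dec_tau: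
  assumes i: "i \<in> S"
  shows "E (dec (cj i) tau) (e i) = 0"
proof -
  let ?c = "dec (cj i) tau"
  note q3 = q_ge_3
  have ii: "cj i \<noteq> i" "cj i \<in> S" using cj_neq i by auto
  have *: "E ?c (e i) = 0" if k: "k \<in> S" "k \<noteq> cj i" and F: "a \<in> IS" "sz a \<ge> 3" "sz tau \<ge> 5"
    and P: "\<And>b. fin_index b \<Longrightarrow> Suc (b k) < q k \<Longrightarrow> b i = tau i - (if k = i then 2 else 0) \<Longrightarrow> L i (P (X a) (X b)) = sg i * L i (X (e2 k k) * partial (cj i) (X b))" for k a
  proof -
    define b where "b = dec k (dec k tau)"
    have bII: "b \<in> II" by (simp add: b_def II_dec)
    have bk: "b k + 2 = tau k" "tau k = q k - 1" "q k \<ge> 3"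
      using k q3[of k] by (auto simp: b_def dec_apply tau_S)
    have up: "inc k (inc k b) = tau"
      using bk by (simp add: b_def dec_apply inc_dec)
    have szb: "sz tau = sz b + 2"
      using arg_cong[OF up, of sz] k by (simp add: sz_inc)
    have "b \<in> IS"
      using bII bk szb F(3) k neq_tau[of k b] by (auto simp: IS_iff sz_def)
    then have 0: "L i (P (X a) (X b)) = 0"
      using F szb by (intro L_cubic) auto
    have b': "b (cj i) > 0"
      using k ii q3[of "cj i"] by (simp add: b_def dec_apply tau_S)
    have "inc k (inc k (dec (cj i) b)) = ?c"
      using k(2) by (simp add: inc_dec_swap up)
    moreover have "dec (cj i) b k = b k"
      using k by (simp add: dec_apply)
    moreover have "(b k + 2) mod 3 = 2"
      using bk pred_mod_3[OF q_mod_3[OF k(1)]] by simp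
    then have "(of_nat (b k + 2 choose 2) :: 'k) \<noteq> 0"
      using choose_two_mod[of "b k + 2"] by (simp add: of_nat_0 del: One_nat_def)
    ultimately show ?thesis
      using 0 P[of b] b' II_fin[OF bII] bk
      by (simp add: partial_X X_e2_mult_L) (auto simp: b_def dec_apply)
  qed
  show ?thesis
  proof (cases "r = 1")
    case True
    have "inc i (e2 i i) \<in> IS"
      using q_ge_9[OF True i] i e2_in by (intro small_IS) (auto simp: inc_II IS_II sz_inc sz_e2 e2_apply)
    then show ?thesis
      using i ii sz_tau by (intro *[of i "inc i (e2 i i)"]) (auto simp: sz_inc sz_e2 P_X_cubic_same L_C_mult)
  next
    case False
    then obtain k where k: "k \<in> S" "k \<noteq> i" "k \<noteq> cj i" by (rule other_pair[OF _ i])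
    have "L i (P (X (inc k (e2 k i))) (X b)) = sg i * L i (X (e2 k k) * partial (cj i) (X b))"
      if b: "fin_index b" "b i = tau i" for b
    proof -
      have "L i (X (e2 k i) * partial (cj k) (X b)) = 0"
      proof (cases "b (cj k) = 0")
        case False
        have "cj k \<noteq> i" using k i cj_cj by metis
        then have "add_index (e2 k i) (dec (cj k) b) i = q i"
          using b i k q3[of i] by (simp add: e2_apply dec_apply tau_S)
        then have "add_index (e2 k i) (dec (cj k) b) \<notin> IS"
          using IIq[OF IS_II] i by (metis nat_neq_iff)
        then show ?thesis
          using False b by (simp add: partial_X X_mult_L E_def)
      qed (simp add: partial_X b)
      then show ?thesis
        using k i by (simp add: P_X_cubic L_add L_C_mult)
    qed
    then show ?thesis
      using k i cubic_IS[of k i] sz_tau by (intro *[of k "inc k (e2 k i)"]) auto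
  qed
qed

text \<open>\<open>E_consistent\<close> moves the nonzero value to neighbours of \<open>c\<close>:
  trading x_i for x_{i'} forces \<open>c (cj i)\<close> to be q - 2, trading x_i for any other x_k
  forces \<open>c k\<close> to be maximal. Hence \<open>c\<close> is \<open>dec (cj i) tau\<close>,
  contrary to \<open>E_dec_tau\<close>.\<close>

lemma E_top_case:
  assumes c: "c \<in> IS" and i: "i \<in> S" and E: "E c (e i) \<noteq> 0"
    and top: "Suc (c i) = q i" "c (cj i) mod 3 = 1"
  shows False
proof -
  have ii: "cj i \<noteq> i" "cj i \<in> S" "cj (cj i) = i" using cj_neq i by auto
  note cII = IS_II[OF c]
  have ci: "c i \<noteq> 0" using top q_ge_3[OF i] by simp
  have c'q: "Suc (c (cj i)) < q (cj i)"
    using mod_3_1_less[OF IIq[OF cII ii(2)] q_mod_3[OF ii(2)] top(2)] .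
  have inc_i': "inc (cj i) c \<in> II"
    using c'q inc_II[OF cII ii(2)] by simp
  have 1: "inc (cj i) c \<noteq> tau \<Longrightarrow> Suc (Suc (c (cj i))) = q (cj i)"
  proof -
    assume nt: "inc (cj i) c \<noteq> tau"
    then have a: "inc (cj i) c \<in> IS" using inc_i' by (simp add: IS_iff)
    define c2 where "c2 = dec i (inc (cj i) c)"
    have E2: "E c2 (e (cj i)) \<noteq> 0"
      using E_consistent[OF a i ii(2)] E ci ii by (simp add: inc_apply c2_def)
    then have c2: "c2 \<in> IS" by (rule E_IS)
    show ?thesis
      using pair_same[OF c2 ii(2) E2] top ii by (auto simp: c2_def inc_apply dec_apply mod_Suc)
  qed
  have c': "Suc (Suc (c (cj i))) = q (cj i)"
  proof (cases "inc (cj i) c = tau")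
    case True
    from fun_cong[OF this, of "cj i"] show ?thesis
      using ii q_ge_3[of "cj i"] by (simp add: inc_apply tau_S)
  qed (rule 1)
  have other: "Suc (c k) = q k" if k: "k \<in> S" "k \<noteq> i" "k \<noteq> cj i" for k
  proof (rule ccontr)
    assume ne: "Suc (c k) \<noteq> q k"
    then have lt: "Suc (c k) < q k" using IIq[OF cII k(1)] by simp
    have "inc k c \<noteq> tau"
      using neq_tau[of "cj i" "inc k c"] c' ii k by (simp add: inc_apply)
    then have a: "inc k c \<in> IS" using lt inc_II[OF cII k(1)] by (simp add: IS_iff)
    define c3 where "c3 = dec i (inc k c)"
    have E3: "E c3 (e k) \<noteq> 0"
      using E_consistent[OF a i k(1)] E ci k by (simp add: inc_apply c3_def)
    then have c3: "c3 \<in> IS" by (rule E_IS)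
    have "i \<noteq> cj k" using k i cj_cj by metis
    then show False
      using pair_other[OF i c3 k(1) E3] k top c' ii q_mod_3[OF i] q_ge_3[OF i]
      by (simp add: c3_def inc_apply dec_apply)
  qed
  have "c = dec (cj i) tau"
  proof
    fix k
    show "c k = dec (cj i) tau k"
      using other[of k] c' top(1) II_posS[OF cII, of k] ii i
      by (cases "k = i"; cases "k = cj i"; cases "k \<in> S") (auto simp: dec_apply tau_S)
  qed
  then show False using E E_dec_tau[OF i] by simp
qed

text \<open>After \<open>E_top_case\<close> the only open alternative is a pair k, k' away from
  \<open>i\<close> with both exponents maximal. A bracket with the cubic x_k^(2) x_{i'} excludes
  it.\<close>

lemma E_mod3:
  assumes c: "c \<in> IS" and i: "i \<in> S" and E: "E c (e i) \<noteq> 0"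
  shows "c i mod 3 = 1" "\<And>k. k \<noteq> i \<Longrightarrow> c k mod 3 = 0"
proof -
  have ii: "cj i \<noteq> i" "cj i \<in> S" "cj (cj i) = i" using cj_neq i by auto
  note cII = IS_II[OF c]
  have same: "c i mod 3 = 1 \<and> c (cj i) mod 3 = 0"
    using pair_same[OF c i E] E_top_case[OF c i E] by blast
  then show "c i mod 3 = 1" by blast
  have False if k: "k \<in> S" "k \<noteq> i" "k \<noteq> cj i" "Suc (c k) = q k" "Suc (c (cj k)) = q (cj k)" for k
  proof -
    have k': "cj k \<noteq> i" "cj k \<noteq> k" "cj k \<noteq> cj i" "cj k \<in> S"
      using k cj_neq(1)[OF k(1)] by (simp_all add: cj_eq_iff[OF k(1) i] cj_inj[OF k(1) i])
    \<comment> \<open>Chosen so that x_k^(2) \<partial>_i, one of the two parts of the bracket with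
      the cubic, leads from \<open>b\<close> to \<open>c\<close>; the factor (c k choose 2) is 1
      modulo 3.\<close>
    define b where "b = inc i (dec k (dec k c))"
    have ck: "c k \<ge> 2" using k q_ge_3[of k] by simp
    have iq: "Suc (c i) < q i"
      using mod_3_1_less[OF IIq[OF cII i] q_mod_3[OF i]] same by blast
    have bII: "b \<in> II"
      unfolding b_def using inc_II[OF II_dec[OF II_dec[OF cII]] i] iq k by (simp add: dec_apply)
    have b: "b k = c k - 2" "b i = Suc (c i)" "dec i b = dec k (dec k c)" "b (cj k) = c (cj k)"
      using k k' by (auto simp: b_def dec_apply inc_apply)
    have bIS: "b \<in> IS"
      using bII b k neq_tau[of k b] q_ge_3[of k] by (auto simp: IS_iff b_def)
    have "sz b \<ge> 3"
      using sz_ge2[OF i k'(4), of b] k k' b q_ge_3[of "cj k"] same by (cases "c i") auto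
    moreover have "k \<noteq> cj i" by fact
    ultimately have 0: "L i (P (X (inc k (e2 k (cj i)))) (X b)) = 0"
      using cubic_IS[OF k(1) ii(2)] bIS by (intro L_cubic) auto
    have fin: "fin_index b" using bIS IS_fin by blast
    \<comment> \<open>The other part leads to an exponent q - 2 in x_k, which
      \<open>pair_other\<close> forbids.\<close>
    have "L i (X (e2 k (cj i)) * partial (cj k) (X b)) = 0"
    proof -
      let ?g = "add_index (e2 k (cj i)) (dec (cj k) b)"
      have gk: "Suc (?g k) = c k"
        using k(3) k'(2) b(1) ck by (simp add: e2_apply dec_apply)
      have "E ?g (e i) = 0"
      proof (rule ccontr)
        assume g: "E ?g (e i) \<noteq> 0"
        then have "?g \<in> IS" by (rule E_IS)
        from pair_other[OF k(1) this i g k(2,3)] show False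
        proof
          assume "?g k mod 3 = 0 \<and> ?g (cj k) mod 3 = 0"
          then have "?g k mod 3 = 0" ..
          moreover have "Suc (Suc (?g k)) mod 3 = 0" using gk k(4) q_mod_3[OF k(1)] by simp
          ultimately show False by presburger
        next
          assume "Suc (?g k) = q k \<and> Suc (?g (cj k)) = q (cj k)"
          then show False using gk k(4) by simp
        qed
      qed
      then show ?thesis
        using fin by (cases "b (cj k) = 0") (simp_all add: partial_X X_mult_L)
    qed
    moreover have "L i (X (e2 k k) * X (dec k (dec k c))) = of_nat (b k + 2 choose 2) * E c (e i)"
    proof -
      have "inc k (inc k (dec k (dec k c))) = c" "dec k (dec k c) k = b k"
        using ck b(1) by (simp_all add: inc_dec dec_apply)
      then show ?thesis
        using X_e2_mult_L[of "dec k (dec k c)" i k] IS_fin[OF c] by simp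
    qed
    ultimately have "of_nat (b k + 2 choose 2) * E c (e i) = 0"
      using 0 k ii fin b by (simp add: P_X_cubic L_add L_C_mult partial_X)
    moreover have "(b k + 2) mod 3 = 2"
    proof -
      have "b k + 2 = c k" using b(1) ck by simp
      then show ?thesis using Suc_mod_3[of "c k"] k(4) q_mod_3[OF k(1)] by simp
    qed
    then have "(of_nat (b k + 2 choose 2) :: 'k) \<noteq> 0"
      using choose_two_mod[of "b k + 2"] by (simp add: of_nat_0 del: One_nat_def)
    ultimately show False using E by simp
  qed
  note no_top = this
  show "c k mod 3 = 0" if ki: "k \<noteq> i" for k
  proof (cases "k = cj i")
    case True
    then show ?thesis using same by simp
  next
    case False
    show ?thesis
    proof (cases "k \<in> S")
      case True
      then show ?thesis
        using pair_other[OF True c i E ki False] no_top[OF True ki False] by blast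
    next
      case F: False
      then have "c k = 0" using II_posS[OF cII, of k] by blast
      then show ?thesis by simp
    qed
  qed
qed

end

section \<open>Splitting exponents divisible by 3\<close>

lemma mod_3_0_less: "a < m \<Longrightarrow> m mod 3 = 0 \<Longrightarrow> a mod 3 = 0 \<Longrightarrow> Suc a < (m :: nat)"
  using Suc_mod_3[of a] by (cases "Suc a = m") auto

lemma mod_add_right_0: "b mod 3 = 0 \<Longrightarrow> (a + b) mod 3 = a mod (3 :: nat)"
  using mod_add_right_eq[of a b 3] by simp

lemma choose_mult_3_eq_0:
  assumes "D mod 3 = 0" "m mod 3 \<noteq> 0"
  shows "(D choose m) mod 3 = 0"
proof -
  obtain d where d: "D = 3 * d" using assms(1) by auto
  have "\<not> 3 dvd m" using assms(2) by (simp add: dvd_eq_mod_eq_0)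
  then show ?thesis unfolding d choose_3_mult_mod by simp
qed

context ham_big begin

text \<open>The powers of 3 are exactly the numbers divisible by 3 for which this splitting fails, which
  is why the derivations \<open>\<partial>\<^sub>k\<close> to the power \<open>3\<^sup>j\<close> survive.\<close>

lemma mod_3_split:
  assumes d: "d \<in> II" "d \<noteq> zi" "\<And>k. d k mod 3 = 0" and ne: "\<And>k j. k \<in> S \<Longrightarrow> j \<ge> 1 \<Longrightarrow> d \<noteq> Xi k j"
  shows "\<exists>a. a \<le> d \<and> a \<noteq> zi \<and> a \<noteq> d \<and> (\<forall>k. a k mod 3 = 0) \<and> binom_index d a mod 3 \<noteq> 0"
proof -
  obtain k where k: "d k > 0" using d(2) by (auto simp: fun_eq_iff)
  have kS: "k \<in> S" using II_posS d(1) k by blast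
  show ?thesis
  proof (cases "\<exists>l. l \<noteq> k \<and> d l > 0")
    case True
    then obtain l where l: "l \<noteq> k" "d l > 0" by blast
    \<comment> \<open>If two variables occur, the full power of one of them is split off, and every
      binomial factor is 1.\<close>
    define a where "a = (\<lambda>i. if i = k then d k else 0)"
    have "a \<le> d" by (simp add: a_def le_fun_def)
    moreover have "a \<noteq> zi" "a \<noteq> d"
      using k l by (auto simp: a_def dest: fun_cong[of _ _ k] fun_cong[of _ _ l])
    moreover have "\<forall>k. a k mod 3 = 0" using d(3) by (simp add: a_def)
    moreover have "binom_index d a = 1"
      by (rule binom_index_eq_1) (auto simp: a_def)
    ultimately show ?thesis by (intro exI[of _ a]) simp
  next
    case False
    then have dk: "d = (\<lambda>i. if i = k then d k else 0)"
      by (intro ext) auto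
    have "d k \<noteq> 3 ^ j" if "j \<ge> 1" for j
    proof
      assume "d k = 3 ^ j"
      then have "d = Xi k j" unfolding Xi_def by (subst dk) (simp add: fun_eq_iff)
      then show False using ne[OF kS that] by blast
    qed
    moreover have "3 dvd d k" using d(3) by (simp add: dvd_eq_mod_eq_0)
    ultimately obtain m where m: "3 dvd m" "0 < m" "m < d k" "(d k choose m) mod 3 \<noteq> 0"
      using choose_split_mod[of "d k"] k by blast
    define a where "a = (\<lambda>i. if i = k then m else 0)"
    have le: "a \<le> d" using m by (simp add: a_def le_fun_def)
    moreover have "a \<noteq> zi" "a \<noteq> d"
      using m by (auto simp: a_def dest: fun_cong[of _ _ k])
    moreover have "\<forall>k. a k mod 3 = 0" using m by (simp add: a_def dvd_eq_mod_eq_0)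
    moreover have "binom_index d a = (d k choose m)"
      using binom_index_single[OF II_fin[OF d(1)] le, of k] by (simp add: a_def)
    ultimately show ?thesis using m by (intro exI[of _ a]) simp
  qed
qed

lemma sz_ge_3: "a \<in> II \<Longrightarrow> a \<noteq> zi \<Longrightarrow> (\<And>k. a k mod 3 = 0) \<Longrightarrow> sz a \<ge> 3"
proof -
  assume a: "a \<in> II" "a \<noteq> zi" "\<And>k. a k mod 3 = 0"
  obtain k where k: "a k > 0" using a(2) by (auto simp: fun_eq_iff)
  have kS: "k \<in> S" using II_posS a(1) k by blast
  have "a k \<ge> 3" using k a(3)[of k] by (metis mod_less not_less neq0_conv)
  also have "a k \<le> sz a" unfolding sz_def by (rule member_le_sum[OF kS]) auto
  finally show ?thesis .
qed

lemma fin_Xi [simp]: "fin_index (Xi k j)"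
  by (auto simp: fin_index_def Xi_def)

lemma Xi_II: "k \<in> S \<Longrightarrow> j < n k \<Longrightarrow> Xi k j \<in> II"
  using q_ge_3 by (fastforce simp: II_S Xi_def q_def)

lemma power_Suc_less: "1 \<le> j \<Longrightarrow> j < m \<Longrightarrow> (3::nat) ^ j + 2 < 3 ^ m"
proof -
  assume "1 \<le> j" "j < m"
  then have "(3::nat) ^ Suc j \<le> 3 ^ m" "(3::nat) ^ 1 \<le> 3 ^ j"
    by (intro power_increasing; simp)+
  then show ?thesis by simp
qed

lemma inc_Xi_IS:
  assumes "k \<in> S" "1 \<le> j" "j < n k" "i \<in> S"
  shows "inc i (Xi k j) \<in> IS"
    and "l \<in> S \<Longrightarrow> l \<noteq> i \<Longrightarrow> inc l (inc i (Xi k j)) \<in> IS"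
proof -
  have q: "3 ^ j + 2 < q k" using power_Suc_less assms by (simp add: q_def)
  have II: "inc i (Xi k j) \<in> II"
    using inc_II[OF Xi_II[OF assms(1,3)] assms(4)] q q_ge_3[OF assms(4)] by (auto simp: Xi_def)
  moreover have "inc i (Xi k j) \<noteq> tau"
    by (rule neq_tau[OF assms(1)]) (use q in \<open>auto simp: inc_apply Xi_def\<close>)
  ultimately show "inc i (Xi k j) \<in> IS"
    by (simp add: IS_iff)
  show "inc l (inc i (Xi k j)) \<in> IS" if l: "l \<in> S" "l \<noteq> i"
  proof -
    have "inc l (inc i (Xi k j)) \<in> II"
      using inc_II[OF II l(1)] q q_ge_3[OF l(1)] l by (auto simp: Xi_def inc_apply)
    moreover have "inc l (inc i (Xi k j)) \<noteq> tau"
      by (rule neq_tau[OF assms(1)]) (use q l in \<open>auto simp: inc_apply Xi_def\<close>)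
    ultimately show ?thesis
      by (simp add: IS_iff)
  qed
qed

lemma Xi_inj: "Xi k j = Xi k' j' \<Longrightarrow> k = k' \<and> j = j'"
proof -
  assume eq: "Xi k j = Xi k' j'"
  from fun_cong[OF eq, of k] have "k = k'" by (auto simp: Xi_def split: if_splits)
  with fun_cong[OF eq, of k] show ?thesis by (simp add: Xi_def)
qed

lemma Xi_eq_iff: "Xi k j = Xi k' j' \<longleftrightarrow> k = k' \<and> j = j'"
  using Xi_inj by blast

lemma unit_upd: "(e i)(k := e i k + 3 ^ j) = inc i (Xi k j)"
  by (rule ext) (simp add: unit_index_apply inc_apply Xi_def)

lemma partial_power_y: "j \<ge> 1 \<Longrightarrow> drop_const ((partial k ^^ 3 ^ j) (y l)) = 0"
proof (rule dps_eqI)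
  fix a :: "nat \<Rightarrow> nat" assume "j \<ge> 1"
  then have "(3::nat) ^ 1 \<le> 3 ^ j" by (intro power_increasing) auto
  then have big: "a k + 3 ^ j > 1" by simp
  have "a(k := a k + 3 ^ j) \<noteq> e (cj l)"
  proof
    assume eq: "a(k := a k + 3 ^ j) = e (cj l)"
    show False
      using fun_cong[OF eq, of k] big by (simp add: unit_index_apply split: if_splits)
  qed
  then show "coef (drop_const ((partial k ^^ 3 ^ j) (y l))) a = coef 0 a"
    by (simp add: coef_drop_const coef_partial_power y_def coef_X)
qed

lemma sum_Xi:
  assumes "k0 \<in> S" "1 \<le> j0" "j0 < n k0"
  shows "(\<Sum>k\<in>S. \<Sum>j = 1..<n k. v k j * (if inc i (Xi k0 j0) = inc i (Xi k j) then 1 else 0)) = (v k0 j0 :: 'k)"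
proof -
  have "(\<Sum>k\<in>S. \<Sum>j = 1..<n k. v k j * (if inc i (Xi k0 j0) = inc i (Xi k j) then 1 else 0)) =
    (\<Sum>k\<in>S. if k = k0 then v k0 j0 else 0)"
    unfolding inc_inject Xi_eq_iff
  proof (intro sum.cong refl)
    fix k assume "k \<in> S"
    have "(\<Sum>j = 1..<n k. v k j * (if k0 = k \<and> j0 = j then 1 else 0)) =
      (\<Sum>j = 1..<n k. if j = j0 then (if k = k0 then v k0 j0 else 0) else 0)"
      by (intro sum.cong refl) auto
    then show "(\<Sum>j = 1..<n k. v k j * (if k0 = k \<and> j0 = j then 1 else 0)) = (if k = k0 then v k0 j0 else 0)"
      using assms by simp
  qed
  then show ?thesis using assms by simp
qed

lemma coef_power_X:
  assumes "fin_index a"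
  shows "coef (\<Sum>k\<in>S. \<Sum>j = 1..<n k. C (v k j) * drop_const ((partial k ^^ 3 ^ j) (X a))) (e i) =
    (\<Sum>k\<in>S. \<Sum>j = 1..<n k. v k j * (if a = inc i (Xi k j) then 1 else 0))"
  unfolding coef_sum coef_C_mult coef_drop_const coef_partial_power unit_upd
  by (intro sum.cong refl) (auto simp: coef_X assms)

end

context ham_T2
begin

text \<open>By \<open>E_mod3\<close> the exponent is d + e_i with all entries of \<open>d\<close>
  divisible by 3. If \<open>d\<close> is no power of 3 in one variable, it splits as a + b with
  nonzero binomial coefficient. In the bracket of x^(a + e_i) with x^(b + e_i + e_{i'}) only the
  term with \<partial>_i on the first factor survives; it is a nonzero multiple of x^(c), in
  contradiction to \<open>L_cubic\<close>.\<close>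

lemma E_form:
  assumes c: "c \<in> IS" and i: "i \<in> S" and E: "E c (e i) \<noteq> 0"
  shows "\<exists>k\<in>S. \<exists>j\<ge>1. c = inc i (Xi k j)"
proof (rule ccontr)
  assume neg: "\<not> ?thesis"
  have ii: "cj i \<noteq> i" "cj i \<in> S" "cj (cj i) = i" using cj_neq i by auto
  define d where "d = dec i c"
  note m3 = E_mod3[OF assms]
  have ci: "c i > 0" using m3(1) by (cases "c i") auto
  have c_eq: "c = inc i d" using ci by (simp add: d_def inc_dec)
  have cII: "c \<in> II" using c by (rule IS_II)
  then have dII: "d \<in> II" by (simp add: d_def II_dec)
  have d3: "d k mod 3 = 0" for k
  proof (cases "k = i")
    case True
    have "Suc (d i) mod 3 = 1" using m3(1) c_eq by (simp add: inc_apply)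
    then show ?thesis using True by (simp add: mod_Suc split: if_splits)
  next
    case False
    then show ?thesis using m3(2)[OF False] by (simp add: d_def dec_apply)
  qed
  have "d \<noteq> zi"
  proof
    assume "d = zi"
    then have "c = e i" using c_eq by (simp add: inc_zi)
    then show False using E E_e by simp
  qed
  then obtain a where a: "a \<le> d" "a \<noteq> zi" "a \<noteq> d" "\<And>k. a k mod 3 = 0" "binom_index d a mod 3 \<noteq> 0"
    using mod_3_split[OF dII _ d3] neg c_eq by blast
  define b where "b = sub_index d a"
  have ab: "add_index a b = d" unfolding b_def by (rule le_add_sub_index[OF a(1)])
  have ab': "d k = a k + b k" for k using ab by (metis add_index_apply)
  have aII: "a \<in> II" using II_le[OF dII a(1)] .
  have bII: "b \<in> II" using II_le[OF dII, of b] le_add_index(2)[of b a] ab by simp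
  have b3: "b k mod 3 = 0" for k
  proof -
    have "(a k + b k) mod 3 = 0" using d3[of k] ab'[of k] by simp
    then have "3 dvd a k + b k" "3 dvd a k" using a(4)[of k] by (simp_all add: dvd_eq_mod_eq_0)
    then have "3 dvd b k" by (simp add: dvd_add_right_iff)
    then show ?thesis by (simp add: dvd_eq_mod_eq_0)
  qed
  have b0: "b \<noteq> zi" using ab a(3) by (metis add_zi(2))
  \<comment> \<open>Both \<open>x i\<close> and \<open>q i\<close> are divisible by 3, so their
    distance is at least 3.\<close>
  have small: "Suc (Suc (x i)) < q i" if "x \<in> II" "\<And>k. x k mod 3 = 0" for x
  proof -
    have lt: "Suc (x i) < q i" by (rule mod_3_0_less[OF IIq[OF that(1) i] q_mod_3[OF i] that(2)])
    have "Suc (x i) mod 3 = 1" using that(2)[of i] by (simp add: mod_Suc)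
    then show ?thesis by (rule mod_3_1_less[OF lt q_mod_3[OF i]])
  qed
  have FII: "inc i x \<in> IS" if "x \<in> II" "\<And>k. x k mod 3 = 0" for x
    using inc_II[OF that(1) i] small[OF that] neq_tau[OF i, of "inc i x"] by (simp add: IS_iff inc_apply)
  have F: "inc i a \<in> IS" by (rule FII[OF aII a(4)])
  have G1: "inc i b \<in> IS" by (rule FII[OF bII b3])
  have "Suc (b (cj i)) < q (cj i)"
    using mod_3_0_less[OF IIq[OF bII ii(2)] q_mod_3[OF ii(2)] b3] .
  then have "inc (cj i) (inc i b) \<in> II"
    using inc_II[OF IS_II[OF G1] ii(2)] ii(1) by (simp add: inc_apply)
  then have G: "inc (cj i) (inc i b) \<in> IS"
    using neq_tau[OF i, of "inc (cj i) (inc i b)"] small[OF bII b3] ii(1) by (simp add: IS_iff inc_apply)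
  have "L i (P (X (inc i a)) (X (inc (cj i) (inc i b)))) = 0"
    using sz_ge_3[OF aII a(2,4)] sz_ge_3[OF bII b0 b3] i ii F G by (intro L_cubic) (auto simp: sz_inc)
  moreover have "L i (P (X (inc i a)) (X (inc (cj i) (inc i b)))) =
    (\<Sum>k\<in>S. if k = i then sg i * (of_nat (binom_index (inc i d) a) * E c (e i)) else 0)"
    unfolding P_def L_sum L_C_mult
  proof (rule sum.cong)
    fix k assume k: "k \<in> S"
    have fa: "fin_index a" and fb: "fin_index b" using aII bII II_fin by auto
    show "sg k * L i (partial k (X (inc i a)) * partial (cj k) (X (inc (cj i) (inc i b)))) =
      (if k = i then sg i * (of_nat (binom_index (inc i d) a) * E c (e i)) else 0)"
    proof (cases "k = i")
      case True
      have "add_index a (inc i b) = inc i d" by (simp add: add_inc ab)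
      then show ?thesis
        using True fa fb by (simp add: partial_X inc_apply X_mult_L c_eq)
    next
      case ki: False
      show ?thesis
      proof (cases "k = cj i")
        case True
        \<comment> \<open>The binomial coefficient has the factor (d k choose a k - 1), whose upper
          entry is divisible by 3 and whose lower entry is not.\<close>
        have "L i (X (dec k (inc i a)) * X (dec i (inc (cj i) (inc i b)))) = 0" if "a k > 0"
        proof -
          let ?w = "add_index (dec k (inc i a)) (dec i (inc (cj i) (inc i b)))"
          have "?w k = d k" "dec k (inc i a) k = a k - 1"
            using True that ii ab'[of k] by (simp_all add: inc_apply dec_apply)
          moreover have "(a k - 1) mod 3 \<noteq> 0"
            using pred_mod_3[OF a(4) that] by simp
          ultimately have "(?w k choose dec k (inc i a) k) mod 3 = 0"
            using choose_mult_3_eq_0[OF d3[of k]] by simp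
          moreover have "?w k \<noteq> 0" using \<open>?w k = d k\<close> that ab'[of k] by simp
          ultimately have "3 dvd binom_index ?w (dec k (inc i a))"
            using fa fb by (intro dvd_binom_index[of _ k]) (auto simp: dvd_eq_mod_eq_0)
          then show ?thesis
            using fa fb by (simp add: X_mult_L of_nat_0 dvd_eq_mod_eq_0)
        qed
        then show ?thesis
          using True ki ii fa fb by (simp add: partial_X inc_apply)
      next
        case False
        have ck: "cj k \<noteq> i" "cj k \<noteq> cj i"
          using ki False k i by (simp_all add: cj_eq_iff cj_inj)
        \<comment> \<open>Here it is the linear part that vanishes: the exponent of x_k in the
          product is 2 modulo 3 but not maximal, against \<open>pair_other\<close>.\<close>
        have "L i (X (dec k (inc i a)) * X (dec (cj k) (inc (cj i) (inc i b)))) = 0" if "a k > 0"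
        proof -
          let ?w = "add_index (dec k (inc i a)) (dec (cj k) (inc (cj i) (inc i b)))"
          have w: "?w k = d k - 1" "d k > 0"
            using ki False that ab'[of k] cj_neq[OF k] by (simp_all add: inc_apply dec_apply)
          have "?w k mod 3 = 2" using pred_mod_3[OF d3[of k]] w by simp
          moreover have "Suc (?w k) \<noteq> q k" using w IIq[OF dII k] by simp
          ultimately have "E ?w (e i) = 0"
            using pair_other[OF k _ i _ ki False, of ?w] E_IS[of ?w "e i"] by auto
          then show ?thesis using fa fb by (simp add: X_mult_L)
        qed
        then show ?thesis
          using ki False ck fa fb by (simp add: partial_X inc_apply)
      qed
    qed
  qed simp
  ultimately have "of_nat (binom_index (inc i d) a) * E c (e i) = 0"
    using i by simp
  \<comment> \<open>The additional summand in Pascal's rule has the factor (d i choose a i - 1),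
    which is again divisible by 3.\<close>
  moreover have "binom_index (inc i d) a mod 3 = binom_index d a mod 3"
  proof -
    have "binom_index d (dec i a) mod 3 = 0" if "a i > 0"
    proof -
      have "(a i - 1) mod 3 \<noteq> 0" using pred_mod_3[OF a(4) that] by simp
      then have "3 dvd (d i choose dec i a i)"
        using choose_mult_3_eq_0[OF d3[of i]] by (simp add: dec_apply dvd_eq_mod_eq_0)
      moreover have "d i \<noteq> 0" using that ab'[of i] by simp
      ultimately show ?thesis
        using dvd_binom_index[OF II_fin[OF dII], of i 3 "dec i a"] by (simp add: dvd_eq_mod_eq_0)
    qed
    moreover have "a \<le> inc i d" by (rule order_trans[OF a(1) le_inc])
    ultimately show ?thesis
      using binom_index_Pascal[OF II_fin[OF dII], of a i] a(1)
      by (cases "a i > 0") (simp_all add: mod_add_right_0)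
  qed
  ultimately show False
    using E a(5) by (simp add: of_nat_0)
qed

text \<open>Consistency at \<open>inc k (inc i (Xi k j))\<close>. The independence of
  \<open>i\<close> is exactly the behaviour of the \<open>3 ^ j\<close>-th power of \<partial>_k, so
  the coefficient of that power can be read off at \<open>i = k\<close>.\<close>

lemma E_indep:
  assumes "k \<in> S" "1 \<le> j" "j < n k" "i \<in> S"
  shows "E (inc i (Xi k j)) (e i) = E (inc k (Xi k j)) (e k)"
proof (cases "i = k")
  case False
  have "dec i (inc k (inc i (Xi k j))) = inc k (Xi k j)"
    by (simp add: inc_inc[of k i])
  then show ?thesis
    using False E_consistent[OF inc_Xi_IS(2)[OF assms assms(1)] assms(4,1)]
    by (simp add: inc_apply)
qed simp

theorem T_eq_powers:
  "\<exists>v. \<forall>f\<in>GG. T f = (\<Sum>k\<in>S. \<Sum>j = 1..<n k. C (v k j) * drop_const ((partial k ^^ 3 ^ j) f))"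
proof -
  define v where "v k j = E (inc k (Xi k j)) (e k)" for k j
  define R where "R f = (\<Sum>k\<in>S. \<Sum>j = 1..<n k. C (v k j) * drop_const ((partial k ^^ 3 ^ j) f))" for f
  define U where "U f = T f - R f" for f
  have "poisson_der R"
    unfolding R_def[abs_def] by (intro poisson_der_sum_fun poisson_der_C_mult poisson_der_partial_power)
  then have kU: "poisson_der U"
    unfolding U_def[abs_def] by (intro poisson_der_diff T)
  have Ry: "R (y l) = 0" for l
    by (auto simp: R_def partial_power_y intro!: sum.neutral)
  \<comment> \<open>Subtracting the powers with these coefficients gives a derivation that still
    commutes with the partial derivatives and has no linear parts, so \<open>E_eq_0\<close>
    applies.\<close>
  interpret U: ham_T r n kk U
    using kU by unfold_locales (auto simp: U_def T_y Ry)
  have "U.E a (e i) = 0" if a: "a \<in> IS" and i: "i \<in> S" for a i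
  proof -
    have "coef (R (X a)) (e i) = (\<Sum>k\<in>S. \<Sum>j = 1..<n k. v k j * (if a = inc i (Xi k j) then 1 else 0))"
      unfolding R_def by (rule coef_power_X[OF IS_fin[OF a]])
    also have "\<dots> = E a (e i) * (\<Sum>k\<in>S. \<Sum>j = 1..<n k. (if a = inc i (Xi k j) then 1 else 0))"
      unfolding sum_distrib_left
      by (intro sum.cong refl) (auto simp: v_def E_indep[OF _ _ _ i])
    also have "\<dots> = E a (e i)"
    proof (cases "E a (e i) = 0")
      case False
      from E_form[OF a i this] obtain k0 j0 where kj: "k0 \<in> S" "j0 \<ge> 1" "a = inc i (Xi k0 j0)" by blast
      have "3 ^ j0 \<le> a k0" using kj by (simp add: inc_apply Xi_def)
      also have "\<dots> < 3 ^ n k0" using IIq[OF IS_II[OF a] kj(1)] by (simp add: q_def)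
      finally have "j0 < n k0" by simp
      show ?thesis
        using sum_Xi[OF kj(1,2) \<open>j0 < n k0\<close>, of "\<lambda>k j. 1" i] by (simp add: kj(3))
    qed simp
    finally show ?thesis
      using a by (simp add: U.E_def U_def E_def)
  qed
  then have "U f = 0" if "f \<in> GG" for f
    using U.E_eq_0 that by blast
  then show ?thesis
    by (intro exI[of _ v]) (simp add: U_def R_def)
qed

end

context ham_big
begin

section \<open>Normal form, commutators and independence of the outer derivations\<close>

definition outer_der :: "(nat \<Rightarrow> 'k) \<Rightarrow> 'k \<Rightarrow> 'k \<Rightarrow> (nat \<Rightarrow> nat \<Rightarrow> 'k) \<Rightarrow> 'k dps \<Rightarrow> 'k dps" where
  "outer_der w z s v f = br (outer w z) f + C s * drop_const (delta f) +
     (\<Sum>k\<in>S. \<Sum>j = 1..<n k. C (v k j) * drop_const ((partial k ^^ 3 ^ j) f))"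

lemma poisson_der_outer_der: "poisson_der (outer_der w z s v)"
  unfolding outer_der_def[abs_def]
  by (intro poisson_der_add poisson_der_outer poisson_der_C_mult poisson_der_delta poisson_der_sum_fun poisson_der_partial_power)

theorem poisson_der_eq_outer_der:
  assumes T: "poisson_der T"
  shows "\<exists>F w z s v. F \<in> GG \<and> (\<forall>f\<in>GG. T f = br F f + outer_der w z s v f)"
proof -
  obtain F w z s where F: "F \<in> GG"
    and y: "\<And>j. j \<in> S \<Longrightarrow> T (y j) = br F (y j) + br (outer w z) (y j) + C s * drop_const (delta (y j))"
    using poisson_der_reduce_y[OF T] by blast
  define T1 where "T1 f = T f - (br F f + br (outer w z) f + C s * drop_const (delta f))" for f
  have "poisson_der T1"
    unfolding T1_def[abs_def]
    by (intro poisson_der_diff poisson_der_add T poisson_der_br_GG F poisson_der_outer poisson_der_C_mult poisson_der_delta)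
  then interpret T1: ham_T r n kk T1
    by unfold_locales (auto simp: T1_def y)
  obtain W where W: "W \<in> GG"
    and quad: "\<forall>f\<in>{X (e2 i j) |i j. i \<in> S \<and> j \<in> S} \<union> y ` S. T1 f = br W f"
    using T1.reduce_quadratic by blast
  define T2 where "T2 f = T1 f - br W f" for f
  have "poisson_der T2"
    unfolding T2_def[abs_def] by (intro poisson_der_diff T1.T poisson_der_br_GG W)
  then interpret T2: ham_T2 r n kk T2
    by unfold_locales (use quad in \<open>auto simp: T2_def\<close>)
  obtain v where "\<And>f. f \<in> GG \<Longrightarrow> T2 f = (\<Sum>k\<in>S. \<Sum>j = 1..<n k. C (v k j) * drop_const ((partial k ^^ 3 ^ j) f))"
    using T2.T_eq_powers by blast
  then have "T f = br (F + W) f + outer_der w z s v f" if "f \<in> GG" for f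
    using that by (simp add: T2_def T1_def outer_der_def br_bilinear algebra_simps)
  then show ?thesis
    using F W GG_add by blast
qed

text \<open>The same operator before constants are removed. On series the Jacobi identity and the
  derivation rules hold exactly, so commutators are computed here;
  \<open>drop_const_pre_der_drop_const\<close> carries them over.\<close>

definition pre_der :: "(nat \<Rightarrow> 'k) \<Rightarrow> 'k \<Rightarrow> 'k \<Rightarrow> (nat \<Rightarrow> nat \<Rightarrow> 'k) \<Rightarrow> 'k dps \<Rightarrow> 'k dps" where
  "pre_der w z s v f = P (outer w z) f + C s * delta f +
     (\<Sum>k\<in>S. \<Sum>j = 1..<n k. C (v k j) * (partial k ^^ 3 ^ j) f)"

lemma outer_der_drop_const: "outer_der w z s v f = drop_const (pre_der w z s v f)"
  by (simp add: outer_der_def pre_der_def drop_const_linear drop_const_sum br_drop_const)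

lemma outer_linear:
  "outer (\<lambda>j. w j + w' j) (z + z') = outer w z + outer w' z'"
  "outer (\<lambda>j. c * w j) (c * z) = C c * outer w z"
  by (simp_all add: outer_def C_simps C_mult algebra_simps sum.distrib sum_distrib_left)

lemma outer_der_linear:
  "outer_der (\<lambda>j. w j + w' j) (z + z') (s + s') (\<lambda>k j. v k j + v' k j) f = outer_der w z s v f + outer_der w' z' s' v' f"
  "outer_der (\<lambda>j. c * w j) (c * z) (c * s) (\<lambda>k j. c * v k j) f = C c * outer_der w z s v f"
  by (simp_all add: outer_der_def outer_linear br_bilinear C_simps C_mult algebra_simps sum.distrib sum_distrib_left)

lemma outer_der_cong:
  assumes "\<And>j. j \<in> S \<Longrightarrow> w j = w' j" "z = z'" "s = s'" "\<And>k j. k \<in> S \<Longrightarrow> 1 \<le> j \<Longrightarrow> j < n k \<Longrightarrow> v k j = v' k j"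
  shows "outer_der w z s v = outer_der w' z' s' v'"
proof -
  have "outer w z = outer w' z'"
    using assms(1,2) by (simp add: outer_def)
  moreover have "(\<Sum>k\<in>S. \<Sum>j = 1..<n k. C (v k j) * drop_const ((partial k ^^ 3 ^ j) f)) =
      (\<Sum>k\<in>S. \<Sum>j = 1..<n k. C (v' k j) * drop_const ((partial k ^^ 3 ^ j) f))" for f
    by (intro sum.cong refl) (simp add: assms(4))
  ultimately show ?thesis
    using assms(3) by (simp add: outer_der_def fun_eq_iff)
qed

lemma pre_der_add: "pre_der w z s v (f + g) = pre_der w z s v f + pre_der w z s v g"
  by (simp add: pre_der_def poisson_add_right delta_add partial_power_add algebra_simps sum.distrib)

lemma pre_der_C_mult: "pre_der w z s v (C c * f) = C c * pre_der w z s v f"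
  by (simp add: pre_der_def poisson_C_mult_right delta_C_mult partial_power_C_mult distrib_left sum_distrib_left mult.left_commute[of "C c"])

lemma drop_const_pre_der_one: "drop_const (pre_der w z s v 1) = 0"
proof (rule dps_eqI)
  fix a :: "nat \<Rightarrow> nat" assume a: "fin_index a"
  have "a(k := a k + 3 ^ j) \<noteq> zi" for k j
    by (metis add_is_0 fun_upd_same power_not_zero zero_index_apply zero_neq_numeral)
  then show "coef (drop_const (pre_der w z s v 1)) a = coef 0 a"
    using a by (simp add: coef_drop_const pre_der_def coef_delta coef_one coef_partial_power)
qed

lemma drop_const_pre_der_drop_const: "drop_const (pre_der w z s v (drop_const f)) = drop_const (pre_der w z s v f)"
proof -
  have "pre_der w z s v f = pre_der w z s v (drop_const f + C (coef f zi) * 1)"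
    by (simp add: drop_const_def)
  also have "drop_const \<dots> = drop_const (pre_der w z s v (drop_const f)) + C (coef f zi) * drop_const (pre_der w z s v 1)"
    by (simp only: pre_der_add pre_der_C_mult drop_const_linear)
  finally show ?thesis
    by (simp add: drop_const_pre_der_one)
qed

text \<open>Lowering an exponent by \<open>3 ^ j\<close> with \<open>1 \<le> j\<close> leaves the
  degree unchanged modulo 3.\<close>

lemma delta_partial_power: "1 \<le> j \<Longrightarrow> delta ((partial k ^^ 3 ^ j) f) = (partial k ^^ 3 ^ j) (delta f)"
proof (rule dps_eqI)
  fix a :: "nat \<Rightarrow> nat" assume j: "1 \<le> j" and a: "fin_index a"
  let ?b = "a(k := a k + 3 ^ j)"
  have fb: "fin_index ?b"
    unfolding fin_index_def
    by (rule finite_subset[of _ "insert k {i. a i \<noteq> 0}"]) (use a in \<open>auto simp: fin_index_def\<close>)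
  have "sz ?b = (\<Sum>i\<in>S. a i + (if i = k then 3 ^ j else 0))"
    unfolding sz_def by (rule sum.cong) auto
  also have "\<dots> = sz a + (if k \<in> S then 3 ^ j else 0)"
    by (simp add: sum.distrib sz_def)
  finally have sz: "sz ?b = sz a + (if k \<in> S then 3 ^ j else 0)" .
  have "(of_nat (3 ^ j) :: 'k) = 0"
    unfolding of_nat_0 using j by (cases j) auto
  then have "(of_nat (sz ?b) :: 'k) = of_nat (sz a)"
    unfolding sz of_nat_add by simp
  then show "coef (delta ((partial k ^^ 3 ^ j) f)) a = coef ((partial k ^^ 3 ^ j) (delta f)) a"
    using a fb by (simp add: coef_delta coef_partial_power)
qed

lemma partial_power_commute: "(partial k ^^ m) ((partial l ^^ m') f) = (partial l ^^ m') ((partial k ^^ m) f)"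
proof (rule dps_eqI)
  fix a
  have "(a(k := a k + m))(l := (a(k := a k + m)) l + m') = (a(l := a l + m'))(k := (a(l := a l + m')) k + m)"
    by auto
  then show "coef ((partial k ^^ m) ((partial l ^^ m') f)) a = coef ((partial l ^^ m') ((partial k ^^ m) f)) a"
    by (simp only: coef_partial_power)
qed

definition pw :: "(nat \<Rightarrow> nat \<Rightarrow> 'k) \<Rightarrow> 'k dps \<Rightarrow> 'k dps" where
  "pw v f = (\<Sum>k\<in>S. \<Sum>j = 1..<n k. C (v k j) * (partial k ^^ 3 ^ j) f)"

lemma pw_add: "pw v (f + g) = pw v f + pw v g"
  by (simp add: pw_def partial_power_add algebra_simps sum.distrib)

lemma pw_C_mult: "pw v (C c * f) = C c * pw v f"
  by (simp add: pw_def partial_power_C_mult sum_distrib_left mult.left_commute[of "C c"])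

lemma pw_sum: "pw v (\<Sum>x\<in>A. F x) = (\<Sum>x\<in>A. pw v (F x))"
proof (induction A rule: infinite_finite_induct)
  case empty
  show ?case using pw_C_mult[of v 0 0] by (simp add: C_simps)
next
  case (infinite A)
  then show ?case using pw_C_mult[of v 0 0] by (simp add: C_simps)
qed (simp add: pw_add)

lemma pw_P: "pw v (P f g) = P (pw v f) g + P f (pw v g)"
  by (simp add: pw_def partial_power_P poisson_sum_left poisson_sum_right poisson_C_mult_left poisson_C_mult_right distrib_left sum.distrib)

lemma delta_sum: "delta (\<Sum>x\<in>A. F x) = (\<Sum>x\<in>A. delta (F x))"
  by (rule dps_eqI) (simp add: coef_delta sum_distrib_left)

lemma delta_pw: "delta (pw v f) = pw v (delta f)"
  unfolding pw_def delta_sum delta_C_mult by (intro sum.cong refl) (simp add: delta_partial_power)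

lemma pw_pw: "pw v (pw v' f) = pw v' (pw v f)"
proof -
  have "pw v (pw v' f) = (\<Sum>k\<in>S. \<Sum>j = 1..<n k. pw v (C (v' k j) * (partial k ^^ 3 ^ j) f))" for v v'
    unfolding pw_def[of v' f] pw_sum ..
  also have "\<dots> v v' = pw v' (pw v f)" for v v'
    unfolding pw_C_mult unfolding pw_def partial_power_sum partial_power_C_mult
    by (simp add: partial_power_commute)
  finally show ?thesis .
qed

lemma pre_der_pw: "pre_der w z s v f = P (outer w z) f + C s * delta f + pw v f"
  by (simp add: pre_der_def pw_def)

text \<open>The degree derivation and the powers commute with one another, so every surviving term
  is a bracket with a function, and these functions add up to one.\<close>

lemma pre_der_commutator:
  "pre_der w z s v (pre_der w' z' s' v' f) - pre_der w' z' s' v' (pre_der w z s v f) =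
   P (P (outer w z) (outer w' z') + C s * delta (outer w' z') - C s' * delta (outer w z) +
      pw v (outer w' z') - pw v' (outer w z)) f"
proof -
  let ?U = "outer w z" and ?U' = "outer w' z'"
  have "pre_der w z s v (pre_der w' z' s' v' f) - pre_der w' z' s' v' (pre_der w z s v f) =
    (P ?U (P ?U' f) - P ?U' (P ?U f)) + (C s * P (delta ?U') f - C s' * P (delta ?U) f) +
    (P (pw v ?U') f - P (pw v' ?U) f)"
    unfolding pre_der_pw delta_add delta_C_mult delta_P pw_add pw_C_mult pw_P poisson_add_right poisson_C_mult_right
    by (simp add: delta_pw pw_pw[of v v'] algebra_simps)
  also have "P ?U (P ?U' f) - P ?U' (P ?U f) = P (P ?U ?U') f"
    by (simp add: poisson_Jacobi[of r ?U ?U'])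
  finally show ?thesis
    by (simp add: poisson_add_left poisson_diff poisson_C_mult_left algebra_simps)
qed

text \<open>Each of the 2r entries of \<open>tau\<close> is -1 modulo 3, and -2r = r.\<close>

lemma sz_tau_eq: "(of_nat (sz tau) :: 'k) = of_nat r"
proof -
  have "(of_nat (tau i) :: 'k) = -1" if "i \<in> S" for i
  proof -
    have "(of_nat (tau i) :: 'k) = of_nat 2"
      unfolding of_nat_mod using that q_ge_3[OF that] pred_mod_3[OF q_mod_3[OF that]] by (simp add: tau_S)
    then show ?thesis using two_eq by simp
  qed
  then have "(of_nat (sz tau) :: 'k) = - of_nat (2 * r)"
    unfolding sz_def of_nat_sum by (simp add: S_def)
  also have "\<dots> = of_nat r"
    by (simp add: two_eq)
  finally show ?thesis .
qed

lemma delta_X: "fin_index a \<Longrightarrow> delta (X a) = C (of_nat (sz a) + 1) * X a"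
proof -
  have "(- 2 :: 'k) = 1" by (simp add: two_eq)
  then have "x - 2 = x + (1::'k)" for x by (metis add_uminus_conv_diff)
  then show "fin_index a \<Longrightarrow> delta (X a) = C (of_nat (sz a) + 1) * X a"
    by (intro dps_eqI) (auto simp: coef_delta coef_X)
qed

text \<open>The x_j^(q) have degree 0 modulo 3, hence eigenvalue -2 = 1; the top monomial has
  eigenvalue r - 2 = r + 1. These are the diagonal entries of D in the theorem.\<close>

lemma delta_outer: "delta (outer w z) = outer w ((of_nat r + 1) * z)"
proof -
  have "(of_nat (sz (top_power j)) :: 'k) = 0" if "j \<in> S" for j
  proof -
    have "sz (top_power j) = q j"
      using that by (simp add: sz_def top_power_def)
    then show ?thesis
      using q_mod_3[OF that] by (simp add: of_nat_0)
  qed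
  then show ?thesis
    unfolding outer_def delta_add delta_sum delta_C_mult
    by (simp add: delta_X II_fin sz_tau_eq C_simps C_mult mult.assoc mult.left_commute[of "C z"])
qed

lemma partial_power_X: "fin_index a \<Longrightarrow> (partial k ^^ m) (X a) = (if m \<le> a k then X (a(k := a k - m)) else 0)"
proof (rule dps_eqI)
  fix b :: "nat \<Rightarrow> nat" assume a: "fin_index a"
  have "fin_index (a(k := a k - m))"
    by (rule fin_index_le[OF a]) (simp add: le_fun_def)
  moreover have "b(k := b k + m) = a \<longleftrightarrow> m \<le> a k \<and> b = a(k := a k - m)"
    by auto
  ultimately show "coef ((partial k ^^ m) (X a)) b = coef (if m \<le> a k then X (a(k := a k - m)) else 0) b"
    using a by (auto simp: coef_partial_power coef_X)
qed

text \<open>The bounds on \<open>j\<close> keep \<open>3 ^ j\<close> below the exponents to be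
  lowered, so the outer functions become monomials other than 1 and x^(tau), or 0. Their commutators
  with the powers are therefore inner.\<close>

lemma power_X_GG:
  assumes k: "k \<in> S" and j: "1 \<le> j" "j < n k"
  shows "(partial k ^^ 3 ^ j) (X tau) \<in> GG" "i \<in> S \<Longrightarrow> (partial k ^^ 3 ^ j) (X (top_power i)) \<in> GG"
proof -
  have lt: "3 ^ j + 2 < q k" using power_Suc_less j by (simp add: q_def)
  have pos: "(3::nat) ^ j > 0" by simp
  have "tau(k := tau k - 3 ^ j) \<in> II"
    by (rule II_le[OF tau_II]) (simp add: le_fun_def)
  moreover have "q k - 1 - 3 ^ j \<noteq> 0" "q k - 1 - 3 ^ j \<noteq> q k - 1"
    using lt pos by linarith+
  then have "(tau(k := tau k - 3 ^ j)) k \<noteq> 0" "(tau(k := tau k - 3 ^ j)) k \<noteq> tau k"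
    using k by (simp_all add: tau_S)
  then have "tau(k := tau k - 3 ^ j) \<noteq> zi" "tau(k := tau k - 3 ^ j) \<noteq> tau"
    by (metis zero_index_apply, metis)
  ultimately show "(partial k ^^ 3 ^ j) (X tau) \<in> GG"
    by (auto simp: partial_power_X II_fin GG_X IS_iff)
  assume i: "i \<in> S"
  show "(partial k ^^ 3 ^ j) (X (top_power i)) \<in> GG"
  proof (cases "i = k")
    case True
    let ?b = "(top_power k)(k := q k - 3 ^ j)"
    have "?b \<in> II"
      using k lt pos q_ge_3 by (fastforce simp: II_S top_power_def)
    moreover have "?b \<noteq> zi"
      using lt by (auto dest!: fun_cong[of _ _ k])
    moreover have "?b \<noteq> tau"
      using neq_tau[of "cj k" ?b] q_ge_3[of "cj k"] k cj_neq[OF k] by (simp add: top_power_def)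
    ultimately have "X ?b \<in> GG" by (simp add: GG_X IS_iff)
    moreover have "(partial k ^^ 3 ^ j) (X (top_power k)) = (X ?b :: 'k dps)"
      using lt by (simp add: partial_power_X) (simp add: top_power_def)
    ultimately show ?thesis using True by simp
  next
    case False
    then have "(partial k ^^ 3 ^ j) (X (top_power i)) = (0 :: 'k dps)"
      by (simp add: partial_power_X) (simp add: top_power_def)
    then show ?thesis by simp
  qed
qed

lemma pw_outer: "pw v (outer w z) \<in> GG"
  unfolding pw_def outer_def partial_power_add partial_power_sum partial_power_C_mult
  by (intro GG_sum GG_C_mult GG_add power_X_GG) auto

lemma P_top_power_top_power:
  assumes "i \<in> S" "j \<in> S"
  shows "P (X (top_power i)) (X (top_power j)) =
    (if j = cj i then C (sg i) * (X (dec i (top_power i)) * X (dec j (top_power j))) else 0)"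
  using assms by (auto simp: P_top_power partial_top_power)

lemma top_mult: "i \<in> S \<Longrightarrow>
  (X (dec i (top_power i)) * X (dec (cj i) (top_power (cj i))) :: 'k dps) =
   X (add_index (dec i (top_power i)) (dec (cj i) (top_power (cj i))))"
proof -
  assume i: "i \<in> S"
  have "binom_index (add_index (dec i (top_power i)) (dec (cj i) (top_power (cj i)))) (dec i (top_power i)) = 1"
    using cj_neq[OF i] by (intro binom_index_eq_1) (auto simp: dec_apply top_power_def)
  then show ?thesis by (simp add: X_mult_X)
qed

text \<open>The product would have exponent 2 (q - 1) in x_j. Since \<open>OA\<close> is closed
  under multiplication, its binomial coefficient has to vanish.\<close>

lemma P_tau_top_power: "j \<in> S \<Longrightarrow> P (X (top_power j)) (X tau) = 0"
proof -
  assume j: "j \<in> S"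
  have "(X (dec j (top_power j)) * X (dec (cj j) tau) :: 'k dps) = 0"
  proof -
    have OA: "(X (dec j (top_power j)) * X (dec (cj j) tau) :: 'k dps) \<in> OA"
      by (intro OA_mult OA_X dec_top_power j II_dec tau_II)
    let ?w = "add_index (dec j (top_power j)) (dec (cj j) tau)"
    have "?w j = (q j - 1) + (q j - 1)"
      using j cj_neq[OF j] by (simp add: dec_apply top_power_def tau_S)
    then have "?w \<notin> II"
      using IIq[of ?w j] j q_ge_3[OF j] by auto
    then have "coef (X (dec j (top_power j)) * X (dec (cj j) tau) :: 'k dps) ?w = 0"
      using OA_D[OF OA] by blast
    moreover have prod: "(X (dec j (top_power j)) * X (dec (cj j) tau) :: 'k dps) =
        C (of_nat (binom_index ?w (dec j (top_power j)))) * X ?w"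
      by (simp add: X_mult_X II_fin C_of_nat)
    ultimately have "(of_nat (binom_index ?w (dec j (top_power j))) :: 'k) = 0"
      by (simp only: prod coef_C_mult) (simp add: coef_X II_fin)
    then show ?thesis
      unfolding prod by (simp add: C_simps)
  qed
  then show ?thesis
    using j by (simp add: P_top_power partial_X II_fin)
qed

lemma P_outer: "P (outer w z) (outer w' z') =
  (\<Sum>i\<in>S. C (w i * w' (cj i) * sg i) * X (add_index (dec i (top_power i)) (dec (cj i) (top_power (cj i)))))"
proof -
  have 1: "P (X (top_power j)) (outer w' z') =
      C (w' (cj j) * sg j) * X (add_index (dec j (top_power j)) (dec (cj j) (top_power (cj j))))" if j: "j \<in> S" for j w' z'
  proof -
    have "P (X (top_power j)) (outer w' z') = (\<Sum>i\<in>S. C (w' i) * P (X (top_power j)) (X (top_power i)))"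
      using j by (simp add: outer_def poisson_add_right poisson_sum_right poisson_C_mult_right P_tau_top_power)
    also have "\<dots> = (\<Sum>i\<in>S. if i = cj j then C (w' (cj j) * sg j) * X (add_index (dec j (top_power j)) (dec (cj j) (top_power (cj j)))) else 0)"
      by (rule sum.cong) (use j in \<open>auto simp: P_top_power_top_power top_mult C_mult mult.assoc\<close>)
    finally show ?thesis using j by simp
  qed
  have "P (X tau) (X (top_power i)) = 0" if "i \<in> S" for i
    using P_tau_top_power[OF that] by (subst poisson_commute) simp
  then have "P (X tau) (outer w' z') = 0"
    by (simp add: outer_def poisson_add_right poisson_sum_right poisson_C_mult_right poisson_self)
  then have "P (outer w z) (outer w' z') = (\<Sum>j\<in>S. C (w j) * P (X (top_power j)) (outer w' z'))"
    by (simp add: outer_def[of w z] poisson_add_left poisson_sum_left poisson_C_mult_left)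
  then show ?thesis
    by (simp add: 1 C_mult mult.assoc)
qed

text \<open>With a single pair, the derivatives of the two top powers multiply to the top monomial.
  This is the origin of the Heisenberg bracket.\<close>

lemma P_outer_r1: "r = 1 \<Longrightarrow> P (outer w z) (outer w' z') = C (w 1 * w' 2 - w 2 * w' 1) * X tau"
proof -
  assume r: "r = 1"
  have S: "S = {1, 2}" unfolding S_def using r by auto
  have cj: "cj 1 = 2" "cj 2 = 1" and sg: "sg 1 = 1" "sg 2 = -1"
    unfolding cj_def ham_conj_def sg_def ham_sign_def using r by auto
  have "add_index (dec 1 (top_power 1)) (dec 2 (top_power 2)) = tau"
    "add_index (dec 2 (top_power 2)) (dec 1 (top_power 1)) = tau"
    by (auto simp: fun_eq_iff dec_apply top_power_def tau_S S)
  then show ?thesis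
    unfolding P_outer by (simp add: S cj[unfolded One_nat_def] sg[unfolded One_nat_def] C_simps C_mult algebra_simps)
qed

text \<open>A variable outside the pair of \<open>i\<close> does not occur in the product, which
  therefore stays below the top monomial.\<close>

lemma P_outer_GG:
  assumes "r \<noteq> 1"
  shows "P (outer w z) (outer w' z') \<in> GG"
  unfolding P_outer
proof (intro GG_sum GG_C_mult GG_X)
  fix i assume i: "i \<in> S"
  let ?a = "add_index (dec i (top_power i)) (dec (cj i) (top_power (cj i)))"
  obtain k where k: "k \<in> S" "k \<noteq> i" "k \<noteq> cj i" using other_pair[OF assms i] .
  have "?a \<in> II"
    using i q_ge_3 cj_neq[OF i] by (fastforce simp: II_S dec_apply top_power_def)
  moreover have "?a \<noteq> tau"
    using neq_tau[of k ?a] k q_ge_3[OF k(1)] by (simp add: dec_apply top_power_def)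
  moreover have "?a \<noteq> zi"
    using i q_ge_3[OF i] cj_neq[OF i] by (auto simp: dec_apply top_power_def dest!: fun_cong[of _ _ i])
  ultimately show "?a \<in> IS" by (simp add: IS_iff)
qed

lemma outer_der_commutator:
  "\<exists>G\<in>GG. \<forall>f\<in>GG. outer_der w z s v (outer_der w' z' s' v' f) - outer_der w' z' s' v' (outer_der w z s v f) =
   outer_der (\<lambda>j. s * w' j - s' * w j)
     ((of_nat r + 1) * (s * z' - s' * z) + (if r = 1 then w 1 * w' 2 - w 2 * w' 1 else 0)) 0 (\<lambda>k j. 0) f + br G f"
proof -
  \<comment> \<open>The part of the commutator function that lies in \<open>GG\<close> and hence
    acts as an inner derivation.\<close>
  define G where "G = (if r = 1 then 0 else P (outer w z) (outer w' z')) + pw v (outer w' z') - pw v' (outer w z)"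
  have G: "G \<in> GG"
    unfolding G_def by (intro GG_add GG_diff pw_outer) (metis GG_0 P_outer_GG)
  let ?W = "\<lambda>j. s * w' j - s' * w j"
  let ?Z = "(of_nat r + 1) * (s * z' - s' * z) + (if r = 1 then w 1 * w' 2 - w 2 * w' 1 else 0)"
  have "outer ?W ((of_nat r + 1) * (s * z' - s' * z)) = C s * delta (outer w' z') - C s' * delta (outer w z)"
    unfolding delta_outer
    by (simp add: outer_def C_simps C_mult algebra_simps sum_subtractf sum_distrib_left)
  moreover have "outer ?W ?Z = outer ?W ((of_nat r + 1) * (s * z' - s' * z)) + C (if r = 1 then w 1 * w' 2 - w 2 * w' 1 else 0) * X tau"
    by (simp add: outer_def C_simps distrib_right)
  moreover have "P (outer w z) (outer w' z') = C (if r = 1 then w 1 * w' 2 - w 2 * w' 1 else 0) * X tau +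
      (if r = 1 then 0 else P (outer w z) (outer w' z'))"
  proof (cases "r = 1")
    case True
    then show ?thesis
      unfolding if_P[OF True] using P_outer_r1[OF True] by (simp only: add_0_right)
  qed (simp add: C_simps)
  ultimately have eq: "P (outer w z) (outer w' z') + C s * delta (outer w' z') - C s' * delta (outer w z) +
      pw v (outer w' z') - pw v' (outer w z) = outer ?W ?Z + G"
    by (simp only: G_def) (simp only: algebra_simps)
  have "outer_der w z s v (outer_der w' z' s' v' f) - outer_der w' z' s' v' (outer_der w z s v f) =
      outer_der ?W ?Z 0 (\<lambda>k j. 0) f + br G f" for f
  proof -
    have "outer_der w z s v (outer_der w' z' s' v' f) - outer_der w' z' s' v' (outer_der w z s v f) =
      drop_const (pre_der w z s v (pre_der w' z' s' v' f) - pre_der w' z' s' v' (pre_der w z s v f))"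
      by (simp only: outer_der_drop_const drop_const_pre_der_drop_const drop_const_linear)
    also have "\<dots> = br (outer ?W ?Z + G) f"
      unfolding pre_der_commutator eq br_drop_const ..
    finally show ?thesis
      by (simp add: br_bilinear outer_der_def C_simps)
  qed
  with G show ?thesis by blast
qed

text \<open>Evaluation on the \<open>y j\<close> compares \<open>outer w z\<close> with
  \<open>F\<close> in degree at least 2, up to a contribution of \<open>s\<close>. \<open>GG\<close>
  has no coefficients at the top powers and at \<open>tau\<close>, which gives \<open>w\<close> and
  \<open>z\<close>; \<open>s\<close> is found by a symmetry, and \<open>v\<close> at the exponents
  \<open>inc k (Xi k j)\<close>.\<close>

lemma outer_der_inner_imp_0:
  assumes F: "F \<in> GG" and eq: "\<And>f. f \<in> GG \<Longrightarrow> outer_der w z s v f = br F f"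
  shows "(\<forall>j\<in>S. w j = 0) \<and> z = 0 \<and> s = 0 \<and> (\<forall>k\<in>S. \<forall>j. 1 \<le> j \<and> j < n k \<longrightarrow> v k j = 0)"
proof -
  have d: "coef (outer w z) (inc j a) - coef F (inc j a) = - (s * coef (y j) a)"
    if j: "j \<in> S" and a: "a \<noteq> zi" for j a
  proof -
    have "- drop_const (partial j (outer w z)) + C s * drop_const (- y j) = - drop_const (partial j F)"
      using eq[OF y_GG[OF j]] by (simp add: outer_der_def br_y j coef_delta_y partial_power_y)
    from arg_cong[OF this, of "\<lambda>f. coef f a"] show ?thesis
      using a by (simp add: coef_drop_const algebra_simps)
  qed
  have y: "coef (y j) a = (if a = e (cj j) then sg (cj j) else 0)" for j a
    by (simp add: y_def coef_X)
  have w0: "w j = 0" if j: "j \<in> S" for j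
  proof -
    let ?a = "dec j (top_power j)"
    have aj: "?a j = q j - 1" "inc j ?a = top_power j"
      using q_ge_3[OF j] by (simp_all add: dec_apply top_power_def inc_dec)
    have "?a \<noteq> zi" "?a \<noteq> e (cj j)"
      using aj(1) q_ge_3[OF j] cj_neq[OF j] by (auto simp: unit_index_apply dest!: fun_cong[of ?a _ j])
    then show ?thesis
      using d[OF j, of ?a] OA_D[OF GG_OA[OF F] top_power_notin[OF j]] j
      by (simp add: aj(2) coef_outer_top y)
  qed
  have z0: "z = 0"
  proof -
    let ?a = "dec 1 tau"
    have i: "inc 1 ?a = tau"
      using one_S q_ge_3[OF one_S(1)] by (simp add: inc_dec tau_S)
    have "sz tau = Suc (sz ?a)" using sz_inc[OF one_S(1), of ?a] i by simp
    then have sa: "sz ?a \<ge> 7" using sz_tau by simp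
    have "sz zi = 0" "sz (e (cj 1)) = 1"
      by (simp add: sz_def) (use one_S in \<open>simp add: sz_def unit_index_apply\<close>)
    then have "?a \<noteq> zi" "?a \<noteq> e (cj 1)" using sa by auto
    then show ?thesis
      using d[OF one_S(1), of ?a, unfolded i] GG_tau[OF F] by (simp add: y coef_outer_II)
  qed
  have U0: "outer w z = 0"
    by (simp add: outer_def w0 z0 C_simps)
  have s0: "s = 0"
  proof -
    let ?j = "1::nat"
    \<comment> \<open>One coefficient of \<open>F\<close> is computed from the derivatives in both
      variables of a pair, with opposite signs; hence 2 s = 0.\<close>
    have 1: "coef F (e2 1 (cj 1)) = s * sg (cj 1)" "coef F (e2 (cj 1) 1) = s * sg 1"
      using d[OF one_S(1), of "e (cj 1)"] d[OF cj_S[OF one_S(1)], of "e 1"] one_S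
      by (simp_all add: U0 y e2_def)
    have "s * sg 1 = s * sg (cj 1)"
      using 1 by (metis e2_commute)
    then have "s * sg 1 = - (s * sg 1)"
      by (simp only: sg_cj[OF one_S(1)] mult_minus_right)
    then have "2 * (s * sg 1) = 0" unfolding mult_2 by (simp only: eq_neg_iff_add_eq_0)
    then show ?thesis using two_eq by simp
  qed
  have lin: "coef F (inc j a) = 0" if "j \<in> S" "a \<noteq> zi" for j a
    using d[OF that] by (simp add: U0 s0)
  have rest: "(\<Sum>k\<in>S. \<Sum>j = 1..<n k. C (v k j) * drop_const ((partial k ^^ 3 ^ j) f)) = br F f" if "f \<in> GG" for f
    using eq[OF that] by (simp add: outer_der_def U0 s0 br_drop_const C_simps drop_const_linear)
  \<comment> \<open>Linear terms of \<open>F\<close> are invisible on the \<open>y j\<close>. The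
    square of the conjugate variable detects them, since it is killed by all the powers with
    \<open>j \<ge> 1\<close>.\<close>
  have Fe: "coef F (e l) = 0" if l: "l \<in> S" for l
  proof -
    let ?k = "cj l"
    have k: "?k \<in> S" using l by simp
    have "drop_const ((partial m ^^ 3 ^ j) (X (e2 ?k ?k) :: 'k dps)) = 0" if "j \<ge> 1" for m j
    proof (rule dps_eqI)
      fix a :: "nat \<Rightarrow> nat"
      have "(3::nat) ^ 1 \<le> 3 ^ j" using that by (intro power_increasing) auto
      then have big: "a m + 3 ^ j > 2" by simp
      have "a(m := a m + 3 ^ j) \<noteq> e2 ?k ?k"
      proof
        assume eq: "a(m := a m + 3 ^ j) = e2 ?k ?k"
        show False
          using fun_cong[OF eq, of m] big by (simp add: e2_apply split: if_splits)
      qed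
      then show "coef (drop_const ((partial m ^^ 3 ^ j) (X (e2 ?k ?k) :: 'k dps))) a = coef 0 a"
        by (simp add: coef_drop_const coef_partial_power coef_X)
    qed
    then have "br F (X (e2 ?k ?k)) = 0"
      using rest[OF X_GG_e2[OF k k]] by simp
    then have "coef (br F (X (e2 ?k ?k))) (e ?k) = 0" by simp
    then have "coef (P F (X (e2 ?k ?k))) (e ?k) = 0" by (simp add: br_drop_const coef_drop_const)
    then have "coef (P (X (e2 ?k ?k)) F) (e ?k) = 0" by (subst poisson_commute) simp
    then show ?thesis
      using k l by (simp add: P_X_e2_same coef_X_e_mult inc_zi)
  qed
  have F0: "F = 0"
  proof (rule dps_eqI)
    fix a :: "nat \<Rightarrow> nat" assume "fin_index a"
    show "coef F a = coef 0 a"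
    proof (cases "a \<in> II")
      case True
      show ?thesis
      proof (cases "a = zi")
        case False
        then obtain j where j: "a j > 0" by (auto simp: fun_eq_iff)
        have jS: "j \<in> S" using II_posS True j by blast
        have a: "a = inc j (dec j a)" using j by (simp add: inc_dec)
        show ?thesis
        proof (cases "dec j a = zi")
          case True
          then have "a = e j" using a by (simp add: inc_zi)
          then show ?thesis using Fe[OF jS] by simp
        next
          case False
          then have "coef F a = 0" using lin[OF jS False] a by metis
          then show ?thesis by simp
        qed
      qed (use GG_zero[OF F] in \<open>simp add: GG_zero\<close>)
    qed (simp add: OA_D GG_OA F)
  qed
  have "v k j = 0" if kj: "k \<in> S" "1 \<le> j" "j < n k" for k j
  proof -
    have IS: "inc k (Xi k j) \<in> IS" by (rule inc_Xi_IS(1)[OF kj kj(1)])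
    have "coef (\<Sum>k\<in>S. \<Sum>j = 1..<n k. C (v k j) * drop_const ((partial k ^^ 3 ^ j) (X a))) (e l) = 0" if "a \<in> IS" for a l
      unfolding rest[OF GG_X[OF that]] F0 by (simp add: br_drop_const drop_const_linear)
    from this[OF IS, of k] show ?thesis
      unfolding coef_power_X[OF IS_fin[OF IS]] sum_Xi[OF kj] .
  qed
  then show ?thesis
    using w0 z0 s0 by blast
qed

end

section \<open>Isomorphisms of Lie structures\<close>

text \<open>The closure properties that transport of spans, derived series and quotients relies on,
  without the Lie algebra axioms.\<close>

definition lie_closed :: "('k::field, 'v) lie_struct \<Rightarrow> bool" where
  "lie_closed L \<longleftrightarrow> lzero L \<in> lcarrier L \<and>
     (\<forall>x\<in>lcarrier L. \<forall>y\<in>lcarrier L. ladd L x y \<in> lcarrier L \<and> lbracket L x y \<in> lcarrier L) \<and>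
     (\<forall>c. \<forall>x\<in>lcarrier L. lscale L c x \<in> lcarrier L)"

text \<open>\<open>lie_isomorphism\<close> does not mention zero, and for merely closed structures
  its preservation cannot be derived; derived series and quotients refer to it.\<close>

definition pointed_iso :: "('k::field, 'v) lie_struct \<Rightarrow> ('k, 'w) lie_struct \<Rightarrow> ('v \<Rightarrow> 'w) \<Rightarrow> bool" where
  "pointed_iso L M \<phi> \<longleftrightarrow> lie_isomorphism L M \<phi> \<and> \<phi> (lzero L) = lzero M"

lemma lie_closedD:
  assumes "lie_closed L"
  shows "lzero L \<in> lcarrier L"
    and "x \<in> lcarrier L \<Longrightarrow> y \<in> lcarrier L \<Longrightarrow> ladd L x y \<in> lcarrier L"
    and "x \<in> lcarrier L \<Longrightarrow> y \<in> lcarrier L \<Longrightarrow> lbracket L x y \<in> lcarrier L"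
    and "x \<in> lcarrier L \<Longrightarrow> lscale L c x \<in> lcarrier L"
  using assms by (auto simp: lie_closed_def)

lemma lie_algebra_closed: "lie_algebra L \<Longrightarrow> lie_closed L"
  by (auto simp: lie_closed_def lie_algebra_def)

lemma lie_isomorphismD:
  assumes "lie_isomorphism L M \<phi>"
  shows "bij_betw \<phi> (lcarrier L) (lcarrier M)"
    and "x \<in> lcarrier L \<Longrightarrow> y \<in> lcarrier L \<Longrightarrow> \<phi> (ladd L x y) = ladd M (\<phi> x) (\<phi> y)"
    and "x \<in> lcarrier L \<Longrightarrow> \<phi> (lscale L c x) = lscale M c (\<phi> x)"
    and "x \<in> lcarrier L \<Longrightarrow> y \<in> lcarrier L \<Longrightarrow> \<phi> (lbracket L x y) = lbracket M (\<phi> x) (\<phi> y)"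
    and "x \<in> lcarrier L \<Longrightarrow> \<phi> x \<in> lcarrier M"
  using assms by (auto simp: lie_isomorphism_def bij_betw_def)

lemma pointed_iso_trans:
  assumes "pointed_iso L M \<phi>" "pointed_iso M N \<psi>"
  shows "pointed_iso L N (\<psi> \<circ> \<phi>)"
  using assms unfolding pointed_iso_def lie_isomorphism_def
  by (auto intro: bij_betw_trans simp: bij_betwE)

lemma pointed_iso_inverse:
  assumes iso: "pointed_iso L M \<phi>" and L: "lie_closed L"
  obtains \<psi> where "pointed_iso M L \<psi>" "\<And>x. x \<in> lcarrier L \<Longrightarrow> \<psi> (\<phi> x) = x"
    "\<And>y. y \<in> lcarrier M \<Longrightarrow> \<phi> (\<psi> y) = y" "\<And>y. y \<in> lcarrier M \<Longrightarrow> \<psi> y \<in> lcarrier L"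
proof -
  have iso': "lie_isomorphism L M \<phi>" and z: "\<phi> (lzero L) = lzero M"
    using iso by (auto simp: pointed_iso_def)
  note \<phi> = lie_isomorphismD[OF iso']
  define \<psi> where "\<psi> = inv_into (lcarrier L) \<phi>"
  have bij: "bij_betw \<psi> (lcarrier M) (lcarrier L)"
    unfolding \<psi>_def by (rule bij_betw_inv_into[OF \<phi>(1)])
  have l: "\<psi> (\<phi> x) = x" if "x \<in> lcarrier L" for x
    unfolding \<psi>_def by (rule bij_betw_inv_into_left[OF \<phi>(1) that])
  have r: "\<phi> (\<psi> y) = y" if "y \<in> lcarrier M" for y
    unfolding \<psi>_def by (rule bij_betw_inv_into_right[OF \<phi>(1) that])
  have in_L: "\<psi> y \<in> lcarrier L" if "y \<in> lcarrier M" for y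
    using bij that by (rule bij_betw_apply)
  have "\<psi> (ladd M x y) = ladd L (\<psi> x) (\<psi> y)" if "x \<in> lcarrier M" "y \<in> lcarrier M" for x y
    using l[OF lie_closedD(2)[OF L in_L in_L], of x y] \<phi>(2)[OF in_L in_L, of x y] r that by simp
  moreover have "\<psi> (lbracket M x y) = lbracket L (\<psi> x) (\<psi> y)" if "x \<in> lcarrier M" "y \<in> lcarrier M" for x y
    using l[OF lie_closedD(3)[OF L in_L in_L], of x y] \<phi>(4)[OF in_L in_L, of x y] r that by simp
  moreover have "\<psi> (lscale M c x) = lscale L c (\<psi> x)" if "x \<in> lcarrier M" for x c
    using l[OF lie_closedD(4)[OF L in_L], of x c] \<phi>(3)[OF in_L, of x c] r that by simp
  moreover have "\<psi> (lzero M) = lzero L"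
    using l[OF lie_closedD(1)[OF L]] z by simp
  ultimately have "pointed_iso M L \<psi>"
    unfolding pointed_iso_def lie_isomorphism_def using bij by blast
  then show ?thesis
    using that l r in_L by blast
qed

section \<open>Spans and derived series under isomorphisms\<close>

lemma lie_subspace_span:
  assumes L: "lie_closed L" and S: "S \<subseteq> lcarrier L"
  shows "lie_subspace L (lie_span L S)"
proof -
  have car: "lie_subspace L (lcarrier L)"
    using L by (auto simp: lie_subspace_def lie_closed_def)
  then have "lie_span L S \<subseteq> lcarrier L"
    unfolding lie_span_def using S by (simp add: hull_minimal)
  then show ?thesis
    unfolding lie_subspace_def lie_span_def hull_def by blast
qed

lemma lie_span_superset: "S \<subseteq> lie_span L S"
  unfolding lie_span_def by (rule hull_subset)

lemma lie_span_minimal: "S \<subseteq> U \<Longrightarrow> lie_subspace L U \<Longrightarrow> lie_span L S \<subseteq> U"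
  unfolding lie_span_def by (rule hull_minimal)

lemma derived_series_subset: "lie_closed L \<Longrightarrow> derived_series L k \<subseteq> lcarrier L"
proof (induction k)
  case (Suc k)
  then have "{lbracket L x y |x y. x \<in> derived_series L k \<and> y \<in> derived_series L k} \<subseteq> lcarrier L"
    using lie_closedD(3)[OF Suc.prems] by blast
  from lie_subspace_span[OF Suc.prems this] show ?case
    by (simp add: lie_subspace_def)
qed simp

lemma lie_span_image:
  assumes iso: "pointed_iso L M \<phi>" and L: "lie_closed L" and S: "S \<subseteq> lcarrier L"
  shows "lie_span M (\<phi> ` S) = \<phi> ` lie_span L S"
proof -
  have iso': "lie_isomorphism L M \<phi>" and z: "\<phi> (lzero L) = lzero M"
    using iso by (auto simp: pointed_iso_def)
  note \<phi> = lie_isomorphismD[OF iso']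
  have sub: "lie_subspace L (lie_span L S)"
    by (rule lie_subspace_span[OF L S])
  have car: "lie_span L S \<subseteq> lcarrier L" using sub by (simp add: lie_subspace_def)
  have "lie_subspace M (\<phi> ` lie_span L S)"
    unfolding lie_subspace_def
  proof (intro conjI ballI allI)
    show "\<phi> ` lie_span L S \<subseteq> lcarrier M" using car \<phi>(5) by blast
    show "lzero M \<in> \<phi> ` lie_span L S" using sub z by (metis image_eqI lie_subspace_def)
    fix x assume "x \<in> \<phi> ` lie_span L S"
    then obtain a where a: "a \<in> lie_span L S" "x = \<phi> a" by blast
    show "lscale M c x \<in> \<phi> ` lie_span L S" for c
      using a \<phi>(3)[of a c] car sub unfolding lie_subspace_def by (metis image_eqI subsetD)
    fix y assume "y \<in> \<phi> ` lie_span L S"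
    then obtain b where b: "b \<in> lie_span L S" "y = \<phi> b" by blast
    show "ladd M x y \<in> \<phi> ` lie_span L S"
      using a b \<phi>(2)[of a b] car sub unfolding lie_subspace_def by (metis image_eqI subsetD)
  qed
  then have 1: "lie_span M (\<phi> ` S) \<subseteq> \<phi> ` lie_span L S"
    by (intro lie_span_minimal image_mono lie_span_superset)
  have "\<phi> ` lie_span L S \<subseteq> V" if V: "\<phi> ` S \<subseteq> V" "lie_subspace M V" for V
  proof -
    have "lie_subspace L {x \<in> lcarrier L. \<phi> x \<in> V}"
      using V(2) L \<phi> z unfolding lie_subspace_def lie_closed_def by auto
    moreover have "S \<subseteq> {x \<in> lcarrier L. \<phi> x \<in> V}" using S V(1) by blast
    ultimately show ?thesis using lie_span_minimal by blast
  qed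
  then have "\<phi> ` lie_span L S \<subseteq> lie_span M (\<phi> ` S)"
    unfolding lie_span_def[of M] hull_def by blast
  with 1 show ?thesis by blast
qed

lemma derived_series_image:
  assumes iso: "pointed_iso L M \<phi>" and L: "lie_closed L"
  shows "derived_series M k = \<phi> ` derived_series L k"
proof (induction k)
  case 0
  then show ?case
    using iso by (simp add: pointed_iso_def lie_isomorphism_def bij_betw_def)
next
  case (Suc k)
  let ?D = "derived_series L k"
  note \<phi> = lie_isomorphismD[of L M \<phi>]
  have D: "?D \<subseteq> lcarrier L" by (rule derived_series_subset[OF L])
  have iso': "lie_isomorphism L M \<phi>" using iso by (simp add: pointed_iso_def)
  have "{lbracket M x y |x y. x \<in> \<phi> ` ?D \<and> y \<in> \<phi> ` ?D} = \<phi> ` {lbracket L x y |x y. x \<in> ?D \<and> y \<in> ?D}"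
  proof (intro equalityI subsetI)
    fix u assume "u \<in> {lbracket M x y |x y. x \<in> \<phi> ` ?D \<and> y \<in> \<phi> ` ?D}"
    then obtain a b where ab: "a \<in> ?D" "b \<in> ?D" "u = lbracket M (\<phi> a) (\<phi> b)" by blast
    then have "u = \<phi> (lbracket L a b)" using \<phi>(4)[OF iso'] D by (metis subsetD)
    then show "u \<in> \<phi> ` {lbracket L x y |x y. x \<in> ?D \<and> y \<in> ?D}" using ab by blast
  next
    fix u assume "u \<in> \<phi> ` {lbracket L x y |x y. x \<in> ?D \<and> y \<in> ?D}"
    then obtain a b where ab: "a \<in> ?D" "b \<in> ?D" "u = \<phi> (lbracket L a b)" by blast
    then have "u = lbracket M (\<phi> a) (\<phi> b)" using \<phi>(4)[OF iso'] D by (metis subsetD)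
    then show "u \<in> {lbracket M x y |x y. x \<in> \<phi> ` ?D \<and> y \<in> \<phi> ` ?D}" using ab by blast
  qed
  moreover have "{lbracket L x y |x y. x \<in> ?D \<and> y \<in> ?D} \<subseteq> lcarrier L"
    using D lie_closedD(3)[OF L] by blast
  ultimately show ?case
    by (simp add: Suc lie_span_image[OF iso L])
qed

lemma step_solvable_iso:
  assumes iso: "pointed_iso L M \<phi>" and L: "lie_closed L" and "step_solvable k L"
  shows "step_solvable k M"
proof -
  have iso': "lie_isomorphism L M \<phi>" and z: "\<phi> (lzero L) = lzero M"
    using iso by (auto simp: pointed_iso_def)
  have inj: "inj_on \<phi> (lcarrier L)"
    using lie_isomorphismD(1)[OF iso'] by (simp add: bij_betw_def)
  have "derived_series M k = {lzero M} \<longleftrightarrow> derived_series L k = {lzero L}" for k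
  proof -
    have "derived_series M k = {lzero M} \<longleftrightarrow> \<phi> ` derived_series L k = \<phi> ` {lzero L}"
      by (simp add: derived_series_image[OF iso L] z)
    also have "\<dots> \<longleftrightarrow> derived_series L k = {lzero L}"
      by (rule inj_on_image_eq_iff[OF inj derived_series_subset[OF L]])
        (use lie_closedD(1)[OF L] in simp)
    finally show ?thesis .
  qed
  then show ?thesis
    using assms(3) by (simp add: step_solvable_def lie_solvable_def derived_length_def)
qed

section \<open>Quotients, derivations and outer derivations under isomorphisms\<close>

lemma lie_coset_subset:
  "lie_closed A \<Longrightarrow> I \<subseteq> lcarrier A \<Longrightarrow> x \<in> lcarrier A \<Longrightarrow> lie_coset A I x \<subseteq> lcarrier A"
  by (auto simp: lie_coset_def lie_closed_def)

text \<open>The operations of the quotient are unions over representatives, and images commute with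
  unions, so it suffices to know the images of cosets.\<close>

lemma pointed_iso_quotient:
  assumes iso: "pointed_iso A B \<tau>" and A: "lie_closed A" and I: "I \<subseteq> lcarrier A"
  shows "pointed_iso (lie_quotient A I) (lie_quotient B (\<tau> ` I)) (image \<tau>)"
proof -
  have iso': "lie_isomorphism A B \<tau>" and z: "\<tau> (lzero A) = lzero B"
    using iso by (auto simp: pointed_iso_def)
  note \<tau> = lie_isomorphismD[OF iso']
  have coset: "\<tau> ` lie_coset A I x = lie_coset B (\<tau> ` I) (\<tau> x)" if x: "x \<in> lcarrier A" for x
  proof (intro equalityI subsetI)
    fix u assume "u \<in> \<tau> ` lie_coset A I x"
    then obtain i where i: "i \<in> I" "u = \<tau> (ladd A x i)" by (auto simp: lie_coset_def)
    then have "u = ladd B (\<tau> x) (\<tau> i)" using \<tau>(2)[OF x, of i] I by blast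
    then show "u \<in> lie_coset B (\<tau> ` I) (\<tau> x)" using i by (auto simp: lie_coset_def)
  next
    fix u assume "u \<in> lie_coset B (\<tau> ` I) (\<tau> x)"
    then obtain i where i: "i \<in> I" "u = ladd B (\<tau> x) (\<tau> i)" by (auto simp: lie_coset_def)
    then have "u = \<tau> (ladd A x i)" using \<tau>(2)[OF x, of i] I by (metis subsetD)
    then show "u \<in> \<tau> ` lie_coset A I x" using i by (auto simp: lie_coset_def)
  qed
  have inj: "inj_on \<tau> (lcarrier A)" and img: "\<tau> ` lcarrier A = lcarrier B"
    using \<tau>(1) by (auto simp: bij_betw_def)
  have sub: "X \<subseteq> lcarrier A" if "X \<in> lcarrier (lie_quotient A I)" for X
    using that lie_coset_subset[OF A I] by (auto simp: lie_quotient_def)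
  note cl = lie_closedD[OF A]
  have "bij_betw (image \<tau>) (lcarrier (lie_quotient A I)) (lcarrier (lie_quotient B (\<tau> ` I)))"
    unfolding bij_betw_def
  proof
    show "inj_on (image \<tau>) (lcarrier (lie_quotient A I))"
      by (rule inj_onI) (metis inj inj_on_image_eq_iff sub)
    have "image \<tau> ` lie_coset A I ` lcarrier A = lie_coset B (\<tau> ` I) ` \<tau> ` lcarrier A"
      unfolding image_image by (rule image_cong) (auto simp: coset)
    then show "image \<tau> ` lcarrier (lie_quotient A I) = lcarrier (lie_quotient B (\<tau> ` I))"
      by (simp add: lie_quotient_def img)
  qed
  moreover have "\<tau> ` ladd (lie_quotient A I) X Y = ladd (lie_quotient B (\<tau> ` I)) (\<tau> ` X) (\<tau> ` Y)"
    if "X \<subseteq> lcarrier A" "Y \<subseteq> lcarrier A" for X Y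
    unfolding lie_quotient_def lie_struct.simps image_UN UN_simps(10)
    using that by (intro SUP_cong refl) (simp add: coset cl subset_iff \<tau>)
  moreover have "\<tau> ` lbracket (lie_quotient A I) X Y = lbracket (lie_quotient B (\<tau> ` I)) (\<tau> ` X) (\<tau> ` Y)"
    if "X \<subseteq> lcarrier A" "Y \<subseteq> lcarrier A" for X Y
    unfolding lie_quotient_def lie_struct.simps image_UN UN_simps(10)
    using that by (intro SUP_cong refl) (simp add: coset cl subset_iff \<tau>)
  moreover have "\<tau> ` lscale (lie_quotient A I) c X = lscale (lie_quotient B (\<tau> ` I)) c (\<tau> ` X)"
    if "X \<subseteq> lcarrier A" for X c
    unfolding lie_quotient_def lie_struct.simps image_UN UN_simps(10)
    using that by (intro SUP_cong refl) (simp add: coset cl subset_iff \<tau>)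
  moreover have "\<tau> ` lzero (lie_quotient A I) = lzero (lie_quotient B (\<tau> ` I))"
    by (simp add: lie_quotient_def coset cl z)
  ultimately show ?thesis
    unfolding pointed_iso_def lie_isomorphism_def using sub by simp
qed

lemma lie_closed_image:
  assumes iso: "pointed_iso L M \<phi>" and L: "lie_closed L"
  shows "lie_closed M"
proof -
  have iso': "lie_isomorphism L M \<phi>" and z: "\<phi> (lzero L) = lzero M"
    using iso by (auto simp: pointed_iso_def)
  note \<phi> = lie_isomorphismD[OF iso']
  have M: "lcarrier M = \<phi> ` lcarrier L" using \<phi>(1) by (simp add: bij_betw_def)
  show ?thesis
    unfolding lie_closed_def M
  proof (intro conjI)
    show "lzero M \<in> \<phi> ` lcarrier L"
      using z lie_closedD(1)[OF L] by (metis image_eqI)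
  qed (use L in \<open>auto simp: lie_closed_def simp flip: \<phi>(2) \<phi>(3) \<phi>(4)\<close>)
qed

text \<open>Conjugation by an isomorphism \<open>\<phi>\<close> with inverse \<open>\<psi>\<close>;
  the restriction keeps the result extensional, as the elements of \<open>Der\<close> are.\<close>

definition transport :: "('v \<Rightarrow> 'w) \<Rightarrow> ('w \<Rightarrow> 'v) \<Rightarrow> 'w set \<Rightarrow> ('v \<Rightarrow> 'v) \<Rightarrow> 'w \<Rightarrow> 'w" where
  "transport \<phi> \<psi> A D = (\<lambda>y\<in>A. \<phi> (D (\<psi> y)))"

lemma transport_Der:
  assumes \<phi>: "lie_isomorphism L M \<phi>" and \<psi>: "lie_isomorphism M L \<psi>" and M: "lie_closed M"
    and inv: "\<And>y. y \<in> lcarrier M \<Longrightarrow> \<phi> (\<psi> y) = y"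
    and D: "D \<in> lcarrier (Der L)"
  shows "transport \<phi> \<psi> (lcarrier M) D \<in> lcarrier (Der M)"
proof -
  note f = lie_isomorphismD[OF \<phi>] and g = lie_isomorphismD[OF \<psi>] and c = lie_closedD[OF M]
  have D: "D x \<in> lcarrier L" "x \<in> lcarrier L \<Longrightarrow> D (lscale L a x) = lscale L a (D x)"
    "y \<in> lcarrier L \<Longrightarrow> D (ladd L x y) = ladd L (D x) (D y)"
    "y \<in> lcarrier L \<Longrightarrow> D (lbracket L x y) = ladd L (lbracket L (D x) y) (lbracket L x (D y))"
    if "x \<in> lcarrier L" for x y a
    using D that by (auto simp: Der_def lie_derivation_def)
  \<comment> \<open>Closure of \<open>L\<close> under these brackets is obtained from that of
    \<open>M\<close>, since every element of \<open>L\<close> has the form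
    \<open>\<psi> v\<close>.\<close>
  have br: "lbracket L u (\<psi> y) \<in> lcarrier L" "lbracket L (\<psi> y) u \<in> lcarrier L"
    if "u \<in> lcarrier L" "y \<in> lcarrier M" for u y
  proof -
    have "u \<in> \<psi> ` lcarrier M" using g(1) that by (simp add: bij_betw_def)
    then obtain v where v: "v \<in> lcarrier M" "u = \<psi> v" by blast
    show "lbracket L u (\<psi> y) \<in> lcarrier L" "lbracket L (\<psi> y) u \<in> lcarrier L"
      unfolding v(2) using v(1) that(2) by (simp_all add: c g(5) flip: g(4))
  qed
  show ?thesis
    unfolding Der_def lie_derivation_def transport_def
    by (simp add: c f g D inv br)
qed

lemma pointed_iso_Der:
  assumes iso: "pointed_iso L M \<phi>" and L: "lie_closed L" and L': "lie_closed (Der L)"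
  shows "\<exists>t. pointed_iso (Der L) (Der M) t \<and> t ` ad L ` lcarrier L = ad M ` lcarrier M"
proof -
  obtain \<psi> where iso2: "pointed_iso M L \<psi>" and l: "\<And>x. x \<in> lcarrier L \<Longrightarrow> \<psi> (\<phi> x) = x"
    and r: "\<And>y. y \<in> lcarrier M \<Longrightarrow> \<phi> (\<psi> y) = y" and in_L: "\<And>y. y \<in> lcarrier M \<Longrightarrow> \<psi> y \<in> lcarrier L"
    using pointed_iso_inverse[OF iso L] by blast
  have M: "lie_closed M" by (rule lie_closed_image[OF iso L])
  have \<phi>: "lie_isomorphism L M \<phi>" and \<psi>: "lie_isomorphism M L \<psi>" and z: "\<phi> (lzero L) = lzero M"
    using iso iso2 by (auto simp: pointed_iso_def)
  note f = lie_isomorphismD[OF \<phi>] and g = lie_isomorphismD[OF \<psi>] and c = lie_closedD[OF L] and d = lie_closedD[OF M]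
  define t where "t = transport \<phi> \<psi> (lcarrier M)"
  define t' where "t' = transport \<psi> \<phi> (lcarrier L)"
  have t: "t D \<in> lcarrier (Der M)" if "D \<in> lcarrier (Der L)" for D
    unfolding t_def by (rule transport_Der[OF \<phi> \<psi> M r that])
  have t': "t' D \<in> lcarrier (Der L)" if "D \<in> lcarrier (Der M)" for D
    unfolding t'_def by (rule transport_Der[OF \<psi> \<phi> L l that])
  have DL: "D x \<in> lcarrier L" if "D \<in> lcarrier (Der L)" "x \<in> lcarrier L" for D x
    using that by (auto simp: Der_def lie_derivation_def)
  have DM: "D x \<in> lcarrier M" if "D \<in> lcarrier (Der M)" "x \<in> lcarrier M" for D x
    using that by (auto simp: Der_def lie_derivation_def)
  have "bij_betw t (lcarrier (Der L)) (lcarrier (Der M))"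
  proof (rule bij_betw_byWitness[where f' = t'])
    show "\<forall>D\<in>lcarrier (Der L). t' (t D) = D"
    proof
      fix D assume D: "D \<in> lcarrier (Der L)"
      show "t' (t D) = D"
      proof (rule extensionalityI[where A = "lcarrier L"])
        show "D \<in> extensional (lcarrier L)" using D by (simp add: Der_def)
      qed (simp_all add: t_def t'_def transport_def f l DL[OF D])
    qed
    show "\<forall>D\<in>lcarrier (Der M). t (t' D) = D"
    proof
      fix D assume D: "D \<in> lcarrier (Der M)"
      show "t (t' D) = D"
      proof (rule extensionalityI[where A = "lcarrier M"])
        show "D \<in> extensional (lcarrier M)" using D by (simp add: Der_def)
      qed (simp_all add: t_def t'_def transport_def g r DM[OF D])
    qed
  qed (use t t' in auto)
  moreover have "t (ladd (Der L) D E) = ladd (Der M) (t D) (t E)"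
    if "D \<in> lcarrier (Der L)" "E \<in> lcarrier (Der L)" for D E
    by (rule ext) (simp add: Der_def t_def transport_def restrict_def in_L f DL[OF that(1)] DL[OF that(2)])
  moreover have "t (lscale (Der L) a D) = lscale (Der M) a (t D)" if "D \<in> lcarrier (Der L)" for D a
    by (rule ext) (simp add: Der_def t_def transport_def restrict_def in_L f DL[OF that])
  moreover have "t (lbracket (Der L) D E) = lbracket (Der M) (t D) (t E)"
    if "D \<in> lcarrier (Der L)" "E \<in> lcarrier (Der L)" for D E
    by (rule ext) (simp add: Der_def t_def transport_def restrict_def in_L f l c DL[OF that(1)] DL[OF that(2)])
  moreover have "t (lzero (Der L)) = lzero (Der M)"
    by (rule ext) (simp add: Der_def t_def transport_def restrict_def in_L z)
  ultimately have "pointed_iso (Der L) (Der M) t"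
    unfolding pointed_iso_def lie_isomorphism_def by blast
  moreover have "t ` ad L ` lcarrier L = ad M ` lcarrier M"
  proof -
    have "t (ad L x) = ad M (\<phi> x)" if "x \<in> lcarrier L" for x
      by (rule ext) (simp add: ad_def t_def transport_def restrict_def in_L f r that)
    then have "t ` ad L ` lcarrier L = ad M ` \<phi> ` lcarrier L"
      unfolding image_image by (intro image_cong refl) simp
    then show ?thesis using f(1) by (simp add: bij_betw_def)
  qed
  ultimately show ?thesis by blast
qed

lemma pointed_iso_Out:
  assumes iso: "pointed_iso L M \<phi>" and L: "lie_closed L" and L': "lie_closed (Der L)"
    and ad: "ad L ` lcarrier L \<subseteq> lcarrier (Der L)"
  shows "\<exists>\<theta>. pointed_iso (Out L) (Out M) \<theta>"
proof -
  obtain t where t: "pointed_iso (Der L) (Der M) t" "t ` ad L ` lcarrier L = ad M ` lcarrier M"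
    using pointed_iso_Der[OF iso L L'] by blast
  show ?thesis
    using pointed_iso_quotient[OF t(1) L' ad] unfolding Out_def t(2) by blast
qed

context lie_algebra begin

lemma coset_eq:
  assumes I: "lie_subspace L I" and x: "x \<in> lcarrier L" and i: "i \<in> I"
  shows "lie_coset L I (ladd L x i) = lie_coset L I x"
proof -
  have sub: "I \<subseteq> lcarrier L" using I by (simp add: lie_subspace_def)
  have neg: "lscale L (-1) i \<in> I" and add: "\<And>j k. j \<in> I \<Longrightarrow> k \<in> I \<Longrightarrow> ladd L j k \<in> I"
    using I i by (auto simp: lie_subspace_def)
  have iL: "i \<in> lcarrier L" using sub i by blast
  have nL: "lscale L (-1) i \<in> lcarrier L" using iL by (rule scale_closed)
  show ?thesis
  proof (intro equalityI subsetI)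
    fix u assume "u \<in> lie_coset L I (ladd L x i)"
    then obtain j where j: "j \<in> I" "u = ladd L (ladd L x i) j" by (auto simp: lie_coset_def)
    then have "u = ladd L x (ladd L i j)" using add_assoc[OF x iL, of j] sub by blast
    then show "u \<in> lie_coset L I x" using add[OF i j(1)] by (auto simp: lie_coset_def)
  next
    fix u assume "u \<in> lie_coset L I x"
    then obtain j where j: "j \<in> I" "u = ladd L x j" by (auto simp: lie_coset_def)
    have jL: "j \<in> lcarrier L" using j sub by blast
    have "ladd L i (ladd L (lscale L (-1) i) j) = ladd L (lzero L) j"
      using add_assoc[OF iL nL jL] add_minus[OF iL] by simp
    then have "u = ladd L (ladd L x i) (ladd L (lscale L (-1) i) j)"
      using add_assoc[OF x iL add_closed[OF nL jL]] j add_zero[OF jL] by simp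
    then show "u \<in> lie_coset L I (ladd L x i)" using add[OF neg j(1)] by (auto simp: lie_coset_def)
  qed
qed

lemma coset_self:
  assumes I: "lie_subspace L I" and x: "x \<in> lcarrier L"
  shows "x \<in> lie_coset L I x"
proof -
  have "x = ladd L x (lzero L)"
    using add_zero[OF x] add_commute[OF x zero_closed] by simp
  moreover have "lzero L \<in> I" using I by (simp add: lie_subspace_def)
  ultimately show ?thesis by (auto simp: lie_coset_def)
qed

text \<open>The image of \<open>\<Psi>\<close> is a linear complement of \<open>I\<close>, and
  brackets are respected modulo \<open>I\<close>; this makes \<open>M\<close> a model of the
  quotient although \<open>\<Psi>\<close> need not be a homomorphism.\<close>

lemma pointed_iso_into_quotient:
  assumes I: "lie_subspace L I"
    and ideal: "\<And>x i. x \<in> lcarrier L \<Longrightarrow> i \<in> I \<Longrightarrow> lbracket L x i \<in> I"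
      "\<And>x i. x \<in> lcarrier L \<Longrightarrow> i \<in> I \<Longrightarrow> lbracket L i x \<in> I"
    and \<Psi>: "\<And>m. m \<in> lcarrier M \<Longrightarrow> \<Psi> m \<in> lcarrier L" "\<Psi> (lzero M) = lzero L"
      "\<And>m m'. m \<in> lcarrier M \<Longrightarrow> m' \<in> lcarrier M \<Longrightarrow> \<Psi> (ladd M m m') = ladd L (\<Psi> m) (\<Psi> m')"
      "\<And>m c. m \<in> lcarrier M \<Longrightarrow> \<Psi> (lscale M c m) = lscale L c (\<Psi> m)"
      "\<And>m m'. m \<in> lcarrier M \<Longrightarrow> m' \<in> lcarrier M \<Longrightarrow>
        \<exists>i\<in>I. lbracket L (\<Psi> m) (\<Psi> m') = ladd L (\<Psi> (lbracket M m m')) i"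
    and M: "\<And>m m'. m \<in> lcarrier M \<Longrightarrow> m' \<in> lcarrier M \<Longrightarrow> lbracket M m m' \<in> lcarrier M"
    and surj: "\<And>x. x \<in> lcarrier L \<Longrightarrow> \<exists>m\<in>lcarrier M. \<exists>i\<in>I. x = ladd L (\<Psi> m) i"
    and inj: "\<And>m m' i. m \<in> lcarrier M \<Longrightarrow> m' \<in> lcarrier M \<Longrightarrow> i \<in> I \<Longrightarrow> \<Psi> m = ladd L (\<Psi> m') i \<Longrightarrow> m = m'"
  shows "pointed_iso M (lie_quotient L I) (\<lambda>m. lie_coset L I (\<Psi> m))"
proof -
  let ?Q = "lie_quotient L I"
  have sub: "I \<subseteq> lcarrier L" and Iadd: "\<And>i j. i \<in> I \<Longrightarrow> j \<in> I \<Longrightarrow> ladd L i j \<in> I"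
    and Isc: "\<And>i c. i \<in> I \<Longrightarrow> lscale L c i \<in> I"
    using I by (auto simp: lie_subspace_def)
  have iL: "i \<in> lcarrier L" if "i \<in> I" for i using sub that by blast
  note self = coset_self[OF I] and ceq = coset_eq[OF I]
  have UN_const: "(\<Union>x\<in>A. F x) = B" if "A \<noteq> {}" "\<And>x. x \<in> A \<Longrightarrow> F x = B" for A F and B :: "'b set"
    using that by auto
  have ne: "lie_coset L I x \<noteq> {}" if "x \<in> lcarrier L" for x using self[OF that] by blast
  have add: "ladd ?Q (lie_coset L I x) (lie_coset L I y) = lie_coset L I (ladd L x y)"
    if x: "x \<in> lcarrier L" and y: "y \<in> lcarrier L" for x y
    unfolding lie_quotient_def lie_struct.simps
  proof (intro UN_const ne x y)
    fix u v assume "u \<in> lie_coset L I x" "v \<in> lie_coset L I y"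
    then obtain i j where ij: "i \<in> I" "j \<in> I" "u = ladd L x i" "v = ladd L y j"
      by (auto simp: lie_coset_def)
    note c = x y iL[OF ij(1)] iL[OF ij(2)]
    have "ladd L i (ladd L y j) = ladd L y (ladd L i j)"
      by (metis c add_assoc add_commute)
    then have "ladd L u v = ladd L (ladd L x y) (ladd L i j)"
      using c by (simp add: ij add_assoc add_closed)
    then show "lie_coset L I (ladd L u v) = lie_coset L I (ladd L x y)"
      using ceq[OF add_closed[OF x y] Iadd[OF ij(1,2)]] by simp
  qed
  have br: "lbracket ?Q (lie_coset L I x) (lie_coset L I y) = lie_coset L I (lbracket L x y)"
    if x: "x \<in> lcarrier L" and y: "y \<in> lcarrier L" for x y
    unfolding lie_quotient_def lie_struct.simps
  proof (intro UN_const ne x y)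
    fix u v assume "u \<in> lie_coset L I x" "v \<in> lie_coset L I y"
    then obtain i j where ij: "i \<in> I" "j \<in> I" "u = ladd L x i" "v = ladd L y j"
      by (auto simp: lie_coset_def)
    note c = x y iL[OF ij(1)] iL[OF ij(2)]
    \<comment> \<open>All terms of the expanded bracket in which an element of \<open>I\<close>
      occurs.\<close>
    let ?k = "ladd L (lbracket L i y) (ladd L (lbracket L x j) (lbracket L i j))"
    have k: "?k \<in> I"
      using c ij by (intro Iadd ideal add_closed) auto
    have "lbracket L u v = ladd L (lbracket L x y) ?k"
      using c by (simp add: ij bracket_add_left bracket_add_right bracket_closed add_closed add_assoc)
    then show "lie_coset L I (lbracket L u v) = lie_coset L I (lbracket L x y)"
      using ceq[OF bracket_closed[OF x y] k] by simp
  qed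
  have sc: "lscale ?Q a (lie_coset L I x) = lie_coset L I (lscale L a x)" if x: "x \<in> lcarrier L" for x a
    unfolding lie_quotient_def lie_struct.simps
  proof (intro UN_const ne x)
    fix u assume "u \<in> lie_coset L I x"
    then obtain i where i: "i \<in> I" "u = ladd L x i" by (auto simp: lie_coset_def)
    then have "lscale L a u = ladd L (lscale L a x) (lscale L a i)"
      using scale_add_right[OF x iL] by simp
    then show "lie_coset L I (lscale L a u) = lie_coset L I (lscale L a x)"
      using ceq[OF scale_closed[OF x] Isc[OF i(1)]] by simp
  qed
  have "bij_betw (\<lambda>m. lie_coset L I (\<Psi> m)) (lcarrier M) (lcarrier ?Q)"
    unfolding bij_betw_def
  proof
    show "inj_on (\<lambda>m. lie_coset L I (\<Psi> m)) (lcarrier M)"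
    proof (rule inj_onI)
      fix m m' assume m: "m \<in> lcarrier M" "m' \<in> lcarrier M" "lie_coset L I (\<Psi> m) = lie_coset L I (\<Psi> m')"
      have "\<Psi> m \<in> lie_coset L I (\<Psi> m')" using self[OF \<Psi>(1)[OF m(1)]] m(3) by simp
      then obtain i where "i \<in> I" "\<Psi> m = ladd L (\<Psi> m') i" by (auto simp: lie_coset_def)
      then show "m = m'" using inj m by blast
    qed
    show "(\<lambda>m. lie_coset L I (\<Psi> m)) ` lcarrier M = lcarrier ?Q"
    proof (intro equalityI subsetI)
      fix X assume "X \<in> lcarrier ?Q"
      then obtain x where x: "x \<in> lcarrier L" "X = lie_coset L I x" by (auto simp: lie_quotient_def)
      obtain m i where "m \<in> lcarrier M" "i \<in> I" "x = ladd L (\<Psi> m) i" using surj[OF x(1)] by blast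
      then have "X = lie_coset L I (\<Psi> m)" using ceq[OF \<Psi>(1)] x by simp
      then show "X \<in> (\<lambda>m. lie_coset L I (\<Psi> m)) ` lcarrier M" using \<open>m \<in> lcarrier M\<close> by blast
    qed (use \<Psi>(1) in \<open>auto simp: lie_quotient_def\<close>)
  qed
  moreover have "lie_coset L I (\<Psi> (lbracket M m m')) = lbracket ?Q (lie_coset L I (\<Psi> m)) (lie_coset L I (\<Psi> m'))"
    if m: "m \<in> lcarrier M" "m' \<in> lcarrier M" for m m'
  proof -
    obtain i where "i \<in> I" "lbracket L (\<Psi> m) (\<Psi> m') = ladd L (\<Psi> (lbracket M m m')) i"
      using \<Psi>(5)[OF m] by blast
    then show ?thesis
      using br[OF \<Psi>(1)[OF m(1)] \<Psi>(1)[OF m(2)]] ceq[OF \<Psi>(1)[OF M[OF m]]] by simp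
  qed
  moreover have "lie_coset L I (\<Psi> (lzero M)) = lzero ?Q"
    by (simp add: \<Psi>(2) lie_quotient_def)
  ultimately show ?thesis
    unfolding pointed_iso_def lie_isomorphism_def by (simp add: \<Psi> add sc)
qed

end

section \<open>The outer derivation algebra\<close>

context ham
begin

lemma poisson_der_cong:
  assumes "poisson_der T" "\<And>f. f \<in> GG \<Longrightarrow> U f = T f"
  shows "poisson_der U"
  using assms(1) unfolding poisson_der_def by (simp add: assms(2) GG_add GG_C_mult br_GG GG_OA)

lemma poisson_der_restrict [simp]: "poisson_der (restrict T GG) \<longleftrightarrow> poisson_der T"
  using poisson_der_cong[of T "restrict T GG"] poisson_der_cong[of "restrict T GG" T] by auto

lemma poisson_der_fun_diff: "poisson_der T \<Longrightarrow> f \<in> GG \<Longrightarrow> g \<in> GG \<Longrightarrow> T (f - g) = T f - T g"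
  using poisson_derD(2)[of T "f - g" g] GG_diff[of f g] by simp

lemma poisson_der_commutator:
  assumes TU: "poisson_der T" "poisson_der U"
  shows "poisson_der (\<lambda>f. T (U f) - U (T f))"
proof -
  note k = poisson_derD[OF TU(1)] poisson_derD[OF TU(2)]
  show ?thesis
    unfolding poisson_der_def
  proof (intro conjI ballI allI)
    fix f g c assume f: "f \<in> GG"
    show "T (U f) - U (T f) \<in> GG" using f by (intro GG_diff k)
    show "T (U (C c * f)) - U (T (C c * f)) = C c * (T (U f) - U (T f))"
      using f by (simp add: k right_diff_distrib)
    assume g: "g \<in> GG"
    show "T (U (f + g)) - U (T (f + g)) = (T (U f) - U (T f)) + (T (U g) - U (T g))"
      using f g by (simp add: k)
    show "T (U (br f g)) - U (T (br f g)) = br (T (U f) - U (T f)) g + br f (T (U g) - U (T g))"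
      using f g by (simp add: k br_GG GG_OA br_diff)
  qed
qed

lemma Der_K:
  "lcarrier (Der K) = {D \<in> extensional GG. poisson_der D}"
  "lzero (Der K) = (\<lambda>x\<in>GG. 0)"
  "ladd (Der K) = (\<lambda>D E. \<lambda>x\<in>GG. D x + E x)"
  "lscale (Der K) = (\<lambda>c D. \<lambda>x\<in>GG. C c * D x)"
  "lbracket (Der K) = (\<lambda>D E. \<lambda>x\<in>GG. D (E x) - E (D x))"
  unfolding Der_def poisson_der_iff by (simp_all add: K_def C_simps)

lemma lie_algebra_Der_K: "lie_algebra (Der K)"
proof
  fix D E F :: "'k dps \<Rightarrow> 'k dps" and c d :: 'k
  show "lzero (Der K) \<in> lcarrier (Der K)" by (simp add: Der_K poisson_der_zero)
  assume "D \<in> lcarrier (Der K)"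
  then have D: "poisson_der D" "D \<in> extensional GG" "restrict D GG = D"
    by (auto simp: Der_K extensional_restrict)
  note kD = poisson_derD(1,2,3)[OF D(1)] poisson_der_fun_diff[OF D(1)] poisson_der_0[OF D(1)]
  show "lscale (Der K) c D \<in> lcarrier (Der K)" by (simp add: Der_K poisson_der_C_mult D)
  show "ladd (Der K) (lzero (Der K)) D = D"
    using D(3) by (simp add: Der_K cong: restrict_cong)
  show "ladd (Der K) D (lscale (Der K) (-1) D) = lzero (Der K)"
    by (simp add: Der_K C_simps cong: restrict_cong)
  show "lscale (Der K) (c + d) D = ladd (Der K) (lscale (Der K) c D) (lscale (Der K) d D)"
    by (simp add: Der_K C_simps distrib_right cong: restrict_cong)
  show "lscale (Der K) c (lscale (Der K) d D) = lscale (Der K) (c * d) D"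
    by (simp add: Der_K C_mult mult.assoc cong: restrict_cong)
  show "lscale (Der K) 1 D = D"
    using D(3) by (simp add: Der_K C_simps cong: restrict_cong)
  show "lbracket (Der K) D D = lzero (Der K)" by (simp add: Der_K)
  assume "E \<in> lcarrier (Der K)"
  then have E: "poisson_der E" "E \<in> extensional GG" by (auto simp: Der_K)
  note kE = poisson_derD(1,2,3)[OF E(1)] poisson_der_fun_diff[OF E(1)] poisson_der_0[OF E(1)]
  show "ladd (Der K) D E \<in> lcarrier (Der K)" by (simp add: Der_K poisson_der_add D E)
  show "lbracket (Der K) D E \<in> lcarrier (Der K)" by (simp add: Der_K poisson_der_commutator D E)
  show "ladd (Der K) D E = ladd (Der K) E D" by (simp add: Der_K add.commute)
  show "lscale (Der K) c (ladd (Der K) D E) = ladd (Der K) (lscale (Der K) c D) (lscale (Der K) c E)"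
    by (simp add: Der_K distrib_left cong: restrict_cong)
  show "lbracket (Der K) (lscale (Der K) c D) E = lscale (Der K) c (lbracket (Der K) D E)"
    by (simp add: Der_K kD kE right_diff_distrib cong: restrict_cong)
  show "lbracket (Der K) D (lscale (Der K) c E) = lscale (Der K) c (lbracket (Der K) D E)"
    by (simp add: Der_K kD kE right_diff_distrib cong: restrict_cong)
  assume "F \<in> lcarrier (Der K)"
  then have F: "poisson_der F" "F \<in> extensional GG" by (auto simp: Der_K)
  note kF = poisson_derD(1,2,3)[OF F(1)] poisson_der_fun_diff[OF F(1)] poisson_der_0[OF F(1)]
  show "ladd (Der K) (ladd (Der K) D E) F = ladd (Der K) D (ladd (Der K) E F)"
    by (simp add: Der_K add.assoc cong: restrict_cong)
  show "lbracket (Der K) (ladd (Der K) D E) F = ladd (Der K) (lbracket (Der K) D F) (lbracket (Der K) E F)"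
    by (simp add: Der_K kD kE kF algebra_simps cong: restrict_cong)
  show "lbracket (Der K) D (ladd (Der K) E F) = ladd (Der K) (lbracket (Der K) D E) (lbracket (Der K) D F)"
    by (simp add: Der_K kD kE kF algebra_simps cong: restrict_cong)
  show "ladd (Der K) (lbracket (Der K) D (lbracket (Der K) E F))
      (ladd (Der K) (lbracket (Der K) E (lbracket (Der K) F D)) (lbracket (Der K) F (lbracket (Der K) D E))) =
      lzero (Der K)"
    by (simp add: Der_K kD kE kF algebra_simps cong: restrict_cong)
qed

lemma ad_K: "ad K F = (\<lambda>f\<in>GG. br F f)"
  by (simp add: ad_def K_def)

lemma carrier_K: "lcarrier K = GG"
  by (simp add: K_def)

lemma inner_subspace: "lie_subspace (Der K) (ad K ` lcarrier K)"
  unfolding lie_subspace_def carrier_K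
proof (intro conjI ballI allI)
  show "ad K ` GG \<subseteq> lcarrier (Der K)"
    by (auto simp: ad_K Der_K poisson_der_br_GG)
  have "lzero (Der K) = ad K 0"
    by (simp add: ad_K Der_K br_drop_const drop_const_linear)
  then show "lzero (Der K) \<in> ad K ` GG" by simp
  fix D assume "D \<in> ad K ` GG"
  then obtain F where F: "F \<in> GG" "D = ad K F" by blast
  have "lscale (Der K) c D = ad K (C c * F)" for c
    unfolding F(2) by (simp add: ad_K Der_K br_bilinear cong: restrict_cong)
  then show "lscale (Der K) c D \<in> ad K ` GG" for c using F(1) GG_C_mult by simp
  fix E assume "E \<in> ad K ` GG"
  then obtain G where G: "G \<in> GG" "E = ad K G" by blast
  have "ladd (Der K) D E = ad K (F + G)"
    unfolding F(2) G(2) by (simp add: ad_K Der_K br_bilinear cong: restrict_cong)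
  then show "ladd (Der K) D E \<in> ad K ` GG" using F(1) G(1) GG_add by simp
qed

lemma inner_ideal:
  assumes D: "D \<in> lcarrier (Der K)" and E: "E \<in> ad K ` lcarrier K"
  shows "lbracket (Der K) D E \<in> ad K ` lcarrier K" "lbracket (Der K) E D \<in> ad K ` lcarrier K"
proof -
  obtain F where F: "F \<in> GG" "E = ad K F" using E by (auto simp: carrier_K)
  have kD: "poisson_der D" using D by (simp add: Der_K)
  note k = poisson_derD[OF kD]
  have "lbracket (Der K) D E = ad K (D F)"
    unfolding F(2) by (simp add: ad_K Der_K k F(1) br_GG GG_OA cong: restrict_cong)
  then show "lbracket (Der K) D E \<in> ad K ` lcarrier K" using k(1)[OF F(1)] by (simp add: carrier_K)
  have "lbracket (Der K) E D = ad K (C (-1) * D F)"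
    unfolding F(2) by (simp add: ad_K Der_K k F(1) br_GG GG_OA br_bilinear cong: restrict_cong)
      (simp add: C_simps)
  then show "lbracket (Der K) E D \<in> ad K ` lcarrier K"
    using GG_C_mult[OF k(1)[OF F(1)]] by (simp add: carrier_K)
qed

lemma pointed_iso_ham_op: "pointed_iso K (hamiltonian r n) ham_op"
proof -
  have "ham_op 0 = (\<lambda>u a. 0)" by (simp add: ham_op_def fun_eq_iff)
  then show ?thesis
    by (simp add: pointed_iso_def lie_isomorphism_ham_op) (simp add: K_def hamiltonian_def jacobson_witt_def)
qed

end

context ham_big
begin

text \<open>\<open>W\<close>, \<open>Z\<close>, \<open>s\<close> and \<open>V\<close> read the
  parameters of an outer derivation off an element of \<open>M\<close>. Brackets, surjectivity and
  injectivity are tested only at the indices that enter \<open>outer_der\<close>, so each right-hand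
  side may arrange its coordinates freely.\<close>

lemma pointed_iso_Out_hamiltonian:
  fixes M :: "('k, 'm) lie_struct"
  assumes M: "lie_closed M"
    and zero: "W (lzero M) = (\<lambda>j. 0)" "Z (lzero M) = 0" "s (lzero M) = 0" "V (lzero M) = (\<lambda>k j. 0)"
    and add: "\<And>m m'. m \<in> lcarrier M \<Longrightarrow> m' \<in> lcarrier M \<Longrightarrow> W (ladd M m m') = (\<lambda>j. W m j + W m' j) \<and>
      Z (ladd M m m') = Z m + Z m' \<and> s (ladd M m m') = s m + s m' \<and> V (ladd M m m') = (\<lambda>k j. V m k j + V m' k j)"
    and scale: "\<And>c m. m \<in> lcarrier M \<Longrightarrow> W (lscale M c m) = (\<lambda>j. c * W m j) \<and>
      Z (lscale M c m) = c * Z m \<and> s (lscale M c m) = c * s m \<and> V (lscale M c m) = (\<lambda>k j. c * V m k j)"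
    and bracket: "\<And>m m'. m \<in> lcarrier M \<Longrightarrow> m' \<in> lcarrier M \<Longrightarrow>
      (\<forall>j\<in>S. W (lbracket M m m') j = s m * W m' j - s m' * W m j) \<and>
      Z (lbracket M m m') = (of_nat r + 1) * (s m * Z m' - s m' * Z m) +
        (if r = 1 then W m 1 * W m' 2 - W m 2 * W m' 1 else 0) \<and>
      s (lbracket M m m') = 0 \<and> (\<forall>k\<in>S. \<forall>j. 1 \<le> j \<and> j < n k \<longrightarrow> V (lbracket M m m') k j = 0)"
    and surj: "\<And>w z t v. \<exists>m\<in>lcarrier M. (\<forall>j\<in>S. W m j = w j) \<and> Z m = z \<and> s m = t \<and>
      (\<forall>k\<in>S. \<forall>j. 1 \<le> j \<and> j < n k \<longrightarrow> V m k j = v k j)"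
    and inj: "\<And>m m'. m \<in> lcarrier M \<Longrightarrow> m' \<in> lcarrier M \<Longrightarrow> \<forall>j\<in>S. W m j = W m' j \<Longrightarrow> Z m = Z m' \<Longrightarrow> s m = s m' \<Longrightarrow>
      \<forall>k\<in>S. \<forall>j. 1 \<le> j \<and> j < n k \<longrightarrow> V m k j = V m' k j \<Longrightarrow> m = m'"
  shows "\<exists>\<phi>. pointed_iso M (Out (hamiltonian r n :: ('k, 'k dp \<Rightarrow> 'k dp) lie_struct)) \<phi>"
proof -
  define \<Psi> where "\<Psi> m = (\<lambda>f\<in>GG. outer_der (W m) (Z m) (s m) (V m) f)" for m
  have "pointed_iso M (lie_quotient (Der K) (ad K ` lcarrier K)) (\<lambda>m. lie_coset (Der K) (ad K ` lcarrier K) (\<Psi> m))"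
  proof (rule lie_algebra.pointed_iso_into_quotient[OF lie_algebra_Der_K inner_subspace inner_ideal(1) inner_ideal(2)])
    show "\<Psi> (lzero M) = lzero (Der K)"
      unfolding \<Psi>_def zero Der_K by (rule restrict_cong) (simp_all add: outer_der_def outer_def br_drop_const drop_const_linear C_simps)
  next
    fix m m' assume m: "m \<in> lcarrier M" "m' \<in> lcarrier M"
    show "\<Psi> (ladd M m m') = ladd (Der K) (\<Psi> m) (\<Psi> m')"
      using add[OF m] by (simp add: \<Psi>_def Der_K outer_der_linear cong: restrict_cong)
    obtain G where G: "G \<in> GG" and eq: "\<And>f. f \<in> GG \<Longrightarrow>
      outer_der (W m) (Z m) (s m) (V m) (outer_der (W m') (Z m') (s m') (V m') f) -
        outer_der (W m') (Z m') (s m') (V m') (outer_der (W m) (Z m) (s m) (V m) f) =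
      outer_der (\<lambda>j. s m * W m' j - s m' * W m j) ((of_nat r + 1) * (s m * Z m' - s m' * Z m) +
        (if r = 1 then W m 1 * W m' 2 - W m 2 * W m' 1 else 0)) 0 (\<lambda>k j. 0) f + br G f"
      using outer_der_commutator[of "W m" "Z m" "s m" "V m" "W m'" "Z m'" "s m'" "V m'"] by blast
    have o: "outer_der (\<lambda>j. s m * W m' j - s m' * W m j) ((of_nat r + 1) * (s m * Z m' - s m' * Z m) +
        (if r = 1 then W m 1 * W m' 2 - W m 2 * W m' 1 else 0)) 0 (\<lambda>k j. 0) =
      outer_der (W (lbracket M m m')) (Z (lbracket M m m')) (s (lbracket M m m')) (V (lbracket M m m'))"
      by (rule outer_der_cong) (use bracket[OF m] in simp_all)
    have "lbracket (Der K) (\<Psi> m) (\<Psi> m') = ladd (Der K) (\<Psi> (lbracket M m m')) (ad K G)"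
      unfolding Der_K \<Psi>_def ad_K
      by (rule restrict_cong) (simp_all add: poisson_derD(1)[OF poisson_der_outer_der] eq[unfolded o])
    then show "\<exists>i\<in>ad K ` lcarrier K. lbracket (Der K) (\<Psi> m) (\<Psi> m') = ladd (Der K) (\<Psi> (lbracket M m m')) i"
      using G by (auto simp: carrier_K)
    show "lbracket M m m' \<in> lcarrier M" using lie_closedD(3)[OF M m] .
  next
    fix m c assume m: "m \<in> lcarrier M"
    show "\<Psi> m \<in> lcarrier (Der K)" by (simp add: \<Psi>_def Der_K poisson_der_outer_der)
    show "\<Psi> (lscale M c m) = lscale (Der K) c (\<Psi> m)"
      using scale[OF m] by (simp add: \<Psi>_def Der_K outer_der_linear cong: restrict_cong)
  next
    fix D assume D: "D \<in> lcarrier (Der K)"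
    then have kD: "poisson_der D" "restrict D GG = D" by (simp_all add: Der_K extensional_restrict)
    obtain F w z t v where F: "F \<in> GG" and eq: "\<And>f. f \<in> GG \<Longrightarrow> D f = br F f + outer_der w z t v f"
      using poisson_der_eq_outer_der[OF kD(1)] by blast
    obtain m where m: "m \<in> lcarrier M" "\<forall>j\<in>S. W m j = w j" "Z m = z" "s m = t"
      "\<forall>k\<in>S. \<forall>j. 1 \<le> j \<and> j < n k \<longrightarrow> V m k j = v k j"
      using surj by blast
    have "outer_der w z t v = outer_der (W m) (Z m) (s m) (V m)"
      by (rule outer_der_cong) (use m in simp_all)
    then have "D = ladd (Der K) (\<Psi> m) (ad K F)"
      unfolding Der_K \<Psi>_def ad_K
      by (subst kD(2)[symmetric]) (rule restrict_cong, simp_all add: eq add.commute)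
    then show "\<exists>m\<in>lcarrier M. \<exists>i\<in>ad K ` lcarrier K. D = ladd (Der K) (\<Psi> m) i"
      using m(1) F by (auto simp: carrier_K)
  next
    fix m m' E assume m: "m \<in> lcarrier M" "m' \<in> lcarrier M" and E: "E \<in> ad K ` lcarrier K"
      and eq: "\<Psi> m = ladd (Der K) (\<Psi> m') E"
    obtain F where F: "F \<in> GG" "E = ad K F" using E by (auto simp: carrier_K)
    \<comment> \<open>The difference of the two parameter families, written with \<open>-1\<close>
      as a factor to fit \<open>outer_der_linear\<close>, acts as an inner derivation.\<close>
    have "outer_der (\<lambda>j. W m j + -1 * W m' j) (Z m + -1 * Z m') (s m + -1 * s m') (\<lambda>k j. V m k j + -1 * V m' k j) f = br F f"
      if "f \<in> GG" for f
      unfolding outer_der_linear using fun_cong[OF eq, of f] that F(2) by (simp add: \<Psi>_def Der_K ad_K C_simps)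
    from outer_der_inner_imp_0[OF F(1) this] show "m = m'"
      by (intro inj[OF m]) auto
  qed
  then have "pointed_iso M (Out K) (\<lambda>m. lie_coset (Der K) (ad K ` lcarrier K) (\<Psi> m))"
    by (simp add: Out_def)
  moreover obtain \<theta> where "pointed_iso (Out K) (Out (hamiltonian r n :: ('k, 'k dp \<Rightarrow> 'k dp) lie_struct)) \<theta>"
    using pointed_iso_Out[OF pointed_iso_ham_op lie_algebra_closed[OF lie_algebra_K] lie_algebra_closed[OF lie_algebra_Der_K]]
      inner_subspace unfolding lie_subspace_def by blast
  ultimately show ?thesis
    using pointed_iso_trans by blast
qed

definition N :: nat where "N = (\<Sum>i\<in>S. n i)"

text \<open>For each \<open>k\<close> there are \<open>n k - 1\<close> powers, in total |n| - 2r,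
  which is the source of the abelian summand.\<close>

lemma power_index_bij:
  obtains b where "bij_betw b {(k, j). k \<in> S \<and> 1 \<le> j \<and> j < n k} {1..N - 2 * r}"
proof -
  have eq: "{(k, j). k \<in> S \<and> 1 \<le> j \<and> j < n k} = Sigma S (\<lambda>k. {1..<n k})" by auto
  have "card (Sigma S (\<lambda>k. {1..<n k})) = (\<Sum>k\<in>S. n k - 1)" by (simp add: card_SigmaI)
  also have "\<dots> = N - 2 * r"
  proof -
    have "N = (\<Sum>k\<in>S. (n k - 1) + 1)"
      unfolding N_def
    proof (intro sum.cong refl)
      fix k assume "k \<in> S"
      then have "n k \<ge> 1" using n_pos unfolding S_def by blast
      then show "n k = n k - 1 + 1" by simp
    qed
    also have "\<dots> = (\<Sum>k\<in>S. n k - 1) + 2 * r"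
      by (simp only: sum.distrib) (simp add: S_def)
    finally show ?thesis by simp
  qed
  finally have "\<exists>b. bij_betw b (Sigma S (\<lambda>k. {1..<n k})) {1..N - 2 * r}"
    by (intro finite_same_card_bij) auto
  then show ?thesis using that eq by auto
qed

text \<open>The parameter \<open>z\<close> becomes coordinate 2r + 1 of the left factor, on which t
  acts by r + 1. For \<open>r = 1\<close> this is coordinate 3, the centre of the Heisenberg
  algebra, and the extra commutator term supplies its bracket.\<close>

lemma Out_iso_top_left:
  assumes A: "(A = abelian_lie (2 * r + 1) \<and> r \<noteq> 1) \<or> (A = heisenberg_lie \<and> r = 1)"
    and d: "\<And>j. j \<in> S \<Longrightarrow> d j = 1" "d (2 * r + 1) = (of_nat r + 1 :: 'k)"
  shows "\<exists>\<phi>. pointed_iso (semidirect A (diag_map d) \<oplus>\<^sub>L abelian_lie (N - 2 * r))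
    (Out (hamiltonian r n :: ('k, 'k dp \<Rightarrow> 'k dp) lie_struct)) \<phi>"
proof -
  obtain b where b: "bij_betw b {(k, j). k \<in> S \<and> 1 \<le> j \<and> j < n k} {1..N - 2 * r}"
    by (rule power_index_bij)
  have b_in: "1 \<le> b (k, j)" "b (k, j) \<le> N - 2 * r" if "k \<in> S" "1 \<le> j" "j < n k" for k j
    using bij_betw_apply[OF b, of "(k, j)"] that by auto
  define c where "c = inv_into {(k, j). k \<in> S \<and> 1 \<le> j \<and> j < n k} b"
  have cb: "c (b (k, j)) = (k, j)" if "k \<in> S" "1 \<le> j" "j < n k" for k j
    using bij_betw_inv_into_left[OF b, of "(k, j)"] that by (simp add: c_def)
  have bc: "b (c i) = i" "c i \<in> {(k, j). k \<in> S \<and> 1 \<le> j \<and> j < n k}" if "i \<in> {1..N - 2 * r}" for i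
    using bij_betw_inv_into_right[OF b that] bij_betw_apply[OF bij_betw_inv_into[OF b] that] by (simp_all add: c_def)
  define M where "M = semidirect A (diag_map d) \<oplus>\<^sub>L abelian_lie (N - 2 * r)"
  \<comment> \<open>One formula covers both choices of \<open>A\<close>: the bracket of
    \<open>A\<close> is nonzero only for \<open>r = 1\<close>, when 2r + 1 = 3.\<close>
  have Aops: "lcarrier A = {v. \<forall>i. i \<notin> {1..2 * r + 1} \<longrightarrow> v i = 0}" "lzero A = (\<lambda>i. 0)"
    "ladd A = (\<lambda>v w i. v i + w i)" "lscale A = (\<lambda>c v i. c * v i)"
    "lbracket A = (\<lambda>v w i. if i = 2 * r + 1 \<and> r = 1 then v 1 * w 2 - v 2 * w 1 else 0)"
    using A by (auto simp: abelian_lie_def heisenberg_lie_def)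
  have Ms: "lcarrier M = (lcarrier A \<times> UNIV) \<times> {v. \<forall>i. i \<notin> {1..N - 2 * r} \<longrightarrow> v i = 0}"
    "lzero M = (((\<lambda>i. 0), 0), (\<lambda>i. 0))"
    "ladd M ((x, s), u) ((x', s'), u') = (((\<lambda>i. x i + x' i), s + s'), (\<lambda>i. u i + u' i))"
    "lscale M a ((x, s), u) = (((\<lambda>i. a * x i), a * s), (\<lambda>i. a * u i))"
    "lbracket M ((x, s), u) ((x', s'), u') =
      (((\<lambda>i. (if i = 2 * r + 1 \<and> r = 1 then x 1 * x' 2 - x 2 * x' 1 else 0) + (s * (d i * x' i) + - s' * (d i * x i))), 0), (\<lambda>i. 0))"
    for x s u x' s' u' a
    by (simp_all add: M_def lie_direct_sum_def semidirect_def Aops abelian_lie_def diag_map_def)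
  have r1: "2 * r + 1 \<notin> S" by (simp add: S_def)
  show ?thesis
    unfolding M_def[symmetric]
  proof (rule pointed_iso_Out_hamiltonian[where W = "\<lambda>m. fst (fst m)" and Z = "\<lambda>m. fst (fst m) (2 * r + 1)"
        and s = "\<lambda>m. snd (fst m)" and V = "\<lambda>m k j. snd m (b (k, j))"])
    show "lie_closed M"
      unfolding lie_closed_def Ms(1,2) by (auto simp: Ms(3-) Aops)
  next
    fix m m' :: "((nat \<Rightarrow> 'k) \<times> 'k) \<times> (nat \<Rightarrow> 'k)"
    assume m: "m \<in> lcarrier M" "m' \<in> lcarrier M"
    obtain x s u x' s' u' where mm: "m = ((x, s), u)" "m' = ((x', s'), u')" by (metis surj_pair)
    show "fst (fst (ladd M m m')) = (\<lambda>j. fst (fst m) j + fst (fst m') j) \<and>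
       fst (fst (ladd M m m')) (2 * r + 1) = fst (fst m) (2 * r + 1) + fst (fst m') (2 * r + 1) \<and>
       snd (fst (ladd M m m')) = snd (fst m) + snd (fst m') \<and>
       (\<lambda>k j. snd (ladd M m m') (b (k, j))) = (\<lambda>k j. snd m (b (k, j)) + snd m' (b (k, j)))"
      by (simp add: mm Ms)
    show "(\<forall>j\<in>S. fst (fst (lbracket M m m')) j = snd (fst m) * fst (fst m') j - snd (fst m') * fst (fst m) j) \<and>
       fst (fst (lbracket M m m')) (2 * r + 1) =
       (of_nat r + 1) * (snd (fst m) * fst (fst m') (2 * r + 1) - snd (fst m') * fst (fst m) (2 * r + 1)) +
       (if r = 1 then fst (fst m) 1 * fst (fst m') 2 - fst (fst m) 2 * fst (fst m') 1 else 0) \<and>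
       snd (fst (lbracket M m m')) = 0 \<and>
       (\<forall>k\<in>S. \<forall>j. 1 \<le> j \<and> j < n k \<longrightarrow> snd (lbracket M m m') (b (k, j)) = 0)"
    proof (intro conjI)
      show "\<forall>j\<in>S. fst (fst (lbracket M m m')) j = snd (fst m) * fst (fst m') j - snd (fst m') * fst (fst m) j"
        unfolding mm Ms using d(1) r1 by auto
      show "fst (fst (lbracket M m m')) (2 * r + 1) =
       (of_nat r + 1) * (snd (fst m) * fst (fst m') (2 * r + 1) - snd (fst m') * fst (fst m) (2 * r + 1)) +
       (if r = 1 then fst (fst m) 1 * fst (fst m') 2 - fst (fst m) 2 * fst (fst m') 1 else 0)"
        unfolding mm Ms fst_conv snd_conv d(2) by (simp add: algebra_simps)
    qed (simp_all add: mm Ms)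
    show "m = m'" if eq: "\<forall>j\<in>S. fst (fst m) j = fst (fst m') j" "fst (fst m) (2 * r + 1) = fst (fst m') (2 * r + 1)"
       "snd (fst m) = snd (fst m')"
       "\<forall>k\<in>S. \<forall>j. 1 \<le> j \<and> j < n k \<longrightarrow> snd m (b (k, j)) = snd m' (b (k, j))"
    proof -
      have "x i = x' i" for i
      proof (cases "i \<in> {1..2 * r + 1}")
        case True
        then have "i \<in> S \<or> i = 2 * r + 1" by (auto simp: S_def)
        then show ?thesis using eq(1,2) by (auto simp: mm)
      next
        case False
        then show ?thesis using m unfolding Ms(1) mm Aops by simp
      qed
      moreover have "u i = u' i" for i
      proof (cases "i \<in> {1..N - 2 * r}")
        case True
        obtain k j where kj: "c i = (k, j)" by (metis surj_pair)
        then show ?thesis using bc[OF True] eq(4) by (auto simp: mm)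
      next
        case False
        then show ?thesis using m unfolding Ms(1) mm by simp
      qed
      ultimately show ?thesis using eq(3) by (simp add: mm fun_eq_iff)
    qed
  next
    fix w :: "nat \<Rightarrow> 'k" and z t :: 'k and v :: "nat \<Rightarrow> nat \<Rightarrow> 'k"
    let ?x = "\<lambda>i. if i \<in> S then w i else if i = 2 * r + 1 then z else 0"
    let ?u = "\<lambda>i. if i \<in> {1..N - 2 * r} then v (fst (c i)) (snd (c i)) else 0"
    have "((?x, t), ?u) \<in> lcarrier M"
      unfolding Ms(1) Aops by (auto simp: S_def)
    moreover have "\<forall>k\<in>S. \<forall>j. 1 \<le> j \<and> j < n k \<longrightarrow> ?u (b (k, j)) = v k j"
      using b_in cb by auto
    ultimately show "\<exists>m\<in>lcarrier M. (\<forall>j\<in>S. fst (fst m) j = w j) \<and> fst (fst m) (2 * r + 1) = z \<and> snd (fst m) = t \<and>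
       (\<forall>k\<in>S. \<forall>j. 1 \<le> j \<and> j < n k \<longrightarrow> snd m (b (k, j)) = v k j)"
      using r1 by (intro bexI[of _ "((?x, t), ?u)"]) simp_all
  next
    fix a and m :: "((nat \<Rightarrow> 'k) \<times> 'k) \<times> (nat \<Rightarrow> 'k)"
    obtain x s u where mm: "m = ((x, s), u)" by (metis surj_pair)
    show "fst (fst (lscale M a m)) = (\<lambda>j. a * fst (fst m) j) \<and>
       fst (fst (lscale M a m)) (2 * r + 1) = a * fst (fst m) (2 * r + 1) \<and>
       snd (fst (lscale M a m)) = a * snd (fst m) \<and>
       (\<lambda>k j. snd (lscale M a m) (b (k, j))) = (\<lambda>k j. a * snd m (b (k, j)))"
      by (simp add: mm Ms)
  qed (simp_all add: Ms)
qed

text \<open>The degree derivation acts on the top monomial by r + 1 = 0 and no commutator produces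
  it, so \<open>z\<close> is stored as an additional last coordinate of the abelian summand.\<close>

lemma Out_iso_top_right:
  assumes r0: "(of_nat r + 1 :: 'k) = 0" "r \<noteq> 1"
  shows "\<exists>\<phi>. pointed_iso (semidirect (abelian_lie (2 * r)) id \<oplus>\<^sub>L abelian_lie (N - 2 * r + 1))
    (Out (hamiltonian r n :: ('k, 'k dp \<Rightarrow> 'k dp) lie_struct)) \<phi>"
proof -
  obtain b where b: "bij_betw b {(k, j). k \<in> S \<and> 1 \<le> j \<and> j < n k} {1..N - 2 * r}"
    by (rule power_index_bij)
  have b_in: "1 \<le> b (k, j)" "b (k, j) \<le> N - 2 * r" if "k \<in> S" "1 \<le> j" "j < n k" for k j
    using bij_betw_apply[OF b, of "(k, j)"] that by auto
  define c where "c = inv_into {(k, j). k \<in> S \<and> 1 \<le> j \<and> j < n k} b"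
  have cb: "c (b (k, j)) = (k, j)" if "k \<in> S" "1 \<le> j" "j < n k" for k j
    using bij_betw_inv_into_left[OF b, of "(k, j)"] that by (simp add: c_def)
  have bc: "b (c i) = i" "c i \<in> {(k, j). k \<in> S \<and> 1 \<le> j \<and> j < n k}" if "i \<in> {1..N - 2 * r}" for i
    using bij_betw_inv_into_right[OF b that] bij_betw_apply[OF bij_betw_inv_into[OF b] that] by (simp_all add: c_def)
  let ?l = "N - 2 * r + 1"
  define M :: "('k, ((nat \<Rightarrow> 'k) \<times> 'k) \<times> (nat \<Rightarrow> 'k)) lie_struct"
    where "M = semidirect (abelian_lie (2 * r)) id \<oplus>\<^sub>L abelian_lie ?l"
  have Ms: "lcarrier M = ({v. \<forall>i. i \<notin> S \<longrightarrow> v i = 0} \<times> UNIV) \<times> {v. \<forall>i. i \<notin> {1..?l} \<longrightarrow> v i = 0}"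
    "lzero M = (((\<lambda>i. 0), 0), (\<lambda>i. 0))"
    "ladd M ((x, s), u) ((x', s'), u') = (((\<lambda>i. x i + x' i), s + s'), (\<lambda>i. u i + u' i))"
    "lscale M a ((x, s), u) = (((\<lambda>i. a * x i), a * s), (\<lambda>i. a * u i))"
    "lbracket M ((x, s), u) ((x', s'), u') = (((\<lambda>i. s * x' i + - s' * x i), 0), (\<lambda>i. 0))"
    for x s u x' s' u' a
    by (simp_all add: M_def lie_direct_sum_def semidirect_def abelian_lie_def S_def)
  show ?thesis
    unfolding M_def[symmetric]
  proof (rule pointed_iso_Out_hamiltonian[where W = "\<lambda>m. fst (fst m)" and Z = "\<lambda>m. snd m ?l"
        and s = "\<lambda>m. snd (fst m)" and V = "\<lambda>m k j. snd m (b (k, j))"])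
    show "lie_closed M"
      unfolding lie_closed_def Ms(1,2) by (auto simp: Ms(3-))
  next
    fix m m' :: "((nat \<Rightarrow> 'k) \<times> 'k) \<times> (nat \<Rightarrow> 'k)"
    assume m: "m \<in> lcarrier M" "m' \<in> lcarrier M"
    obtain x s u x' s' u' where mm: "m = ((x, s), u)" "m' = ((x', s'), u')" by (metis surj_pair)
    show "fst (fst (ladd M m m')) = (\<lambda>j. fst (fst m) j + fst (fst m') j) \<and>
       snd (ladd M m m') ?l = snd m ?l + snd m' ?l \<and>
       snd (fst (ladd M m m')) = snd (fst m) + snd (fst m') \<and>
       (\<lambda>k j. snd (ladd M m m') (b (k, j))) = (\<lambda>k j. snd m (b (k, j)) + snd m' (b (k, j)))"
      by (simp add: mm Ms)
    show "(\<forall>j\<in>S. fst (fst (lbracket M m m')) j = snd (fst m) * fst (fst m') j - snd (fst m') * fst (fst m) j) \<and>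
       snd (lbracket M m m') ?l =
       (of_nat r + 1) * (snd (fst m) * snd m' ?l - snd (fst m') * snd m ?l) +
       (if r = 1 then fst (fst m) 1 * fst (fst m') 2 - fst (fst m) 2 * fst (fst m') 1 else 0) \<and>
       snd (fst (lbracket M m m')) = 0 \<and>
       (\<forall>k\<in>S. \<forall>j. 1 \<le> j \<and> j < n k \<longrightarrow> snd (lbracket M m m') (b (k, j)) = 0)"
      using r0 by (simp add: mm Ms)
    show "m = m'" if eq: "\<forall>j\<in>S. fst (fst m) j = fst (fst m') j" "snd m ?l = snd m' ?l"
       "snd (fst m) = snd (fst m')"
       "\<forall>k\<in>S. \<forall>j. 1 \<le> j \<and> j < n k \<longrightarrow> snd m (b (k, j)) = snd m' (b (k, j))"
    proof -
      have "x i = x' i" for i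
      proof (cases "i \<in> S")
        case True
        then show ?thesis using eq(1) by (simp add: mm)
      next
        case False
        then show ?thesis using m unfolding Ms(1) mm by simp
      qed
      moreover have "u i = u' i" for i
      proof (cases "i \<in> {1..N - 2 * r}")
        case True
        obtain k j where kj: "c i = (k, j)" by (metis surj_pair)
        then show ?thesis using bc[OF True] eq(4) by (auto simp: mm)
      next
        case False
        show ?thesis
        proof (cases "i = ?l")
          case True
          then show ?thesis using eq(2) by (simp add: mm)
        next
          case ne: False
          then have "i \<notin> {1..?l}" using False by auto
          then show ?thesis using m unfolding Ms(1) mm by simp
        qed
      qed
      ultimately show ?thesis using eq(3) by (simp add: mm fun_eq_iff)
    qed
  next
    fix w :: "nat \<Rightarrow> 'k" and z t :: 'k and v :: "nat \<Rightarrow> nat \<Rightarrow> 'k"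
    let ?x = "\<lambda>i. if i \<in> S then w i else 0"
    let ?u = "\<lambda>i. if i \<in> {1..N - 2 * r} then v (fst (c i)) (snd (c i)) else if i = ?l then z else 0"
    have "((?x, t), ?u) \<in> lcarrier M"
      unfolding Ms(1) by auto
    moreover have "\<forall>k\<in>S. \<forall>j. 1 \<le> j \<and> j < n k \<longrightarrow> ?u (b (k, j)) = v k j"
      using b_in cb by auto
    ultimately show "\<exists>m\<in>lcarrier M. (\<forall>j\<in>S. fst (fst m) j = w j) \<and> snd m ?l = z \<and> snd (fst m) = t \<and>
       (\<forall>k\<in>S. \<forall>j. 1 \<le> j \<and> j < n k \<longrightarrow> snd m (b (k, j)) = v k j)"
      by (intro bexI[of _ "((?x, t), ?u)"]) simp_all
  next
    fix a and m :: "((nat \<Rightarrow> 'k) \<times> 'k) \<times> (nat \<Rightarrow> 'k)"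
    obtain x s u where mm: "m = ((x, s), u)" by (metis surj_pair)
    show "fst (fst (lscale M a m)) = (\<lambda>j. a * fst (fst m) j) \<and>
       snd (lscale M a m) ?l = a * snd m ?l \<and>
       snd (fst (lscale M a m)) = a * snd (fst m) \<and>
       (\<lambda>k j. snd (lscale M a m) (b (k, j))) = (\<lambda>k j. a * snd m (b (k, j)))"
      by (simp add: mm Ms)
  qed (simp_all add: Ms)
qed

end

section \<open>Derived series of the right-hand sides\<close>

lemma derived_series_zero: "lie_closed L \<Longrightarrow> lzero L \<in> derived_series L k"
proof (induction k)
  case (Suc k)
  have "{lbracket L x y |x y. x \<in> derived_series L k \<and> y \<in> derived_series L k} \<subseteq> lcarrier L"
    using derived_series_subset[OF Suc.prems, of k] lie_closedD(3)[OF Suc.prems] by blast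
  from lie_subspace_span[OF Suc.prems this] show ?case by (simp add: lie_subspace_def)
qed (simp add: lie_closedD)

lemma derived_series_bracket:
  "x \<in> derived_series L k \<Longrightarrow> y \<in> derived_series L k \<Longrightarrow> lbracket L x y \<in> derived_series L (Suc k)"
  using lie_span_superset by fastforce

lemma derived_series_Suc_subset:
  assumes "derived_series L k \<subseteq> U" "lie_subspace L V" "\<And>x y. x \<in> U \<Longrightarrow> y \<in> U \<Longrightarrow> lbracket L x y \<in> V"
  shows "derived_series L (Suc k) \<subseteq> V"
  unfolding derived_series.simps by (rule lie_span_minimal) (use assms in blast)+

lemma step_solvableI:
  assumes "derived_series L k = {lzero L}" "\<And>j. j < k \<Longrightarrow> derived_series L j \<noteq> {lzero L}"
  shows "step_solvable k L"
proof -
  have "derived_length L = k"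
    unfolding derived_length_def using assms by (intro Least_equality) (auto simp: not_less[symmetric])
  then show ?thesis using assms(1) by (auto simp: step_solvable_def lie_solvable_def)
qed

lemma lie_closed_abelian_semidirect:
  "lie_closed (semidirect (abelian_lie k) (diag_map d) \<oplus>\<^sub>L abelian_lie l)"
  "lie_closed (semidirect heisenberg_lie (diag_map d) \<oplus>\<^sub>L abelian_lie l)"
  by (auto simp: lie_closed_def lie_direct_sum_def semidirect_def heisenberg_lie_def abelian_lie_def diag_map_def)

text \<open>The derived algebra lies in an abelian ideal, and [t, e_i] = d_i e_i with nonzero d_i
  keeps it from vanishing.\<close>

lemma step_solvable_abelian_semidirect:
  fixes d :: "nat \<Rightarrow> 'k::field"
  assumes i: "i \<in> {1..k}" "d i \<noteq> 0"
  shows "step_solvable 2 (semidirect (abelian_lie k) (diag_map d) \<oplus>\<^sub>L abelian_lie l)"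
proof -
  define L where "L = semidirect (abelian_lie k) (diag_map d) \<oplus>\<^sub>L abelian_lie l"
  have cl: "lie_closed L" unfolding L_def by (rule lie_closed_abelian_semidirect)
  have Ls: "lzero L = (((\<lambda>i. 0), 0), (\<lambda>i. 0))" "lcarrier L = ({v. \<forall>i. i \<notin> {1..k} \<longrightarrow> v i = 0} \<times> UNIV) \<times> {v. \<forall>i. i \<notin> {1..l} \<longrightarrow> v i = 0}"
    "lbracket L ((x, s), u) ((x', s'), u') = (((\<lambda>i. s * (d i * x' i) + - s' * (d i * x i)), 0), (\<lambda>i. 0))"
    "ladd L ((x, s), u) ((x', s'), u') = (((\<lambda>i. x i + x' i), s + s'), (\<lambda>i. u i + u' i))"
    "lscale L a ((x, s), u) = (((\<lambda>i. a * x i), a * s), (\<lambda>i. a * u i))"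
    for x s u x' s' u' a
    by (simp_all add: L_def lie_direct_sum_def semidirect_def abelian_lie_def diag_map_def)
  show ?thesis
    unfolding L_def[symmetric]
  proof (rule step_solvableI)
    let ?U = "{((x, 0), (\<lambda>i. 0)) | x. \<forall>i. i \<notin> {1..k} \<longrightarrow> x i = (0 :: 'k)}"
    have sub: "lie_subspace L ?U" and sub0: "lie_subspace L {lzero L}"
      unfolding lie_subspace_def by (auto simp: Ls)
    have 1: "derived_series L (Suc 0) \<subseteq> ?U"
      by (rule derived_series_Suc_subset[of L 0 "lcarrier L", OF _ sub]) (auto simp: Ls)
    have "derived_series L (Suc (Suc 0)) \<subseteq> {lzero L}"
      by (rule derived_series_Suc_subset[OF 1 sub0]) (auto simp: Ls)
    then show "derived_series L 2 = {lzero L}"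
      using derived_series_zero[OF cl, of 2] by (auto simp: numeral_2_eq_2)
    fix j :: nat assume "j < 2"
    let ?e = "((\<lambda>j. if j = i then 1 else 0, 0), \<lambda>i. 0) :: ((nat \<Rightarrow> 'k) \<times> 'k) \<times> (nat \<Rightarrow> 'k)"
    let ?t = "((\<lambda>j. 0, 1), \<lambda>i. 0) :: ((nat \<Rightarrow> 'k) \<times> 'k) \<times> (nat \<Rightarrow> 'k)"
    have te: "?e \<in> derived_series L 0" "?t \<in> derived_series L 0"
      using i by (auto simp: Ls)
    have "lbracket L ?t ?e \<in> derived_series L 1"
      using derived_series_bracket[OF te(2,1)] by simp
    moreover have "lbracket L ?t ?e \<noteq> lzero L"
      using i by (auto simp: Ls fun_eq_iff)
    moreover have "?t \<noteq> lzero L" by (simp add: Ls)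
    ultimately show "derived_series L j \<noteq> {lzero L}"
      using te \<open>j < 2\<close> by (cases "j = 0") (auto simp: less_2_cases_iff)
  qed
qed

text \<open>The derived series passes through the Heisenberg algebra and its centre: t reproduces
  e_1 and e_2, and their bracket e_3 survives in the second derived algebra.\<close>

lemma step_solvable_heisenberg_semidirect:
  "step_solvable 3 (semidirect heisenberg_lie (diag_map (\<lambda>i. if i = 3 then -1 else 1 :: 'k::field)) \<oplus>\<^sub>L abelian_lie l)"
proof -
  define L where "L = semidirect heisenberg_lie (diag_map (\<lambda>i. if i = 3 then -1 else 1 :: 'k)) \<oplus>\<^sub>L abelian_lie l"
  have cl: "lie_closed L" unfolding L_def by (rule lie_closed_abelian_semidirect)
  have Ls: "lzero L = (((\<lambda>i. 0), 0), (\<lambda>i. 0))" "lcarrier L = ({v. \<forall>i. i \<notin> {1..3} \<longrightarrow> v i = 0} \<times> UNIV) \<times> {v. \<forall>i. i \<notin> {1..l} \<longrightarrow> v i = 0}"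
    "lbracket L ((x, s), u) ((x', s'), u') =
      (((\<lambda>i. (if i = 3 then x 1 * x' 2 - x 2 * x' 1 else 0) + (s * ((if i = 3 then -1 else 1) * x' i) + - s' * ((if i = 3 then -1 else 1) * x i))), 0), (\<lambda>i. 0))"
    "ladd L ((x, s), u) ((x', s'), u') = (((\<lambda>i. x i + x' i), s + s'), (\<lambda>i. u i + u' i))"
    "lscale L a ((x, s), u) = (((\<lambda>i. a * x i), a * s), (\<lambda>i. a * u i))"
    for x s u x' s' u' a
    by (simp_all add: L_def lie_direct_sum_def semidirect_def heisenberg_lie_def abelian_lie_def diag_map_def)
  show ?thesis
    unfolding L_def[symmetric]
  proof (rule step_solvableI)
    let ?U = "\<lambda>A. {((x, 0), (\<lambda>i. 0)) | x. \<forall>i. i \<notin> A \<longrightarrow> x i = (0 :: 'k)}"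
    have sub: "lie_subspace L (?U A)" if "A \<subseteq> {1..3}" for A
      unfolding lie_subspace_def using that by (auto simp: Ls)
    have sub0: "lie_subspace L {lzero L}"
      unfolding lie_subspace_def by (auto simp: Ls)
    have 1: "derived_series L (Suc 0) \<subseteq> ?U {1..3}"
      by (rule derived_series_Suc_subset[of L 0 "lcarrier L" "?U {1..3}", OF _ sub]) (auto simp: Ls)
    have 2: "derived_series L (Suc (Suc 0)) \<subseteq> ?U {3}"
      by (rule derived_series_Suc_subset[OF 1 sub]) (auto simp: Ls)
    have 3: "derived_series L (Suc (Suc (Suc 0))) \<subseteq> {lzero L}"
      by (rule derived_series_Suc_subset[OF 2 sub0]) (auto simp: Ls intro!: ext)
    then show "derived_series L 3 = {lzero L}"
      using derived_series_zero[OF cl, of 3] by (auto simp: numeral_3_eq_3)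
    let ?e = "\<lambda>i. ((\<lambda>j. if j = i then 1 else 0, 0), \<lambda>i. 0) :: ((nat \<Rightarrow> 'k) \<times> 'k) \<times> (nat \<Rightarrow> 'k)"
    let ?t = "((\<lambda>j. 0, 1), \<lambda>i. 0) :: ((nat \<Rightarrow> 'k) \<times> 'k) \<times> (nat \<Rightarrow> 'k)"
    have in0: "?t \<in> derived_series L 0" "?e 1 \<in> derived_series L 0" "?e 2 \<in> derived_series L 0"
      by (auto simp: Ls)
    have "lbracket L ?t (?e 1) = ?e 1" "lbracket L ?t (?e 2) = ?e 2"
      by (auto simp: Ls)
    then have in1: "?e 1 \<in> derived_series L 1" "?e 2 \<in> derived_series L 1"
      using derived_series_bracket[OF in0(1,2)] derived_series_bracket[OF in0(1,3)] by simp_all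
    have "lbracket L (?e 1) (?e 2) = ?e 3"
      by (auto simp: Ls)
    then have in2: "?e 3 \<in> derived_series L 2"
      using derived_series_bracket[OF in1] by (simp add: numeral_2_eq_2)
    have ne: "?e i \<noteq> lzero L" for i
      by (auto simp: Ls fun_eq_iff)
    fix j :: nat assume "j < 3"
    then have "j = 0 \<or> j = 1 \<or> j = 2" by auto
    then show "derived_series L j \<noteq> {lzero L}"
      using in0(2) in1(1) in2 ne by (metis singletonD)
  qed
qed

lemma pointed_iso_isomorphic:
  assumes "pointed_iso L M \<phi>" "lie_closed L"
  shows "M \<cong>\<^sub>L L"
proof -
  obtain \<psi> where "pointed_iso M L \<psi>"
    by (rule pointed_iso_inverse[OF assms])
  then show ?thesis
    by (auto simp: lie_isomorphic_def pointed_iso_def)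
qed

lemma id_eq_diag_map: "id = diag_map (\<lambda>i. 1)"
  by (simp add: diag_map_def fun_eq_iff)

theorem theorem3p6:
  fixes r :: nat and n :: "nat \<Rightarrow> nat" and N :: nat
    and \<gg> :: "('k::field, 'k dp \<Rightarrow> 'k dp) lie_struct"
  assumes "CHAR('k) = 3"
    and "r \<ge> 1"
    and "\<forall>i\<in>{1..2 * r}. n i \<ge> 1"
    and "N = (\<Sum>i = 1..2 * r. n i)"
    and "\<gg> = hamiltonian r n"
  shows
    "(r > 1 \<longrightarrow> step_solvable 2 (Out \<gg>)) \<and>
     (r = 1 \<and> 1 < n 1 \<and> n 1 \<le> n 2 \<longrightarrow> step_solvable 3 (Out \<gg>)) \<and>
     (r = 1 \<and> 1 < n 1 \<and> n 1 \<le> n 2 \<longrightarrow>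
        Out \<gg> \<cong>\<^sub>L
          semidirect heisenberg_lie (diag_map (\<lambda>i. if i = 3 then -1 else 1))
            \<oplus>\<^sub>L abelian_lie (N - 2)) \<and>
     (r > 1 \<and> r mod 3 = 0 \<longrightarrow>
        Out \<gg> \<cong>\<^sub>L
          semidirect (abelian_lie (2 * r + 1)) id \<oplus>\<^sub>L abelian_lie (N - 2 * r)) \<and>
     (r > 1 \<and> r mod 3 = 1 \<longrightarrow>
        Out \<gg> \<cong>\<^sub>L
          semidirect (abelian_lie (2 * r + 1)) (diag_map (\<lambda>i. if i = 2 * r + 1 then -1 else 1))
            \<oplus>\<^sub>L abelian_lie (N - 2 * r)) \<and>
     (r > 1 \<and> r mod 3 = 2 \<longrightarrow>
        Out \<gg> \<cong>\<^sub>L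
          semidirect (abelian_lie (2 * r)) id \<oplus>\<^sub>L abelian_lie (N - 2 * r + 1))"
proof -
  interpret ham r n "TYPE('k)"
    using assms(1-3) by unfold_locales auto
  let ?H = "hamiltonian r n :: ('k, 'k dp \<Rightarrow> 'k dp) lie_struct"
  have heis: "\<exists>\<phi>. pointed_iso (semidirect heisenberg_lie (diag_map (\<lambda>i. if i = 3 then -1 else 1)) \<oplus>\<^sub>L abelian_lie (N - 2)) (Out ?H) \<phi>"
    if r: "r = 1" and n: "1 < n 1" "n 1 \<le> n 2"
  proof -
    interpret ham_big r n "TYPE('k)"
    proof unfold_locales
      fix i assume "r = 1" "i \<in> {1..2 * r}"
      then have "i = 1 \<or> i = 2" by auto
      then show "n i \<ge> 2" using n by auto
    qed
    have N: "ham_big.N r n = N"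
      by (simp add: N_def S_def assms(4))
    have "\<exists>\<phi>. pointed_iso (semidirect heisenberg_lie (diag_map (\<lambda>i. if i = 3 then -1 else 1 :: 'k)) \<oplus>\<^sub>L abelian_lie (N - 2 * r)) (Out ?H) \<phi>"
      unfolding N[symmetric]
    proof (rule Out_iso_top_left)
      have "3 \<notin> S" unfolding S_def using r by simp
      then show "(if j = 3 then -1 else 1 :: 'k) = 1" if "j \<in> S" for j using that by auto
      \<comment> \<open>For \<open>r = 1\<close> the scalar r + 1 is 2 = -1, and the top coordinate
        2r + 1 is 3.\<close>
      show "(if 2 * r + 1 = 3 then -1 else 1 :: 'k) = of_nat r + 1" using r two_eq by simp
    qed (use r in simp)
    then show ?thesis
      using r by simp
  qed
  have iso: "(r mod 3 = 0 \<longrightarrow> (\<exists>\<phi>. pointed_iso (semidirect (abelian_lie (2 * r + 1)) id \<oplus>\<^sub>L abelian_lie (N - 2 * r)) (Out ?H) \<phi>)) \<and>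
     (r mod 3 = 1 \<longrightarrow> (\<exists>\<phi>. pointed_iso (semidirect (abelian_lie (2 * r + 1)) (diag_map (\<lambda>i. if i = 2 * r + 1 then -1 else 1))
        \<oplus>\<^sub>L abelian_lie (N - 2 * r)) (Out ?H) \<phi>)) \<and>
     (r mod 3 = 2 \<longrightarrow> (\<exists>\<phi>. pointed_iso (semidirect (abelian_lie (2 * r)) id \<oplus>\<^sub>L abelian_lie (N - 2 * r + 1)) (Out ?H) \<phi>))"
    if r: "r > 1"
  proof -
    \<comment> \<open>The bound on \<open>n\<close> in \<open>ham_big\<close> concerns
      \<open>r = 1\<close>, so it holds vacuously here.\<close>
    interpret ham_big r n "TYPE('k)"
      using r by unfold_locales auto
    have N: "ham_big.N r n = N"
      by (simp add: N_def S_def assms(4))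
    have of_r: "(of_nat r :: 'k) = of_nat (r mod 3)"
      unfolding of_nat_mod by simp
    show ?thesis
    proof (intro conjI impI)
      assume "r mod 3 = 0"
      then show "\<exists>\<phi>. pointed_iso (semidirect (abelian_lie (2 * r + 1)) id \<oplus>\<^sub>L abelian_lie (N - 2 * r)) (Out ?H) \<phi>"
        using Out_iso_top_left[of "abelian_lie (2 * r + 1)" "\<lambda>i. 1"] r of_r
        unfolding N id_eq_diag_map by simp
    next
      assume "r mod 3 = 1"
      then show "\<exists>\<phi>. pointed_iso (semidirect (abelian_lie (2 * r + 1)) (diag_map (\<lambda>i. if i = 2 * r + 1 then -1 else 1))
        \<oplus>\<^sub>L abelian_lie (N - 2 * r)) (Out ?H) \<phi>"
        using Out_iso_top_left[of "abelian_lie (2 * r + 1)" "\<lambda>i. if i = 2 * r + 1 then -1 else 1"] r of_r two_eq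
        unfolding N by (simp add: S_def)
    next
      assume "r mod 3 = 2"
      then have "(of_nat r + 1 :: 'k) = 0" using of_r three_eq_0 by simp
      then show "\<exists>\<phi>. pointed_iso (semidirect (abelian_lie (2 * r)) id \<oplus>\<^sub>L abelian_lie (N - 2 * r + 1)) (Out ?H) \<phi>"
        using Out_iso_top_right r unfolding N by simp
    qed
  qed
  have cl: "lie_closed (semidirect (abelian_lie k) id \<oplus>\<^sub>L abelian_lie l :: ('k, ((nat \<Rightarrow> 'k) \<times> 'k) \<times> (nat \<Rightarrow> 'k)) lie_struct)" for k l
    unfolding id_eq_diag_map by (rule lie_closed_abelian_semidirect)
  have solv: "step_solvable 2 (semidirect (abelian_lie k) id \<oplus>\<^sub>L abelian_lie l :: ('k, ((nat \<Rightarrow> 'k) \<times> 'k) \<times> (nat \<Rightarrow> 'k)) lie_struct)" if "k \<ge> 1" for k l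
    unfolding id_eq_diag_map by (rule step_solvable_abelian_semidirect[of 1]) (use that in auto)
  have solv': "step_solvable 2 (semidirect (abelian_lie (2 * r + 1)) (diag_map (\<lambda>i. if i = 2 * r + 1 then -1 else 1 :: 'k)) \<oplus>\<^sub>L abelian_lie l)" for l
    by (rule step_solvable_abelian_semidirect[of 1]) auto
  have "step_solvable 2 (Out ?H)" if r: "r > 1"
  proof -
    consider "r mod 3 = 0" | "r mod 3 = 1" | "r mod 3 = 2" by linarith
    then show ?thesis
    proof cases
      case 1
      then obtain \<phi> where "pointed_iso (semidirect (abelian_lie (2 * r + 1)) id \<oplus>\<^sub>L abelian_lie (N - 2 * r)) (Out ?H) \<phi>"
        using iso[OF r] by metis
      then show ?thesis by (rule step_solvable_iso[OF _ cl solv]) simp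
    next
      case 2
      then obtain \<phi> where "pointed_iso (semidirect (abelian_lie (2 * r + 1)) (diag_map (\<lambda>i. if i = 2 * r + 1 then -1 else 1))
        \<oplus>\<^sub>L abelian_lie (N - 2 * r)) (Out ?H) \<phi>"
        using iso[OF r] by metis
      then show ?thesis by (rule step_solvable_iso[OF _ lie_closed_abelian_semidirect(1) solv'])
    next
      case 3
      then obtain \<phi> where "pointed_iso (semidirect (abelian_lie (2 * r)) id \<oplus>\<^sub>L abelian_lie (N - 2 * r + 1)) (Out ?H) \<phi>"
        using iso[OF r] by metis
      then show ?thesis by (rule step_solvable_iso[OF _ cl solv]) (use r in simp)
    qed
  qed
  moreover have "step_solvable 3 (Out ?H)" if h: "r = 1" "1 < n 1" "n 1 \<le> n 2"
  proof -
    obtain \<phi> where "pointed_iso (semidirect heisenberg_lie (diag_map (\<lambda>i. if i = 3 then -1 else 1)) \<oplus>\<^sub>L abelian_lie (N - 2)) (Out ?H) \<phi>"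
      using heis[OF h] ..
    then show ?thesis
      by (rule step_solvable_iso[OF _ lie_closed_abelian_semidirect(2) step_solvable_heisenberg_semidirect])
  qed
  ultimately show ?thesis
    unfolding assms(5)
  proof (intro conjI impI)
    assume "r = 1 \<and> 1 < n 1 \<and> n 1 \<le> n 2"
    then obtain \<phi> where "pointed_iso (semidirect heisenberg_lie (diag_map (\<lambda>i. if i = 3 then -1 else 1)) \<oplus>\<^sub>L abelian_lie (N - 2)) (Out ?H) \<phi>"
      using heis by metis
    then show "Out ?H \<cong>\<^sub>L semidirect heisenberg_lie (diag_map (\<lambda>i. if i = 3 then -1 else 1)) \<oplus>\<^sub>L abelian_lie (N - 2)"
      by (rule pointed_iso_isomorphic[OF _ lie_closed_abelian_semidirect(2)])
  next
    assume "r > 1 \<and> r mod 3 = 0"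
    then obtain \<phi> where "pointed_iso (semidirect (abelian_lie (2 * r + 1)) id \<oplus>\<^sub>L abelian_lie (N - 2 * r)) (Out ?H) \<phi>"
      using iso by metis
    then show "Out ?H \<cong>\<^sub>L semidirect (abelian_lie (2 * r + 1)) id \<oplus>\<^sub>L abelian_lie (N - 2 * r)"
      by (rule pointed_iso_isomorphic[OF _ cl])
  next
    assume "r > 1 \<and> r mod 3 = 1"
    then obtain \<phi> where "pointed_iso (semidirect (abelian_lie (2 * r + 1)) (diag_map (\<lambda>i. if i = 2 * r + 1 then -1 else 1))
        \<oplus>\<^sub>L abelian_lie (N - 2 * r)) (Out ?H) \<phi>"
      using iso by metis
    then show "Out ?H \<cong>\<^sub>L semidirect (abelian_lie (2 * r + 1)) (diag_map (\<lambda>i. if i = 2 * r + 1 then -1 else 1))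
        \<oplus>\<^sub>L abelian_lie (N - 2 * r)"
      by (rule pointed_iso_isomorphic[OF _ lie_closed_abelian_semidirect(1)])
  next
    assume "r > 1 \<and> r mod 3 = 2"
    then obtain \<phi> where "pointed_iso (semidirect (abelian_lie (2 * r)) id \<oplus>\<^sub>L abelian_lie (N - 2 * r + 1)) (Out ?H) \<phi>"
      using iso by metis
    then show "Out ?H \<cong>\<^sub>L semidirect (abelian_lie (2 * r)) id \<oplus>\<^sub>L abelian_lie (N - 2 * r + 1)"
      by (rule pointed_iso_isomorphic[OF _ cl])
  qed simp_all
qed

end
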